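(* Let $X=\mathbb C^n$ and let $\varOmega\Subset T^*X$ (conically) be an open conic subset. For any $P(t;z,\zeta,\eta),Q(t;z,\zeta,\eta)\in\widehat{\mathfrak S}_{\rm cl}(\varOmega;S)$ set $$Q\circ P(t;z,\zeta,\eta)=e^{t\langle\partial_{\zeta'},\partial_{z'}\rangle}Q(t;z,\zeta',\eta)\,P(t;z',\zeta,\eta)\Big|_{z'=z,\ \zeta'=\zeta}=e^{t\langle\partial_{\zeta'},\partial_{z'}\rangle}Q(t;z,\zeta+\zeta',\eta)\,P(t;z+z',\zeta,\eta)\Big|_{z'=0,\ \zeta'=0}.$$ (1) $Q\circ P\in\widehat{\mathfrak S}_{\rm cl}(\varOmega;S)$. Moreover, if either $P$ or $Q$ is an element of $\widehat{\mathfrak N}_{\rm cl}(\varOmega;S)$, then $Q\circ P\in\widehat{\mathfrak N}_{\rm cl}(\varOmega;S)$. (2) $R\circ(Q\circ P)=(R\circ Q)\circ P$ holds (for $P,Q,R\in\widehat{\mathfrak S}_{\rm cl}(\varOmega;S)$). (3) Let $\varPhi(w)=z$ be a holomorphic coordinate transformation. Then $$\varPhi^*Q\circ\varPhi^*P(t;w,\lambda,\eta)=\varPhi^*(Q\circ P)(t;w,\lambda,\eta).$$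
   Context: $\|z\|=\max_i|z_i|$. $V\Subset U$ conically means that $V$ is generated by a relatively compact subset of $U$ (contained in $\mathbb R_{>0}K$ with $K\subset U$ compact). For an open conic $\varOmega$ and $\rho\ge0$, $\varOmega_\rho$ is the closure of $\bigcup_{(z;\zeta)\in\varOmega}\{(z+z';\zeta+\zeta');\ \|z'\|\le\rho,\ \|\zeta'\|\le\rho\|\zeta\|\}$, $V[d]=\{(z;\zeta)\in V;\ \|\zeta\|\ge d\}$, $d_\rho=d(1-\rho)$. $S=\{\eta\in\mathbb C;\ 0<|\eta|<r,\ |\arg\eta|<\theta/4\}$ with $r,\theta\in]0,\frac12[$. Functions on $\varOmega_\rho[d_\rho]\times S$ are understood to be holomorphic on a neighborhood of it; $t$ is an indeterminate. $\widehat{\mathfrak N}_{\rm cl}(\varOmega;S)$: formal series $P=\sum_{\nu\ge0}t^\nu P_\nu(z,\zeta,\eta)$ such that, for some $d>0$, $\rho\in]0,1[$, all $P_\nu$ are holomorphic on $\varOmega_\rho[d_\rho]\times S$, and there is $A>0$ such that for every $Z\Subset S$, $h>0$ there is $C_{h,Z}>0$ with $\bigl|\sum_{\nu=0}^{m-1}P_\nu\bigr|\le C_{h,Z}\,m!\,A^me^{h\|\zeta\|}/\|\eta\zeta\|^m$ for all $m\in\mathbb N$ on $\varOmega_\rho[d_\rho]\times Z$. $\widehat{\mathfrak S}_{\rm cl}(\varOmega;S)$: formal series $P=\sum t^\nu P_\nu$ such that, for some $d>0$, $\rho\in]0,1[$, all $P_\nu$ are holomorphic on $\varOmega_\rho[d_\rho]\times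 S$; there is $A>0$ such that for every $Z\Subset S$, $h>0$ there is $C_{h,Z}>0$ with $|P_\nu|\le C_{h,Z}\,\nu!\,A^\nu e^{h\|\zeta\|}/\|\eta\zeta\|^\nu$ for all $\nu\ge0$ on $\varOmega_\rho[d_\rho]\times Z$; and $\partial_\eta P\in\widehat{\mathfrak N}_{\rm cl}(\varOmega;S)$. Coordinate transformation: let $(z;\zeta)$, $(w;\lambda)$ be the cotangent coordinates near $\operatorname{Cl}\varOmega$ associated with local coordinates $z$, $w$ and $z=\varPhi(w)$. $J^*_\varPhi(z',z)$ is a holomorphic $n\times n$ matrix, for $z'$ near $z$, with $\varPhi^{-1}(z')-\varPhi^{-1}(z)=J^*_\varPhi(z',z)(z'-z)$, and $$\varPhi^*P(t;w,\lambda,\eta)=e^{t\langle\partial_{\zeta'},\partial_{z'}\rangle}P\bigl(t;\varPhi(w),\zeta'+{}^{\mathsf t}\!J^*_\varPhi(\varPhi(w)+z',\varPhi(w))\lambda,\eta\bigr)\Big|_{z'=0,\ \zeta'=0}.$$ In (3), the left product $\circ$ is formed in the coordinates $(w;\lambda)$. *)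

theory Defs
  imports "HOL-Complex_Analysis.Complex_Analysis"
begin

text \<open>Points of \<open>T\<^sup>*\<complex>\<^sup>n\<close> are pairs \<open>(z, \<zeta>)\<close>. The norm is the maximum of the
  moduli of the components; it differs from \<open>norm\<close> and from \<open>infnorm\<close> on \<open>complex ^ 'n\<close>.\<close>

type_synonym 'n cotangent = "(complex ^ 'n) \<times> (complex ^ 'n)"

definition maxnorm :: "complex ^ 'n \<Rightarrow> real" where
  "maxnorm z = Max (range (\<lambda>i. cmod (z $ i)))"

definition fiber_conic :: "('n::finite) cotangent set \<Rightarrow> bool" where
  "fiber_conic V \<longleftrightarrow> (\<forall>(z, \<zeta>) \<in> V. \<forall>c>0. (z, c *\<^sub>R \<zeta>) \<in> V)"

definition conically_compact_in :: "('n::finite) cotangent set \<Rightarrow> 'n cotangent set \<Rightarrow> bool" where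
  "conically_compact_in V U \<longleftrightarrow>
     (\<exists>K. compact K \<and> K \<subseteq> U \<and> V \<subseteq> {(z, c *\<^sub>R \<zeta>) | z \<zeta> c. (z, \<zeta>) \<in> K \<and> c > 0})"

definition relatively_compact_in :: "complex set \<Rightarrow> complex set \<Rightarrow> bool" where
  "relatively_compact_in Z S \<longleftrightarrow> compact (closure Z) \<and> closure Z \<subseteq> S"

definition thicken :: "('n::finite) cotangent set \<Rightarrow> real \<Rightarrow> 'n cotangent set" where
  "thicken \<Omega> \<rho> = closure {(z + z', \<zeta> + \<zeta>') | z \<zeta> z' \<zeta>'.
      (z, \<zeta>) \<in> \<Omega> \<and> maxnorm z' \<le> \<rho> \<and> maxnorm \<zeta>' \<le> \<rho> * maxnorm \<zeta>}"

definition cut_off :: "('n::finite) cotangent set \<Rightarrow> real \<Rightarrow> 'n cotangent set" where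
  "cut_off V d = {(z, \<zeta>) \<in> V. maxnorm \<zeta> \<ge> d}"

text \<open>The set \<open>\<Omega>\<^sub>\<rho>[d\<^sub>\<rho>]\<close>, where \<open>d\<^sub>\<rho> = d (1 - \<rho>)\<close>.\<close>

definition symbol_domain :: "('n::finite) cotangent set \<Rightarrow> real \<Rightarrow> real \<Rightarrow> 'n cotangent set" where
  "symbol_domain \<Omega> d \<rho> = cut_off (thicken \<Omega> \<rho>) (d * (1 - \<rho>))"

definition sector :: "real \<Rightarrow> real \<Rightarrow> complex set" where
  "sector r \<theta> = {\<eta>. 0 < cmod \<eta> \<and> cmod \<eta> < r \<and> \<bar>Arg \<eta>\<bar> < \<theta> / 4}"


text \<open>Holomorphy in several variables: Frechet differentiability with complex linear
  derivative. The argument \<open>I\<close> is multiplication by the imaginary unit on the domain; a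
  real linear map commuting with it is complex linear. Vector- and matrix-valued maps are
  treated componentwise.\<close>

definition holo_on :: "('a::real_normed_vector \<Rightarrow> 'a) \<Rightarrow> ('a \<Rightarrow> complex) \<Rightarrow> 'a set \<Rightarrow> bool" where
  "holo_on I f U \<longleftrightarrow>
     (\<forall>x\<in>U. \<exists>D. (f has_derivative D) (at x) \<and> (\<forall>v. D (I v) = \<i> * D v))"

definition mult_i :: "complex ^ 'n \<Rightarrow> complex ^ 'n" where
  "mult_i z = \<i> *s z"

definition mult_i2 :: "(complex ^ 'n) \<times> (complex ^ 'n) \<Rightarrow> (complex ^ 'n) \<times> (complex ^ 'n)" where
  "mult_i2 = (\<lambda>(z, \<zeta>). (\<i> *s z, \<i> *s \<zeta>))"

definition mult_i3 ::
  "(complex ^ 'n) \<times> (complex ^ 'n) \<times> complex \<Rightarrow> (complex ^ 'n) \<times> (complex ^ 'n) \<times> complex" where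
  "mult_i3 = (\<lambda>(z, \<zeta>, \<eta>). (\<i> *s z, \<i> *s \<zeta>, \<i> * \<eta>))"


text \<open>A formal series \<open>P = \<Sum>\<^sub>\<nu> t\<^sup>\<nu> P\<^sub>\<nu>(z, \<zeta>, \<eta>)\<close> is its sequence of coefficients. These are total
  functions, so only their values near the relevant domains are meaningful.\<close>

type_synonym 'n formal_symbol = "nat \<Rightarrow> complex ^ 'n \<Rightarrow> complex ^ 'n \<Rightarrow> complex \<Rightarrow> complex"

text \<open>All coefficients are holomorphic on a neighborhood of \<open>\<Omega>\<^sub>\<rho>[d\<^sub>\<rho>] \<times> S\<close>.\<close>

definition coeffs_holo ::
  "('n::finite) cotangent set \<Rightarrow> complex set \<Rightarrow> real \<Rightarrow> real \<Rightarrow> 'n formal_symbol \<Rightarrow> bool" where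
  "coeffs_holo \<Omega> S d \<rho> P \<longleftrightarrow>
     (\<forall>\<nu>. \<exists>U. open U \<and> {(z, \<zeta>, \<eta>). (z, \<zeta>) \<in> symbol_domain \<Omega> d \<rho> \<and> \<eta> \<in> S} \<subseteq> U \<and>
        holo_on mult_i3 (\<lambda>(z, \<zeta>, \<eta>). P \<nu> z \<zeta> \<eta>) U)"

definition N_cl :: "('n::finite) cotangent set \<Rightarrow> complex set \<Rightarrow> 'n formal_symbol set" where
  "N_cl \<Omega> S = {P. \<exists>d>0. \<exists>\<rho>\<in>{0<..<1}. coeffs_holo \<Omega> S d \<rho> P \<and>
     (\<exists>A>0. \<forall>Z h. relatively_compact_in Z S \<and> h > 0 \<longrightarrow>
       (\<exists>C>0. \<forall>m. \<forall>(z, \<zeta>) \<in> symbol_domain \<Omega> d \<rho>. \<forall>\<eta>\<in>Z.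
          cmod (\<Sum>\<nu><m. P \<nu> z \<zeta> \<eta>)
            \<le> C * fact m * A ^ m * exp (h * maxnorm \<zeta>) / maxnorm (\<eta> *s \<zeta>) ^ m))}"

definition d_eta :: "('n::finite) formal_symbol \<Rightarrow> 'n formal_symbol" where
  "d_eta P = (\<lambda>\<nu> z \<zeta> \<eta>. deriv (\<lambda>x. P \<nu> z \<zeta> x) \<eta>)"

definition S_cl :: "('n::finite) cotangent set \<Rightarrow> complex set \<Rightarrow> 'n formal_symbol set" where
  "S_cl \<Omega> S = {P. (\<exists>d>0. \<exists>\<rho>\<in>{0<..<1}. coeffs_holo \<Omega> S d \<rho> P \<and>
     (\<exists>A>0. \<forall>Z h. relatively_compact_in Z S \<and> h > 0 \<longrightarrow>
       (\<exists>C>0. \<forall>\<nu>. \<forall>(z, \<zeta>) \<in> symbol_domain \<Omega> d \<rho>. \<forall>\<eta>\<in>Z.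
          cmod (P \<nu> z \<zeta> \<eta>)
            \<le> C * fact \<nu> * A ^ \<nu> * exp (h * maxnorm \<zeta>) / maxnorm (\<eta> *s \<zeta>) ^ \<nu>))) \<and>
     d_eta P \<in> N_cl \<Omega> S}"

text \<open>Finitely many elements of \<open>S_cl \<Omega> S\<close> have coefficients that are holomorphic on a
  neighborhood of a common \<open>\<Omega>\<^sub>\<rho>[d\<^sub>\<rho>] \<times> S\<close>, on which identities between them can be stated.\<close>

lemma maxnorm_nonneg: "maxnorm (z :: complex ^ 'n) \<ge> 0"
proof -
  have "cmod (z $ undefined) \<le> maxnorm z"
    unfolding maxnorm_def by (rule Max_ge) auto
  then show ?thesis by (rule order_trans[OF norm_ge_zero])
qed

lemma coeffs_holo_mono:
  assumes "coeffs_holo \<Omega> S d \<rho> P" "\<rho>' \<le> \<rho>" "d * (1 - \<rho>) \<le> d' * (1 - \<rho>')"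
  shows "coeffs_holo \<Omega> S d' \<rho>' P"
proof -
  have "\<rho>' * maxnorm \<zeta> \<le> \<rho> * maxnorm \<zeta>" for \<zeta> :: "complex ^ 'a"
    using assms(2) by (intro mult_right_mono maxnorm_nonneg)
  then have "thicken \<Omega> \<rho>' \<subseteq> thicken \<Omega> \<rho>"
    unfolding thicken_def using assms(2) by (intro closure_mono) (blast intro: order_trans)
  then have "symbol_domain \<Omega> d' \<rho>' \<subseteq> symbol_domain \<Omega> d \<rho>"
    unfolding symbol_domain_def cut_off_def using assms(3) by auto
  then have *: "{(z, \<zeta>, \<eta>). (z, \<zeta>) \<in> symbol_domain \<Omega> d' \<rho>' \<and> \<eta> \<in> S} \<subseteq>
      {(z, \<zeta>, \<eta>). (z, \<zeta>) \<in> symbol_domain \<Omega> d \<rho> \<and> \<eta> \<in> S}"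
    by auto
  show ?thesis
    using assms(1) subset_trans[OF *] unfolding coeffs_holo_def by meson
qed

lemma common_symbol_domain:
  assumes "finite F" "F \<subseteq> S_cl \<Omega> S"
  shows "\<exists>d>0. \<exists>\<rho>\<in>{0<..<1}. \<forall>P\<in>F. coeffs_holo \<Omega> S d \<rho> P"
  using assms
proof (induction F rule: finite_induct)
  case empty
  show ?case using dense[of 0 "1::real"] by (auto intro: exI[of _ 1])
next
  case (insert P F)
  obtain d1 \<rho>1 where 1: "d1 > 0" "0 < \<rho>1" "\<rho>1 < 1" "\<forall>P\<in>F. coeffs_holo \<Omega> S d1 \<rho>1 P"
    using insert by auto
  obtain d2 \<rho>2 where 2: "d2 > 0" "0 < \<rho>2" "\<rho>2 < 1" "coeffs_holo \<Omega> S d2 \<rho>2 P"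
    using insert.prems by (auto simp: S_cl_def)
  define \<rho> where "\<rho> = min \<rho>1 \<rho>2"
  define d where "d = max (d1 * (1 - \<rho>1)) (d2 * (1 - \<rho>2)) / (1 - \<rho>)"
  have \<rho>: "0 < \<rho>" "\<rho> < 1" "\<rho> \<le> \<rho>1" "\<rho> \<le> \<rho>2"
    using 1 2 by (auto simp: \<rho>_def)
  have d: "d * (1 - \<rho>) = max (d1 * (1 - \<rho>1)) (d2 * (1 - \<rho>2))"
    using \<rho> by (simp add: d_def)
  have "max (d1 * (1 - \<rho>1)) (d2 * (1 - \<rho>2)) > 0"
    using 1 by (simp add: less_max_iff_disj)
  then have "d > 0" using \<rho> by (simp add: d_def)
  moreover have "\<forall>P\<in>insert P F. coeffs_holo \<Omega> S d \<rho> P"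
    using 1(4) 2(4) \<rho> d by (auto intro: coeffs_holo_mono)
  ultimately show ?case using \<rho>(1,2) by (intro exI[of _ d] conjI bexI[of _ \<rho>]) auto
qed



definition partial_deriv :: "'n \<Rightarrow> (complex ^ 'n \<Rightarrow> complex) \<Rightarrow> complex ^ 'n \<Rightarrow> complex" where
  "partial_deriv i f z = deriv (\<lambda>s. f (z + axis i s)) 0"

text \<open>\<open>\<langle>\<partial>\<^sub>\<zeta>\<^sub>', \<partial>\<^sub>z\<^sub>'\<rangle> = \<Sum>\<^sub>i \<partial>\<^sup>2 / \<partial>\<zeta>'\<^sub>i \<partial>z'\<^sub>i\<close>, acting on functions of \<open>(z', \<zeta>')\<close>.\<close>

definition pairing_deriv ::
  "(complex ^ 'n \<Rightarrow> complex ^ 'n \<Rightarrow> complex) \<Rightarrow> (complex ^ 'n \<Rightarrow> complex ^ 'n \<Rightarrow> complex)" where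
  "pairing_deriv f =
     (\<lambda>z' \<zeta>'. \<Sum>i\<in>UNIV. partial_deriv i (\<lambda>y. partial_deriv i (\<lambda>x. f x y) z') \<zeta>')"

text \<open>Coefficients of \<open>e\<^bsup>t\<langle>\<partial>\<^sub>\<zeta>\<^sub>', \<partial>\<^sub>z\<^sub>'\<rangle>\<^esup> F\<close> for a formal series \<open>F = \<Sum>\<^sub>m t\<^sup>m F\<^sub>m(z', \<zeta>')\<close>.\<close>

definition exp_pairing ::
  "(nat \<Rightarrow> complex ^ 'n \<Rightarrow> complex ^ 'n \<Rightarrow> complex) \<Rightarrow>
   (nat \<Rightarrow> complex ^ 'n \<Rightarrow> complex ^ 'n \<Rightarrow> complex)" where
  "exp_pairing F \<nu> = (\<lambda>z' \<zeta>'. \<Sum>k\<le>\<nu>. (pairing_deriv ^^ k) (F (\<nu> - k)) z' \<zeta>' / fact k)"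

definition symbol_comp ::
  "('n::finite) formal_symbol \<Rightarrow> 'n formal_symbol \<Rightarrow> 'n formal_symbol" (infixl "\<circ>\<^sub>t" 70) where
  "Q \<circ>\<^sub>t P = (\<lambda>\<nu> z \<zeta> \<eta>.
     exp_pairing (\<lambda>m z' \<zeta>'. \<Sum>j\<le>m. Q j z \<zeta>' \<eta> * P (m - j) z' \<zeta> \<eta>) \<nu> z \<zeta>)"

lemma exp_pairing_shift:
  "exp_pairing (\<lambda>m z' \<zeta>'. F m (a + z') (b + \<zeta>')) \<nu> z' \<zeta>' = exp_pairing F \<nu> (a + z') (b + \<zeta>')"
proof -
  have "(pairing_deriv ^^ k) (\<lambda>z' \<zeta>'. f (a + z') (b + \<zeta>')) =
    (\<lambda>z' \<zeta>'. (pairing_deriv ^^ k) f (a + z') (b + \<zeta>'))" for k f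
    by (induction k) (simp_all add: pairing_deriv_def partial_deriv_def add.assoc)
  then show ?thesis by (simp add: exp_pairing_def)
qed

text \<open>The equivalent form of the composition with increments evaluated at \<open>0\<close>.\<close>

lemma symbol_comp_shift:
  "(Q \<circ>\<^sub>t P) \<nu> z \<zeta> \<eta> =
     exp_pairing (\<lambda>m z' \<zeta>'. \<Sum>j\<le>m. Q j z (\<zeta> + \<zeta>') \<eta> * P (m - j) (z + z') \<zeta> \<eta>) \<nu> 0 0"
  unfolding symbol_comp_def
  using exp_pairing_shift[of "\<lambda>m z' \<zeta>'. \<Sum>j\<le>m. Q j z \<zeta>' \<eta> * P (m - j) z' \<zeta> \<eta>" z \<zeta> \<nu> 0 0]
  by simp


text \<open>\<open>z = \<Phi>(w)\<close> maps the open set \<open>W\<close> biholomorphically onto the open set \<open>Z\<close>.\<close>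

definition coord_transformation ::
  "(complex ^ 'n \<Rightarrow> complex ^ 'n) \<Rightarrow> (complex ^ 'n) set \<Rightarrow> (complex ^ 'n) set \<Rightarrow> bool" where
  "coord_transformation \<Phi> W Z \<longleftrightarrow>
     open W \<and> open Z \<and> bij_betw \<Phi> W Z \<and>
     (\<forall>i. holo_on mult_i (\<lambda>w. \<Phi> w $ i) W) \<and>
     (\<forall>i. holo_on mult_i (\<lambda>z. inv_into W \<Phi> z $ i) Z)"

text \<open>\<open>J z' z\<close> is a possible choice of \<open>J\<^sup>*\<^sub>\<Phi>(z', z)\<close>; it is not unique for \<open>n \<ge> 2\<close>. On the
  diagonal it is the Jacobian matrix of \<open>\<Phi>\<^sup>-\<^sup>1\<close>.\<close>

definition is_J_star ::
  "(complex ^ 'n \<Rightarrow> complex ^ 'n \<Rightarrow> complex ^ 'n ^ 'n) \<Rightarrow>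
   (complex ^ 'n \<Rightarrow> complex ^ 'n) \<Rightarrow> (complex ^ 'n) set \<Rightarrow> (complex ^ 'n) set \<Rightarrow> bool" where
  "is_J_star J \<Phi> W Z \<longleftrightarrow>
     (\<exists>N. open N \<and> (\<forall>z\<in>Z. (z, z) \<in> N) \<and> N \<subseteq> Z \<times> Z \<and>
        (\<forall>i j. holo_on mult_i2 (\<lambda>(z', z). J z' z $ i $ j) N) \<and>
        (\<forall>(z', z) \<in> N. inv_into W \<Phi> z' - inv_into W \<Phi> z = J z' z *v (z' - z)))"

definition pullback ::
  "(complex ^ 'n \<Rightarrow> complex ^ 'n) \<Rightarrow> (complex ^ 'n \<Rightarrow> complex ^ 'n \<Rightarrow> complex ^ 'n ^ 'n) \<Rightarrow>
   ('n::finite) formal_symbol \<Rightarrow> 'n formal_symbol" where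
  "pullback \<Phi> J P = (\<lambda>\<nu> w \<mu> \<eta>.
     exp_pairing (\<lambda>m z' \<zeta>'. P m (\<Phi> w) (\<zeta>' + transpose (J (\<Phi> w + z') (\<Phi> w)) *v \<mu>) \<eta>) \<nu> 0 0)"

text \<open>The \<open>z\<close>-coordinates \<open>(z; \<zeta>)\<close> of the covector with \<open>w\<close>-coordinates \<open>(w; \<mu>)\<close>.\<close>

definition cotangent_map ::
  "(complex ^ 'n \<Rightarrow> complex ^ 'n) \<Rightarrow> (complex ^ 'n \<Rightarrow> complex ^ 'n \<Rightarrow> complex ^ 'n ^ 'n) \<Rightarrow>
   ('n::finite) cotangent \<Rightarrow> 'n cotangent" where
  "cotangent_map \<Phi> J = (\<lambda>(w, \<mu>). (\<Phi> w, transpose (J (\<Phi> w) (\<Phi> w)) *v \<mu>))"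

end

(* Formally, the value of exp(t <d_zeta', d_z'>) a at 0 is the expansion of an oscillatory
   integral of a(z', zeta') exp(-<z', zeta'> / t), so it only depends on a up to changes of
   variables that preserve the phase. Associativity of the composition and its compatibility with
   coordinate transformations are such changes, in two pairs of variables (y, eta), (x, zeta):
   adding to the covectors terms that are orthogonal to (y, x), and the transvections
   eta := eta + J(y)^T zeta compensated by x := x - J(y) y. Each of them lies on a path
   a(X + s V(X)), along which the coefficients are constant: multiplication by a position
   coordinate followed by evaluation at 0 amounts to t times the derivative in the dual covector,
   and this makes the s-derivative cancel.

   The growth estimates follow from Cauchy's inequalities: the k-fold pairing of Q_j and P_i loses
   k^(2k) / k! <= e^(2k) k!, and k! j! i! <= (k + j + i)!. Partial sums of a composition are
   compositions with the partial sums of either factor, which gives the null symbols. *)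
theory Submission
  imports Defs
begin

text \<open>Coefficients are total functions and the operators are built from \<open>deriv\<close>,
  so a formula can be trusted only at points of holomorphy. All identities are therefore proved for
  germs, and equalities are kept on neighbourhoods because further derivatives follow. This is why
  the identities hold on the whole given domain, whereas estimates have to shrink it. The integrals
  themselves are never formed. Constant coefficient second order operators play their role; these
  commute with derivatives in adjoined variables, and the path parameter, \<eta> and the base point
  are all treated as adjoined coordinates. For the coordinate change the difficulty is that
  \<open>J\<close> depends on two points: the required covector shift is orthogonal to the positions
  only because differences of the inverse map telescope. In the estimates the covector radius is
  proportional to the size of \<zeta>, so each pairing gains one power of it. With \<epsilon> =
  \<rho>/8 the constant \<open>A\<close> becomes
  \<open>4 * (2 * A + n * exp 2 / \<epsilon>^2)\<close>, free of \<open>Z\<close> and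
  \<open>h\<close>, while \<open>h\<close> is compensated by starting from
  \<open>h / 3\<close>.\<close>

no_notation fps_nth (infixl "$" 75)

section \<open>Complex structures and holomorphic germs\<close>

text \<open>A real euclidean space with a complex structure \<open>imul\<close>: one notion of complex derivative
  then serves \<open>\<complex>\<^sup>n\<close>, its cotangent space and all products with parameter spaces.\<close>

class complex_space = euclidean_space +
  fixes imul :: "'a \<Rightarrow> 'a"
  assumes imul_add: "imul (x + y) = imul x + imul y"
    and imul_scaleR: "imul (c *\<^sub>R x) = c *\<^sub>R imul x"
    and imul_imul: "imul (imul x) = - x"

instantiation complex :: complex_space
begin
definition "imul_complex (z :: complex) = \<i> * z"
instance by standard (auto simp: imul_complex_def algebra_simps scaleR_conv_of_real)
end

instantiation vec :: (complex_space, finite) complex_space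
begin
definition "imul_vec (z :: 'a ^ 'b) = (\<chi> i. imul (z $ i))"
instance by standard (auto simp: imul_vec_def vec_eq_iff imul_add imul_scaleR imul_imul)
end

instantiation prod :: (complex_space, complex_space) complex_space
begin
definition "imul_prod (z :: 'a \<times> 'b) = (imul (fst z), imul (snd z))"
instance by standard (auto simp: imul_prod_def imul_add imul_scaleR imul_imul prod_eq_iff)
end

text \<open>Only \<open>imul\<close> is a class parameter. Deriving scalar multiplication from it
  makes every real linear map that commutes with \<open>imul\<close> complex linear.\<close>

definition cscale :: "complex \<Rightarrow> 'a::complex_space \<Rightarrow> 'a" where
  "cscale c x = Re c *\<^sub>R x + Im c *\<^sub>R imul x"

lemma linear_imul: "linear (imul :: 'a::complex_space \<Rightarrow> 'a)"
  by (rule linearI) (auto simp: imul_add imul_scaleR)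

lemma imul_0 [simp]: "imul (0::'a::complex_space) = 0"
  using linear_0[OF linear_imul] .

lemma cscale_complex [simp]: "cscale c (x :: complex) = c * x"
  by (simp add: cscale_def imul_complex_def complex_eq_iff)

lemma cscale_vec: "cscale c (x :: 'a::complex_space ^ 'b) = (\<chi> i. cscale c (x $ i))"
  by (simp add: cscale_def imul_vec_def vec_eq_iff)

lemma cscale_vec_complex: "cscale c (x :: complex ^ 'b) = c *s x"
  by (simp add: cscale_vec vec_eq_iff)

lemma cscale_Pair [simp]: "cscale c (x, y) = (cscale c x, cscale c y)"
  by (simp add: cscale_def imul_prod_def)

lemma cscale_simps [simp]: "cscale 0 x = 0" "cscale c 0 = 0" "cscale 1 x = x"
  by (simp_all add: cscale_def)

lemma cscale_imaginary: "cscale \<i> x = imul x"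
  by (simp add: cscale_def)

lemma cscale_add_right: "cscale a (x + y) = cscale a x + cscale a y"
  by (simp add: cscale_def algebra_simps imul_add)

lemma cscale_cscale: "cscale a (cscale b x) = cscale (a * b) x"
  by (simp add: cscale_def algebra_simps imul_add imul_scaleR imul_imul)

lemma bounded_bilinear_cscale: "bounded_bilinear (cscale :: complex \<Rightarrow> 'a::complex_space \<Rightarrow> 'a)"
proof -
  have "bilinear (cscale :: complex \<Rightarrow> 'a \<Rightarrow> 'a)"
    unfolding bilinear_def
    by (auto intro!: linearI simp: cscale_def algebra_simps imul_add imul_scaleR)
  then show ?thesis by (simp add: bilinear_conv_bounded_bilinear)
qed

lemmas cscale_sum_right = bounded_bilinear.sum_right[OF bounded_bilinear_cscale]
  and cscale_has_derivative = bounded_bilinear.FDERIV[OF bounded_bilinear_cscale]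
  and cscale_continuous_on [continuous_intros] = bounded_bilinear.continuous_on[OF bounded_bilinear_cscale]
  and cscale_bounded_linear_left = bounded_bilinear.bounded_linear_left[OF bounded_bilinear_cscale]
  and cscale_bounded_linear_right = bounded_bilinear.bounded_linear_right[OF bounded_bilinear_cscale]

section \<open>Complex differentiability, directional derivatives and Cauchy's formula\<close>

definition cdiff :: "('a::complex_space \<Rightarrow> 'b::complex_space) \<Rightarrow> 'a \<Rightarrow> bool" where
  "cdiff f x \<longleftrightarrow> (\<exists>D. (f has_derivative D) (at x) \<and> (\<forall>v. D (imul v) = imul (D v)))"

text \<open>Differentiability on a neighbourhood, not just at the point, makes this an open
  condition that derivatives inherit; it is a statement about the germ of \<open>f\<close> at
  \<open>x\<close>.\<close>

definition holo :: "('a::complex_space \<Rightarrow> 'b::complex_space) \<Rightarrow> 'a \<Rightarrow> bool" where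
  "holo f x \<longleftrightarrow> (\<forall>\<^sub>F y in nhds x. cdiff f y)"

text \<open>A one-variable \<open>deriv\<close> along the complex line through \<open>x\<close>, so
  that \<open>partial_deriv\<close> and \<open>d_eta\<close> are instances of it. It is linear in
  \<open>v\<close> wherever \<open>f\<close> is \<open>cdiff\<close>.\<close>

definition dir_deriv :: "'a::complex_space \<Rightarrow> ('a \<Rightarrow> complex) \<Rightarrow> 'a \<Rightarrow> complex" where
  "dir_deriv v f x = deriv (\<lambda>s. f (x + cscale s v)) 0"

lemma clinear_cscale:
  assumes "linear D" "\<And>v. D (imul v) = imul (D v)"
  shows "D (cscale c v) = cscale c (D v)"
  using assms by (simp add: cscale_def linear_add linear_scale)

lemma cdiff_line:
  fixes f :: "'a::complex_space \<Rightarrow> complex"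
  assumes "(f has_derivative D) (at (x + cscale s v))" "\<And>v. D (imul v) = imul (D v)"
  shows "((\<lambda>s. f (x + cscale s v)) has_field_derivative D v) (at s)"
proof -
  have lin: "linear D" using assms(1) has_derivative_linear by blast
  have "((\<lambda>s. x + cscale s v) has_derivative (\<lambda>h. cscale h v)) (at s)"
    by (auto intro!: derivative_eq_intros bounded_linear_imp_has_derivative cscale_bounded_linear_left)
  from has_derivative_compose[OF this assms(1)]
  have "((\<lambda>s. f (x + cscale s v)) has_derivative (\<lambda>h. D (cscale h v))) (at s)" .
  then show ?thesis
    by (simp add: has_field_derivative_def clinear_cscale[OF lin assms(2)] mult_commute_abs)
qed

lemma dir_deriv_eq:
  assumes "(f has_derivative D) (at x)" "\<And>v. D (imul v) = imul (D v)"
  shows "dir_deriv v f x = D v"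
  unfolding dir_deriv_def using cdiff_line[of f D x 0 v] assms by (simp add: DERIV_imp_deriv)

lemma cdiff_has_derivative:
  assumes "cdiff f x"
  shows "(f has_derivative (\<lambda>v. dir_deriv v f x)) (at x)"
proof -
  obtain D where D: "(f has_derivative D) (at x)" "\<And>v. D (imul v) = imul (D v)"
    using assms unfolding cdiff_def by blast
  then have "(\<lambda>v. dir_deriv v f x) = D" using dir_deriv_eq by blast
  with D show ?thesis by simp
qed

lemma dir_deriv_imul: "cdiff f x \<Longrightarrow> dir_deriv (imul v) f x = \<i> * dir_deriv v f x"
  unfolding cdiff_def by (auto simp: dir_deriv_eq imul_complex_def)

lemma cdiff_bounded_linear_dir_deriv: "cdiff f x \<Longrightarrow> bounded_linear (\<lambda>v. dir_deriv v f x)"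
  using cdiff_has_derivative has_derivative_bounded_linear by blast

lemma cdiffI:
  fixes f :: "'a::complex_space \<Rightarrow> complex"
  assumes "(f has_derivative D) (at x)" "\<And>v. D (imul v) = \<i> * D v"
  shows "cdiff f x"
  using assms unfolding cdiff_def imul_complex_def by blast

lemma cdiff_isCont: "cdiff f x \<Longrightarrow> isCont f x"
  unfolding cdiff_def using has_derivative_continuous by blast

lemma dir_deriv_cscale: "cdiff f x \<Longrightarrow> dir_deriv (cscale c v) f x = c * dir_deriv v f x"
proof -
  assume a: "cdiff f x"
  have "linear (\<lambda>v. dir_deriv v f x)" using a bounded_linear.linear cdiff_bounded_linear_dir_deriv by blast
  from clinear_cscale[OF this, of c v] a show ?thesis by (simp add: dir_deriv_imul imul_complex_def)
qed

lemma dir_deriv_sum_dir: "cdiff f x \<Longrightarrow> dir_deriv (sum w I) f x = (\<Sum>i\<in>I. dir_deriv (w i) f x)"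
  using linear_sum[OF bounded_linear.linear[OF cdiff_bounded_linear_dir_deriv]] .

lemma dir_deriv_add_dir: "cdiff f x \<Longrightarrow> dir_deriv (v + w) f x = dir_deriv v f x + dir_deriv w f x"
  using linear_add[OF bounded_linear.linear[OF cdiff_bounded_linear_dir_deriv]] .

lemma holo_cdiff: "holo f x \<Longrightarrow> cdiff f x"
  unfolding holo_def by (rule eventually_nhds_x_imp_x)

lemma holo_eventually: "holo f x \<Longrightarrow> \<forall>\<^sub>F y in nhds x. holo f y"
  unfolding holo_def by (simp add: eventually_eventually)

lemma open_holo: "open {x. holo f x}"
  using holo_eventually by (subst open_subopen) (auto simp: eventually_nhds subset_eq)

lemma holo_open: "open U \<Longrightarrow> x \<in> U \<Longrightarrow> (\<And>y. y \<in> U \<Longrightarrow> cdiff f y) \<Longrightarrow> holo f x"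
  unfolding holo_def eventually_nhds by blast

definition circle_pt :: "real \<Rightarrow> real \<Rightarrow> complex" where
  "circle_pt r t = of_real r * exp (2 * of_real pi * \<i> * of_real t)"

text \<open>Cauchy's formula for the first derivative at the centre of a disc in the line through
  \<open>x\<close>. Over the unit interval the velocity of the circle cancels 2 pi i and one power
  of the denominator, which leaves an ordinary integral with parameter \<open>x\<close>.\<close>

lemma dir_deriv_Cauchy_integral:
  assumes r: "r > 0" and d: "\<And>s. norm s \<le> r \<Longrightarrow> cdiff f (x + cscale s v)"
  shows "dir_deriv v f x = integral {0..1} (\<lambda>t. f (x + cscale (circle_pt r t) v) * inverse (circle_pt r t))"
proof -
  let ?g = "\<lambda>s. f (x + cscale s v)"
  have fd: "?g field_differentiable at s" if "norm s \<le> r" for s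
    using d[OF that] cdiff_line unfolding cdiff_def field_differentiable_def by blast
  have "?g holomorphic_on ball 0 r"
    by (auto simp: holomorphic_on_def intro!: field_differentiable_at_within fd)
  moreover have "continuous_on (cball 0 r) ?g"
    by (auto intro!: continuous_at_imp_continuous_on field_differentiable_imp_continuous_at fd)
  ultimately have "contour_integral (circlepath 0 r) (\<lambda>u. ?g u / (u - 0)^2) = (2 * pi * \<i>) * deriv ?g 0"
    using r by (intro Cauchy_contour_integral_circlepath_2) auto
  then have "dir_deriv v f x = contour_integral (circlepath 0 r) (\<lambda>u. ?g u / u^2) / (2 * pi * \<i>)"
    by (simp add: dir_deriv_def)
  also have "\<dots> = integral {0..1} (\<lambda>t. ?g (circlepath 0 r t) / (circlepath 0 r t)^2 *
      vector_derivative (circlepath 0 r) (at t)) / (2 * pi * \<i>)"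
    by (simp add: contour_integral_integral)
  also have "\<dots> = integral {0..1} (\<lambda>t. ?g (circlepath 0 r t) / (circlepath 0 r t)^2 *
      vector_derivative (circlepath 0 r) (at t) / (2 * pi * \<i>))"
    by (rule integral_divide[symmetric])
  also have "\<dots> = integral {0..1} (\<lambda>t. ?g (circle_pt r t) * inverse (circle_pt r t))"
    unfolding vector_derivative_circlepath using r
    by (intro integral_cong) (simp add: circlepath circle_pt_def field_simps power2_eq_square)
  finally show ?thesis .
qed

lemma norm_circle_pt: "r > 0 \<Longrightarrow> norm (circle_pt r t) = r"
  by (simp add: circle_pt_def norm_mult)

lemma circle_pt_nonzero: "r > 0 \<Longrightarrow> circle_pt r t \<noteq> 0"
  by (simp add: circle_pt_def)

lemma continuous_on_circle_pt [continuous_intros]: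
  "continuous_on A g \<Longrightarrow> continuous_on A (\<lambda>x. circle_pt r (g x))"
  unfolding circle_pt_def by (intro continuous_intros)

text \<open>One radius \<open>r\<close> has to serve all base points near \<open>x0\<close>, so that
  Cauchy's formula can be differentiated in the base point.\<close>

lemma holo_Cauchy_setup:
  assumes "holo f x0"
  obtains R r where "R > 0" "r > 0" "\<And>y. y \<in> ball x0 R \<Longrightarrow> holo f y"
    "\<And>x s. x \<in> ball x0 R \<Longrightarrow> norm s \<le> r \<Longrightarrow> holo f (x + cscale s v)"
proof -
  obtain R0 where R0: "R0 > 0" "\<And>y. y \<in> ball x0 R0 \<Longrightarrow> holo f y"
    using holo_eventually[OF assms] unfolding eventually_nhds_metric
    by (auto simp: dist_commute)
  \<comment> \<open>\<open>imul\<close> need not be an isometry, so \<open>cscale s v\<close> is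
    bounded by \<open>norm s\<close> times the sum of both norms; the summand 1 makes
    \<open>K\<close> positive and the estimate strict.\<close>
  define K where "K = 1 + norm v + norm (imul v)"
  have K: "K > 0" unfolding K_def by (simp add: add_pos_nonneg)
  define r where "r = R0 / (2 * K)"
  have "norm (cscale s v) < R0 / 2" if "norm s \<le> r" for s
  proof -
    have "norm (cscale s v) \<le> \<bar>Re s\<bar> * norm v + \<bar>Im s\<bar> * norm (imul v)"
      unfolding cscale_def by (rule order_trans[OF norm_triangle_ineq]) simp
    also have "\<dots> \<le> norm s * norm v + norm s * norm (imul v)"
      by (intro add_mono mult_right_mono abs_Re_le_cmod abs_Im_le_cmod) auto
    also have "\<dots> \<le> r * (norm v + norm (imul v))"
      using that by (simp add: distrib_left[symmetric] mult_right_mono)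
    also have "\<dots> < r * K"
      using R0(1) K by (intro mult_strict_left_mono) (auto simp: K_def r_def)
    also have "\<dots> = R0 / 2" using K by (simp add: r_def)
    finally show ?thesis .
  qed
  then have "x + cscale s v \<in> ball x0 R0" if "x \<in> ball x0 (R0/2)" "norm s \<le> r" for x s
  proof -
    have "dist x0 (x + cscale s v) \<le> dist x0 x + dist x (x + cscale s v)" by (rule dist_triangle)
    also have "dist x (x + cscale s v) = norm (cscale s v)" by (simp add: dist_norm)
    finally show ?thesis using that \<open>norm s \<le> r \<Longrightarrow> norm (cscale s v) < R0 / 2\<close> by auto
  qed
  then show thesis
    using R0 K by (intro that[of "R0/2" r]) (auto simp: r_def)
qed

lemma holo_isCont: "holo f x \<Longrightarrow> isCont f x"
  using cdiff_isCont holo_cdiff by blast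

text \<open>The integrand of Cauchy's formula is jointly continuous, so the integral is continuous
  in \<open>x\<close>. This must precede differentiability: the Leibniz rule asks for a continuous
  derivative of the integrand, and that derivative is itself a \<open>dir_deriv\<close>.\<close>

lemma holo_dir_deriv_isCont:
  assumes "holo f x0"
  shows "isCont (dir_deriv v f) x0"
proof -
  obtain R r where R: "R > 0" "r > 0" "\<And>y. y \<in> ball x0 R \<Longrightarrow> holo f y"
    "\<And>x s. x \<in> ball x0 R \<Longrightarrow> norm s \<le> r \<Longrightarrow> holo f (x + cscale s v)"
    by (rule holo_Cauchy_setup[OF assms, where v=v]) blast
  let ?U = "{x. holo f x}"
  have cf: "continuous_on ?U f"
    by (auto intro!: continuous_at_imp_continuous_on holo_isCont)
  have "continuous_on (ball x0 R) (\<lambda>x. integral (cbox 0 1) (\<lambda>t. f (x + cscale (circle_pt r t) v) * inverse (circle_pt r t)))"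
    using R(2) R(4)
    by (intro integral_continuous_on_param)
       (auto simp: split_beta norm_circle_pt circle_pt_nonzero intro!: continuous_intros continuous_on_compose2[OF cf])
  then have "continuous_on (ball x0 R) (dir_deriv v f)"
    using R by (subst continuous_on_cong[OF refl dir_deriv_Cauchy_integral[of r]]) (auto simp: holo_cdiff)
  then show ?thesis using R(1) by (simp add: continuous_on_eq_continuous_at)
qed

text \<open>Differentiation under the integral in Cauchy's formula. The explicit integral is kept
  because two facts are read off from it: complex linearity in \<open>w\<close>, and the symmetry of
  second derivatives.\<close>

lemma holo_dir_deriv_has_derivative:
  assumes "holo f x0"
  obtains r where "r > 0" "\<forall>\<^sub>F x in nhds x0. (\<forall>s. norm s \<le> r \<longrightarrow> holo f (x + cscale s v)) \<and>
     (dir_deriv v f has_derivative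
       (\<lambda>w. integral {0..1} (\<lambda>t. dir_deriv w f (x + cscale (circle_pt r t) v) * inverse (circle_pt r t)))) (at x)"
proof -
  obtain R r where R: "R > 0" "r > 0" "\<And>y. y \<in> ball x0 R \<Longrightarrow> holo f y"
    "\<And>x s. x \<in> ball x0 R \<Longrightarrow> norm s \<le> r \<Longrightarrow> holo f (x + cscale s v)"
    by (rule holo_Cauchy_setup[OF assms, where v=v]) blast
  let ?U = "{x. holo f x}"
  have cf: "continuous_on ?U f"
    by (auto intro!: continuous_at_imp_continuous_on holo_isCont)
  have cd: "continuous_on ?U (dir_deriv w f)" for w
    by (auto intro!: continuous_at_imp_continuous_on holo_dir_deriv_isCont)
  define fx where "fx x t = Blinfun (\<lambda>w. dir_deriv w f (x + cscale (circle_pt r t) v) * inverse (circle_pt r t))" for x t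
  have fx: "blinfun_apply (fx x t) w = dir_deriv w f (x + cscale (circle_pt r t) v) * inverse (circle_pt r t)"
    if "x \<in> ball x0 R" for x t w
    unfolding fx_def using that R(2,4)
    by (subst bounded_linear_Blinfun_apply)
       (auto intro!: bounded_linear_mult_const cdiff_bounded_linear_dir_deriv holo_cdiff simp: norm_circle_pt)
  have cont_fx: "continuous_on (ball x0 R \<times> cbox 0 1) (\<lambda>(x, t). fx x t)"
  \<comment> \<open>In finite dimension a family of linear maps is continuous once its values on
    basis vectors are; those are handled by \<open>holo_dir_deriv_isCont\<close>.\<close>
  proof (rule continuous_on_blinfun_componentwise)
    fix i :: 'a assume "i \<in> Basis"
    have "continuous_on (ball x0 R \<times> cbox 0 1)
       (\<lambda>p. dir_deriv i f (fst p + cscale (circle_pt r (snd p)) v) * inverse (circle_pt r (snd p)))"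
      using R(2) R(4)
      by (auto simp: norm_circle_pt circle_pt_nonzero intro!: continuous_intros continuous_on_compose2[OF cd])
    then show "continuous_on (ball x0 R \<times> cbox 0 1) (\<lambda>p. blinfun_apply (case p of (x, t) \<Rightarrow> fx x t) i)"
      by (rule continuous_on_eq) (auto simp: fx)
  qed
  have "(dir_deriv v f has_derivative
       (\<lambda>w. integral {0..1} (\<lambda>t. dir_deriv w f (x + cscale (circle_pt r t) v) * inverse (circle_pt r t)))) (at x)"
    if x: "x \<in> ball x0 R" for x
  proof -
    have "((\<lambda>x. integral (cbox 0 1) (\<lambda>t. f (x + cscale (circle_pt r t) v) * inverse (circle_pt r t)))
       has_derivative integral (cbox 0 1) (fx x)) (at x within ball x0 R)"
    proof (rule leibniz_rule)
      fix y t assume y: "y \<in> ball x0 R"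
      have "cdiff f (y + cscale (circle_pt r t) v)" using R y by (auto simp: norm_circle_pt holo_cdiff)
      from cdiff_has_derivative[OF this]
      have "((\<lambda>x. f (x + cscale (circle_pt r t) v)) has_derivative (\<lambda>w. dir_deriv w f (y + cscale (circle_pt r t) v))) (at y)"
        by (rule has_derivative_compose[rotated]) (auto intro!: derivative_eq_intros)
      from has_derivative_mult_left[OF this]
      have "((\<lambda>x. f (x + cscale (circle_pt r t) v) * inverse (circle_pt r t)) has_derivative
           (\<lambda>w. dir_deriv w f (y + cscale (circle_pt r t) v) * inverse (circle_pt r t))) (at y)" .
      moreover have "blinfun_apply (fx y t) = (\<lambda>w. dir_deriv w f (y + cscale (circle_pt r t) v) * inverse (circle_pt r t))"
        using fx[OF y] by auto
      ultimately show "((\<lambda>x. f (x + cscale (circle_pt r t) v) * inverse (circle_pt r t)) has_derivative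
           blinfun_apply (fx y t)) (at y within ball x0 R)"
        by (simp add: has_derivative_at_withinI)
    next
      fix y assume "y \<in> ball x0 R"
      then show "(\<lambda>t. f (y + cscale (circle_pt r t) v) * inverse (circle_pt r t)) integrable_on cbox 0 1"
        using R(2) R(4)
        by (intro integrable_continuous)
          (auto intro!: continuous_intros continuous_on_compose2[OF cf]
            simp: norm_circle_pt circle_pt_nonzero)
    qed (use cont_fx x in auto)
    moreover have "blinfun_apply (integral (cbox 0 1) (fx x)) =
      (\<lambda>w. integral {0..1} (\<lambda>t. dir_deriv w f (x + cscale (circle_pt r t) v) * inverse (circle_pt r t)))"
    proof
      fix w
      have "continuous_on (cbox 0 1) (\<lambda>t. (\<lambda>(x, t). fx x t) (x, t))"
        using x by (intro continuous_on_compose2[OF cont_fx] continuous_intros) auto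
      then have "fx x integrable_on cbox 0 1"
        by (intro integrable_continuous) simp
      then show "blinfun_apply (integral (cbox 0 1) (fx x)) w =
         integral {0..1} (\<lambda>t. dir_deriv w f (x + cscale (circle_pt r t) v) * inverse (circle_pt r t))"
        using fx[OF x] by (simp add: blinfun_apply_integral)
    qed
    moreover have "(dir_deriv v f has_derivative D) (at x)" if
      "((\<lambda>x. integral (cbox 0 1) (\<lambda>t. f (x + cscale (circle_pt r t) v) * inverse (circle_pt r t)))
       has_derivative D) (at x)" for D
      by (rule has_derivative_transform_within_open[OF that open_ball x])
         (use R in \<open>auto simp: dir_deriv_Cauchy_integral[of r] holo_cdiff\<close>)
    ultimately show ?thesis using x at_within_open[OF x open_ball] by simp
  qed
  then show thesis
    using R by (intro that[of r]) (auto simp: eventually_nhds intro!: exI[of _ "ball x0 R"])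
qed

lemma holo_dir_deriv:
  assumes "holo f x"
  shows "holo (dir_deriv v f) x"
proof -
  obtain r where r: "r > 0" and ev: "\<forall>\<^sub>F x in nhds x. (\<forall>s. norm s \<le> r \<longrightarrow> holo f (x + cscale s v)) \<and>
     (dir_deriv v f has_derivative
       (\<lambda>w. integral {0..1} (\<lambda>t. dir_deriv w f (x + cscale (circle_pt r t) v) * inverse (circle_pt r t)))) (at x)"
    using holo_dir_deriv_has_derivative[OF assms] .
  show ?thesis
    unfolding holo_def using ev
  proof (rule eventually_mono, elim conjE)
    fix x assume h: "\<forall>s. norm s \<le> r \<longrightarrow> holo f (x + cscale s v)"
     and D: "(dir_deriv v f has_derivative
       (\<lambda>w. integral {0..1} (\<lambda>t. dir_deriv w f (x + cscale (circle_pt r t) v) * inverse (circle_pt r t)))) (at x)"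
    show "cdiff (dir_deriv v f) x"
      using D by (rule cdiffI) (use h r in \<open>simp add: dir_deriv_imul holo_cdiff norm_circle_pt mult.assoc\<close>)
  qed
qed

text \<open>The derivative of \<open>dir_deriv v f\<close> along \<open>w\<close>, written as an
  integral, is exactly Cauchy's formula for the \<open>v\<close>-derivative of
  \<open>dir_deriv w f\<close>.\<close>

lemma dir_deriv_commute:
  assumes "holo f x"
  shows "dir_deriv v (dir_deriv w f) x = dir_deriv w (dir_deriv v f) x"
proof -
  obtain r where r: "r > 0" and ev: "\<forall>\<^sub>F x in nhds x. (\<forall>s. norm s \<le> r \<longrightarrow> holo f (x + cscale s v)) \<and>
     (dir_deriv v f has_derivative
       (\<lambda>w. integral {0..1} (\<lambda>t. dir_deriv w f (x + cscale (circle_pt r t) v) * inverse (circle_pt r t)))) (at x)"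
    using holo_dir_deriv_has_derivative[OF assms] .
  from eventually_nhds_x_imp_x[OF ev]
  have h: "\<And>s. norm s \<le> r \<Longrightarrow> holo f (x + cscale s v)"
    and D: "(dir_deriv v f has_derivative
       (\<lambda>w. integral {0..1} (\<lambda>t. dir_deriv w f (x + cscale (circle_pt r t) v) * inverse (circle_pt r t)))) (at x)"
    by auto
  have "dir_deriv w (dir_deriv v f) x = integral {0..1} (\<lambda>t. dir_deriv w f (x + cscale (circle_pt r t) v) * inverse (circle_pt r t))"
    using D by (rule dir_deriv_eq) (use h r in \<open>simp add: dir_deriv_imul holo_cdiff norm_circle_pt mult.assoc imul_complex_def\<close>)
  also have "\<dots> = dir_deriv v (dir_deriv w f) x"
    using r h by (intro dir_deriv_Cauchy_integral[symmetric] holo_cdiff holo_dir_deriv) auto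
  finally show ?thesis ..
qed

section \<open>Closure properties of holomorphic germs\<close>

lemma cdiff_const [simp]: "cdiff (\<lambda>_. c) x"
  unfolding cdiff_def by (rule exI[of _ "\<lambda>_. 0"]) auto

lemma cdiff_linear:
  assumes "linear f" "\<And>v. f (imul v) = imul (f v)"
  shows "cdiff f x"
  using assms linear_imp_has_derivative unfolding cdiff_def by blast

lemma cdiff_compose:
  assumes "cdiff f (g x)" "cdiff g x"
  shows "cdiff (\<lambda>x. f (g x)) x"
proof -
  obtain D E where "(f has_derivative D) (at (g x))" "\<And>v. D (imul v) = imul (D v)"
    "(g has_derivative E) (at x)" "\<And>v. E (imul v) = imul (E v)"
    using assms unfolding cdiff_def by blast
  then show ?thesis unfolding cdiff_def
    by (intro exI[of _ "\<lambda>h. D (E h)"]) (auto intro: has_derivative_compose)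
qed

lemma cdiff_Pair:
  assumes "cdiff f x" "cdiff g x"
  shows "cdiff (\<lambda>x. (f x, g x)) x"
proof -
  obtain D E where "(f has_derivative D) (at x)" "\<And>v. D (imul v) = imul (D v)"
    "(g has_derivative E) (at x)" "\<And>v. E (imul v) = imul (E v)"
    using assms unfolding cdiff_def by blast
  then show ?thesis unfolding cdiff_def
    by (intro exI[of _ "\<lambda>h. (D h, E h)"]) (auto intro: has_derivative_Pair simp: imul_prod_def)
qed

lemma cdiff_add:
  assumes "cdiff f x" "cdiff g x"
  shows "cdiff (\<lambda>x. f x + g x) x"
proof -
  obtain D E where "(f has_derivative D) (at x)" "\<And>v. D (imul v) = imul (D v)"
    "(g has_derivative E) (at x)" "\<And>v. E (imul v) = imul (E v)"
    using assms unfolding cdiff_def by blast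
  then show ?thesis unfolding cdiff_def
    by (intro exI[of _ "\<lambda>h. D h + E h"]) (auto intro: has_derivative_add simp: imul_add)
qed

lemma cdiff_cscale:
  assumes "cdiff f x" "cdiff g x"
  shows "cdiff (\<lambda>x. cscale (f x) (g x)) x"
proof -
  obtain D E where "(f has_derivative D) (at x)" "\<And>v. D (imul v) = imul (D v)"
    "(g has_derivative E) (at x)" "\<And>v. E (imul v) = imul (E v)"
    using assms unfolding cdiff_def by blast
  then show ?thesis unfolding cdiff_def
    by (intro exI[of _ "\<lambda>h. cscale (f x) (E h) + cscale (D h) (g x)"] conjI cscale_has_derivative)
      (auto simp: cscale_add_right cscale_cscale imul_complex_def mult.commute simp flip: cscale_imaginary)
qed

lemma holo_const [simp]: "holo (\<lambda>_. c) x"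
  by (simp add: holo_def)

lemma holo_linear:
  assumes "linear f" "\<And>v. f (imul v) = imul (f v)"
  shows "holo f x"
  using cdiff_linear[OF assms] by (simp add: holo_def)

lemma holo_ident [simp]: "holo (\<lambda>x. x) x"
  by (rule holo_linear) (auto intro: linearI)

lemma holo_fst_ident [simp]: "holo fst x" and holo_snd_ident [simp]: "holo snd x"
  by (auto intro!: holo_linear linearI simp: imul_prod_def)

lemma holo_eventually_compose:
  assumes "holo g x" "\<forall>\<^sub>F y in nhds (g x). P y"
  shows "\<forall>\<^sub>F y in nhds x. P (g y)"
  using eventually_compose_filterlim[OF assms(2)] holo_isCont[OF assms(1)]
  by (simp add: isCont_def tendsto_at_iff_tendsto_nhds)

lemma holo_compose:
  assumes "holo f (g x)" "holo g x"
  shows "holo (\<lambda>x. f (g x)) x"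
proof -
  have "\<forall>\<^sub>F y in nhds x. cdiff f (g y)"
    using assms(2,1) unfolding holo_def[of f] by (rule holo_eventually_compose)
  moreover have "\<forall>\<^sub>F y in nhds x. cdiff g y"
    using assms(2) unfolding holo_def .
  ultimately show ?thesis
    unfolding holo_def by eventually_elim (rule cdiff_compose)
qed

lemma holo_binop:
  assumes "\<And>y. cdiff f y \<Longrightarrow> cdiff g y \<Longrightarrow> cdiff (\<lambda>x. F (f x) (g x)) y"
    and "holo f x" "holo g x"
  shows "holo (\<lambda>x. F (f x) (g x)) x"
  using assms(2,3) unfolding holo_def by eventually_elim (rule assms(1))

lemma holo_Pair [intro]: "holo f x \<Longrightarrow> holo g x \<Longrightarrow> holo (\<lambda>x. (f x, g x)) x"
  by (rule holo_binop[where F=Pair]) (rule cdiff_Pair)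

lemma holo_add: "holo f x \<Longrightarrow> holo g x \<Longrightarrow> holo (\<lambda>x. f x + g x) x"
  by (rule holo_binop[where F="(+)"]) (rule cdiff_add)

lemma holo_cscale: "holo f x \<Longrightarrow> holo g x \<Longrightarrow> holo (\<lambda>x. cscale (f x) (g x)) x"
  by (rule holo_binop[where F=cscale]) (rule cdiff_cscale)

lemma holo_mult: "holo f x \<Longrightarrow> holo g x \<Longrightarrow> holo (\<lambda>x. f x * g x :: complex) x"
  using holo_cscale[of f x g] by simp

lemma holo_uminus: "holo f x \<Longrightarrow> holo (\<lambda>x. - f x) x"
  using holo_cscale[of "\<lambda>_. - 1" x f] by (simp add: cscale_def)

lemma holo_diff: "holo f x \<Longrightarrow> holo g x \<Longrightarrow> holo (\<lambda>x. f x - g x) x"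
  using holo_add[OF _ holo_uminus, of f x g] by simp

lemma holo_sum: "(\<And>i. i \<in> I \<Longrightarrow> holo (f i) x) \<Longrightarrow> holo (\<lambda>x. \<Sum>i\<in>I. f i x) x"
  by (induction I rule: infinite_finite_induct) (auto intro: holo_add)

lemma holo_divide: "holo f x \<Longrightarrow> holo (\<lambda>x. f x / c :: complex) x"
  using holo_mult[of f x "\<lambda>_. inverse c"] by (simp add: divide_inverse)

lemma holo_fst: "holo f x \<Longrightarrow> holo (\<lambda>x. fst (f x)) x"
  and holo_snd: "holo f x \<Longrightarrow> holo (\<lambda>x. snd (f x)) x"
  by (auto intro: holo_compose[of fst f] holo_compose[of snd f])

lemma holo_vec_nth: "holo f x \<Longrightarrow> holo (\<lambda>x. f x $ i) x"
  by (rule holo_compose[of "\<lambda>y. y $ i" f]) (auto intro!: holo_linear linearI simp: imul_vec_def)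

lemma vec_eq_sum_cscale_axis: "(v :: complex ^ 'n) = (\<Sum>i\<in>UNIV. cscale (v $ i) (axis i 1))"
  by (simp add: cscale_vec_complex basis_expansion)

lemma holo_vecI:
  fixes f :: "'a::complex_space \<Rightarrow> complex ^ 'n"
  assumes "\<And>i. holo (\<lambda>x. f x $ i) x"
  shows "holo f x"
proof -
  have "holo (\<lambda>x. \<Sum>i\<in>UNIV. cscale (f x $ i) (axis i 1)) x"
    by (intro holo_sum holo_cscale assms holo_const)
  moreover have "(\<lambda>x. \<Sum>i\<in>UNIV. cscale (f x $ i) (axis i 1)) = f"
    by (rule ext) (rule vec_eq_sum_cscale_axis[symmetric])
  ultimately show ?thesis by (rule subst[rotated])
qed

lemma holo_matrix_vector_mult:
  fixes A :: "'a::complex_space \<Rightarrow> complex ^ 'n ^ 'm"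
  assumes "\<And>i j. holo (\<lambda>x. A x $ i $ j) x" "holo v x"
  shows "holo (\<lambda>x. A x *v v x) x"
  by (rule holo_vecI)
    (auto simp: matrix_vector_mult_def intro!: holo_sum holo_mult assms(1) holo_vec_nth assms(2))

lemmas holo_intros = holo_const holo_ident holo_Pair holo_add holo_diff holo_uminus
  holo_cscale holo_mult holo_sum holo_divide holo_fst holo_snd holo_fst_ident holo_snd_ident
  holo_vec_nth

section \<open>Locality and calculus rules for directional derivatives\<close>

lemma dir_deriv_cong:
  assumes "\<forall>\<^sub>F y in nhds x. f y = g y"
  shows "dir_deriv v f x = dir_deriv v g x"
  unfolding dir_deriv_def
proof (rule deriv_cong_ev)
  have "holo (\<lambda>s. x + cscale s v) 0" by (intro holo_intros)
  then show "\<forall>\<^sub>F s in nhds 0. f (x + cscale s v) = g (x + cscale s v)"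
    by (rule holo_eventually_compose) (use assms in simp)
qed simp

text \<open>Equality near \<open>x\<close> is equality near every point close to \<open>x\<close>.
  The conclusion stays on a neighbourhood because iterated derivatives look at it again; the same
  device drives the inductions on powers of \<open>plap\<close>.\<close>

lemma dir_deriv_cong_ev:
  assumes "\<forall>\<^sub>F y in nhds x. f y = g y"
  shows "\<forall>\<^sub>F y in nhds x. dir_deriv v f y = dir_deriv v g y"
proof -
  have "\<forall>\<^sub>F z in nhds x. \<forall>\<^sub>F y in nhds z. f y = g y"
    using assms by (simp add: eventually_eventually)
  then show ?thesis by eventually_elim (rule dir_deriv_cong)
qed

lemma cdiff_cong_ev:
  assumes "\<forall>\<^sub>F y in nhds x. f y = g y" "cdiff f x"
  shows "cdiff g x"
proof -
  obtain D where D: "(f has_derivative D) (at x)" "\<And>v. D (imul v) = imul (D v)"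
    using assms(2) unfolding cdiff_def by blast
  have "\<forall>\<^sub>F y in at x. f y = g y"
    using assms(1) unfolding eventually_at_filter by (rule eventually_mono) simp
  then have "(g has_derivative D) (at x)"
    using eventually_nhds_x_imp_x[OF assms(1)]
    by (rule has_derivative_transform_eventually[OF D(1)]) simp
  with D show ?thesis unfolding cdiff_def by blast
qed

lemma holo_cong_ev:
  assumes "\<forall>\<^sub>F y in nhds x. f y = g y" "holo f x"
  shows "holo g x"
proof -
  have "\<forall>\<^sub>F z in nhds x. \<forall>\<^sub>F y in nhds z. f y = g y"
    using assms(1) by (simp add: eventually_eventually)
  then show ?thesis
    using assms(2) unfolding holo_def by eventually_elim (rule cdiff_cong_ev)
qed

lemma dir_deriv_const [simp]: "dir_deriv v (\<lambda>_. c) x = 0"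
  by (rule dir_deriv_eq[of _ "\<lambda>_. 0"]) auto

lemma dir_deriv_add: "cdiff f x \<Longrightarrow> cdiff g x \<Longrightarrow> dir_deriv v (\<lambda>x. f x + g x) x = dir_deriv v f x + dir_deriv v g x"
  by (rule dir_deriv_eq[where D="\<lambda>v. dir_deriv v f x + dir_deriv v g x"], rule has_derivative_add)
    (simp_all add: cdiff_has_derivative dir_deriv_imul imul_complex_def algebra_simps)

lemma dir_deriv_mult: "cdiff f x \<Longrightarrow> cdiff g x \<Longrightarrow> dir_deriv v (\<lambda>x. f x * g x) x = f x * dir_deriv v g x + dir_deriv v f x * g x"
  by (rule dir_deriv_eq[where D="\<lambda>v. f x * dir_deriv v g x + dir_deriv v f x * g x"], rule has_derivative_mult)
    (simp_all add: cdiff_has_derivative dir_deriv_imul imul_complex_def algebra_simps)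

lemma dir_deriv_sum:
  "(\<And>i. i \<in> I \<Longrightarrow> cdiff (f i) x) \<Longrightarrow> dir_deriv v (\<lambda>x. \<Sum>i\<in>I. f i x) x = (\<Sum>i\<in>I. dir_deriv v (f i) x)"
  by (rule dir_deriv_eq[where D="\<lambda>v. \<Sum>i\<in>I. dir_deriv v (f i) x"], rule has_derivative_sum)
    (simp_all add: cdiff_has_derivative dir_deriv_imul imul_complex_def sum_distrib_left)

lemma dir_deriv_cmult: "cdiff f x \<Longrightarrow> dir_deriv v (\<lambda>x. c * f x) x = c * dir_deriv v f x"
  using dir_deriv_mult[of "\<lambda>_. c" x f v] by simp

lemma dir_deriv_divide: "cdiff f x \<Longrightarrow> dir_deriv v (\<lambda>x. f x / c) x = dir_deriv v f x / c"
  using dir_deriv_cmult[of f x v "inverse c"] by (simp add: field_simps)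

lemma dir_deriv_linear:
  assumes "linear l" "\<And>v. l (imul v) = \<i> * l v"
  shows "dir_deriv v l x = l v"
  using assms by (intro dir_deriv_eq[where D=l] linear_imp_has_derivative) (auto simp: imul_complex_def)

lemma dir_deriv_compose:
  assumes "cdiff f (g x)" "(g has_derivative G) (at x)" "\<And>v. G (imul v) = imul (G v)"
  shows "dir_deriv v (\<lambda>x. f (g x)) x = dir_deriv (G v) f (g x)"
  using has_derivative_compose[OF assms(2) cdiff_has_derivative[OF assms(1)]]
  by (rule dir_deriv_eq[where D="\<lambda>v. dir_deriv (G v) f (g x)"]) (use assms in \<open>auto simp: dir_deriv_imul imul_complex_def\<close>)

lemma dir_deriv_fst_slice: "dir_deriv v (\<lambda>x. f (x, y)) x = dir_deriv (v, 0) f (x, y)"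
  and dir_deriv_snd_slice: "dir_deriv w (\<lambda>y. f (x, y)) y = dir_deriv (0, w) f (x, y)"
  by (simp_all add: dir_deriv_def)

section \<open>Exponentials of second order pairings\<close>

text \<open>The index set and both families of directions are left free: the pairing on one
  cotangent space, on a product of two, on one factor with the other frozen, and with a parameter
  adjoined are all instances.\<close>

definition plap :: "'i set \<Rightarrow> ('i \<Rightarrow> 'a) \<Rightarrow> ('i \<Rightarrow> 'a) \<Rightarrow> ('a::complex_space \<Rightarrow> complex) \<Rightarrow> 'a \<Rightarrow> complex" where
  "plap I u v f = (\<lambda>x. \<Sum>i\<in>I. dir_deriv (v i) (dir_deriv (u i) f) x)"

lemma dir_deriv_const_fun [simp]: "dir_deriv v (\<lambda>_. c) = (\<lambda>_. 0)"
  by (rule ext) simp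

lemma holo_plap: "holo f x \<Longrightarrow> holo (plap I u v f) x"
  unfolding plap_def by (intro holo_sum holo_dir_deriv)

lemma holo_plap_pow: "holo f x \<Longrightarrow> holo ((plap I u v ^^ k) f) x"
  by (induction k) (auto intro: holo_plap)

lemma plap_cong:
  assumes "\<forall>\<^sub>F y in nhds x. f y = g y"
  shows "plap I u v f x = plap I u v g x"
  unfolding plap_def by (intro sum.cong refl dir_deriv_cong dir_deriv_cong_ev assms)

lemma plap_pow_cong_ev:
  assumes "\<forall>\<^sub>F y in nhds x. f y = g y"
  shows "\<forall>\<^sub>F y in nhds x. (plap I u v ^^ k) f y = (plap I u v ^^ k) g y"
proof (induction k)
  case (Suc k)
  then have "\<forall>\<^sub>F z in nhds x. \<forall>\<^sub>F y in nhds z. (plap I u v ^^ k) f y = (plap I u v ^^ k) g y"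
    by (simp add: eventually_eventually)
  then show ?case by eventually_elim (simp add: plap_cong)
qed (use assms in simp)

lemma plap_pow_cong:
  "\<forall>\<^sub>F y in nhds x. f y = g y \<Longrightarrow> (plap I u v ^^ k) f x = (plap I u v ^^ k) g x"
  using eventually_nhds_x_imp_x[OF plap_pow_cong_ev] .

lemma plap_sum:
  assumes "\<And>j. j \<in> J \<Longrightarrow> holo (f j) x"
  shows "plap I u v (\<lambda>x. \<Sum>j\<in>J. f j x) x = (\<Sum>j\<in>J. plap I u v (f j) x)"
proof -
  have ev: "\<forall>\<^sub>F y in nhds x. dir_deriv (u i) (\<lambda>x. \<Sum>j\<in>J. f j x) y = (\<Sum>j\<in>J. dir_deriv (u i) (f j) y)" for i
  proof (cases "finite J")
    case True
    then have "\<forall>\<^sub>F y in nhds x. \<forall>j\<in>J. holo (f j) y"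
      by (intro eventually_ball_finite) (auto intro: holo_eventually assms)
    then show ?thesis by eventually_elim (auto intro: dir_deriv_sum holo_cdiff)
  qed simp
  have "plap I u v (\<lambda>x. \<Sum>j\<in>J. f j x) x = (\<Sum>i\<in>I. \<Sum>j\<in>J. dir_deriv (v i) (dir_deriv (u i) (f j)) x)"
    unfolding plap_def dir_deriv_cong[OF ev]
    by (intro sum.cong refl dir_deriv_sum holo_cdiff holo_dir_deriv assms)
  also have "\<dots> = (\<Sum>j\<in>J. plap I u v (f j) x)"
    unfolding plap_def by (rule sum.swap)
  finally show ?thesis .
qed

lemma plap_pow_sum:
  assumes "\<And>j. j \<in> J \<Longrightarrow> holo (f j) x"
  shows "(plap I u v ^^ k) (\<lambda>x. \<Sum>j\<in>J. f j x) x = (\<Sum>j\<in>J. (plap I u v ^^ k) (f j) x)"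
proof (cases "finite J")
  case True
  have "\<forall>\<^sub>F x in nhds x. \<forall>j\<in>J. holo (f j) x"
    using True by (intro eventually_ball_finite) (auto intro: holo_eventually assms)
  then have "\<forall>\<^sub>F x in nhds x. (plap I u v ^^ k) (\<lambda>x. \<Sum>j\<in>J. f j x) x = (\<Sum>j\<in>J. (plap I u v ^^ k) (f j) x)"
  proof (induction k)
    case (Suc k)
    then have "\<forall>\<^sub>F z in nhds x. \<forall>\<^sub>F x in nhds z.
        (plap I u v ^^ k) (\<lambda>x. \<Sum>j\<in>J. f j x) x = (\<Sum>j\<in>J. (plap I u v ^^ k) (f j) x)"
      by (simp add: eventually_eventually)
    then show ?case using Suc.prems
      by eventually_elim (simp add: plap_cong plap_sum holo_plap_pow)
  qed simp
  then show ?thesis by (rule eventually_nhds_x_imp_x)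
next
  \<comment> \<open>Over an infinite index set both sums are 0 by convention, so the claim concerns
    the zero function.\<close>
  case False
  have "plap I u v (\<lambda>x. 0) = (\<lambda>x. 0)" by (simp add: plap_def fun_eq_iff)
  then have "(plap I u v ^^ k) (\<lambda>x. 0) = (\<lambda>x. 0)" by (induction k) auto
  with False show ?thesis by simp
qed

text \<open>A binary sum is a sum over \<open>bool\<close>.\<close>

lemma plap_pow_add:
  assumes "holo f x" "holo g x"
  shows "(plap I u v ^^ k) (\<lambda>x. f x + g x) x = (plap I u v ^^ k) f x + (plap I u v ^^ k) g x"
proof -
  have "(\<lambda>x. \<Sum>b\<in>UNIV. (if b then f else g) x) = (\<lambda>x. f x + g x)"
    by (simp add: UNIV_bool add.commute)
  moreover have "holo (if b then f else g) x" for b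
    using assms by simp
  ultimately show ?thesis
    using plap_pow_sum[of "UNIV :: bool set" "\<lambda>b. if b then f else g" x k I u v]
    by (simp add: UNIV_bool)
qed

lemma plap_cmult:
  assumes "holo f x"
  shows "plap I u v (\<lambda>x. c * f x) x = c * plap I u v f x"
proof -
  have ev: "\<forall>\<^sub>F y in nhds x. dir_deriv (u i) (\<lambda>x. c * f x) y = c * dir_deriv (u i) f y" for i
    using holo_eventually[OF assms] by eventually_elim (rule dir_deriv_cmult[OF holo_cdiff])
  show ?thesis
    unfolding plap_def dir_deriv_cong[OF ev] sum_distrib_left
    by (intro sum.cong refl dir_deriv_cmult holo_cdiff holo_dir_deriv assms)
qed

lemma plap_pow_cmult:
  assumes "holo f x"
  shows "(plap I u v ^^ k) (\<lambda>x. c * f x) x = c * (plap I u v ^^ k) f x"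
proof -
  have "\<forall>\<^sub>F x in nhds x. (plap I u v ^^ k) (\<lambda>x. c * f x) x = c * (plap I u v ^^ k) f x"
  proof (induction k)
    case (Suc k)
    then have "\<forall>\<^sub>F z in nhds x. \<forall>\<^sub>F x in nhds z. (plap I u v ^^ k) (\<lambda>x. c * f x) x = c * (plap I u v ^^ k) f x"
      by (simp add: eventually_eventually)
    then show ?case using holo_eventually[OF assms]
      by eventually_elim (simp add: plap_cong plap_cmult holo_plap_pow)
  qed simp
  then show ?thesis by (rule eventually_nhds_x_imp_x)
qed

lemma dir_deriv_plap:
  assumes "holo f x"
  shows "dir_deriv w (plap I u v f) x = plap I u v (dir_deriv w f) x"
proof -
  have ev: "\<forall>\<^sub>F y in nhds x. dir_deriv w (dir_deriv (u i) f) y = dir_deriv (u i) (dir_deriv w f) y" for i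
    using holo_eventually[OF assms] by eventually_elim (rule dir_deriv_commute)
  have "dir_deriv w (plap I u v f) x = (\<Sum>i\<in>I. dir_deriv w (dir_deriv (v i) (dir_deriv (u i) f)) x)"
    unfolding plap_def by (intro dir_deriv_sum holo_cdiff holo_dir_deriv assms)
  also have "\<dots> = (\<Sum>i\<in>I. dir_deriv (v i) (dir_deriv w (dir_deriv (u i) f)) x)"
    by (intro sum.cong refl dir_deriv_commute holo_dir_deriv assms)
  also have "\<dots> = plap I u v (dir_deriv w f) x"
    unfolding plap_def by (intro sum.cong refl dir_deriv_cong ev)
  finally show ?thesis .
qed

lemma dir_deriv_plap_pow_ev:
  assumes "holo f x"
  shows "\<forall>\<^sub>F x in nhds x. dir_deriv w ((plap I u v ^^ k) f) x = (plap I u v ^^ k) (dir_deriv w f) x"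
proof (induction k)
  case (Suc k)
  then have "\<forall>\<^sub>F z in nhds x. \<forall>\<^sub>F x in nhds z. dir_deriv w ((plap I u v ^^ k) f) x = (plap I u v ^^ k) (dir_deriv w f) x"
    by (simp add: eventually_eventually)
  then show ?case using holo_eventually[OF assms]
    by eventually_elim (simp add: dir_deriv_plap plap_cong holo_plap_pow)
qed simp

lemma dir_deriv_plap_pow:
  "holo f x \<Longrightarrow> dir_deriv w ((plap I u v ^^ k) f) x = (plap I u v ^^ k) (dir_deriv w f) x"
  using eventually_nhds_x_imp_x[OF dir_deriv_plap_pow_ev] .

text \<open>Both operators have constant coefficients, and directional derivatives of a holomorphic
  germ commute.\<close>

lemma plap_plap_pow_commute:
  assumes "holo f x"
  shows "plap J u v ((plap I u' v' ^^ k) f) x = (plap I u' v' ^^ k) (plap J u v f) x"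
proof -
  have "plap J u v ((plap I u' v' ^^ k) f) x = (\<Sum>i\<in>J. (plap I u' v' ^^ k) (dir_deriv (v i) (dir_deriv (u i) f)) x)"
    unfolding plap_def[of J]
    by (intro sum.cong refl trans[OF dir_deriv_cong[OF dir_deriv_plap_pow_ev] dir_deriv_plap_pow] holo_dir_deriv assms)
  also have "\<dots> = (plap I u' v' ^^ k) (plap J u v f) x"
    unfolding plap_def[of J] by (intro plap_pow_sum[symmetric] holo_dir_deriv assms)
  finally show ?thesis .
qed

text \<open>For a linear form \<open>l\<close>, the commutator of \<open>plap I u v\<close> and multiplication by \<open>l\<close> is
  the derivative in this direction.\<close>

definition dual_dir :: "'i set \<Rightarrow> ('i \<Rightarrow> 'a) \<Rightarrow> ('i \<Rightarrow> 'a) \<Rightarrow> ('a::complex_space \<Rightarrow> complex) \<Rightarrow> 'a" where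
  "dual_dir I u v l = (\<Sum>i\<in>I. cscale (l (u i)) (v i) + cscale (l (v i)) (u i))"

lemma plap_linear_mult:
  assumes l: "linear l" "\<And>v. l (imul v) = \<i> * l v" and f: "holo f x"
  shows "plap I u v (\<lambda>x. l x * f x) x = l x * plap I u v f x + dir_deriv (dual_dir I u v l) f x"
proof -
  have hl: "holo l x" for x using l by (intro holo_linear) (auto simp: imul_complex_def)
  have ddl: "dir_deriv v l x = l v" for v x using l by (rule dir_deriv_linear)
  have ev: "\<forall>\<^sub>F y in nhds x. dir_deriv (u i) (\<lambda>x. l x * f x) y = l y * dir_deriv (u i) f y + l (u i) * f y" for i
    using holo_eventually[OF f] by eventually_elim (simp add: dir_deriv_mult holo_cdiff hl ddl)
  have "dir_deriv (v i) (dir_deriv (u i) (\<lambda>x. l x * f x)) x =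
      l x * dir_deriv (v i) (dir_deriv (u i) f) x + dir_deriv (cscale (l (u i)) (v i) + cscale (l (v i)) (u i)) f x" for i
    unfolding dir_deriv_cong[OF ev]
    by (subst dir_deriv_add) (simp_all add: dir_deriv_mult dir_deriv_cmult holo_cdiff holo_intros holo_dir_deriv hl f ddl dir_deriv_add_dir dir_deriv_cscale)
  then have "plap I u v (\<lambda>x. l x * f x) x = l x * plap I u v f x +
      (\<Sum>i\<in>I. dir_deriv (cscale (l (u i)) (v i) + cscale (l (v i)) (u i)) f x)"
    by (simp add: plap_def sum.distrib sum_distrib_left)
  then show ?thesis
    by (simp only: dual_dir_def dir_deriv_sum_dir[OF holo_cdiff[OF f]])
qed

text \<open>The commutator with \<open>l\<close> is a constant coefficient derivative and so
  commutes with \<open>plap\<close>: moving \<open>l\<close> past \<open>k\<close> copies produces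
  \<open>k\<close> equal terms. At \<open>k = 0\<close> the truncated exponent \<open>k - 1\<close>
  is harmless, its coefficient being 0.\<close>

lemma plap_pow_linear_mult:
  assumes l: "linear l" "\<And>v. l (imul v) = \<i> * l v" and f: "holo f x"
  shows "(plap I u v ^^ k) (\<lambda>x. l x * f x) x =
    l x * (plap I u v ^^ k) f x + of_nat k * (plap I u v ^^ (k - 1)) (dir_deriv (dual_dir I u v l) f) x"
proof -
  have hl: "holo l x" for x using l by (intro holo_linear) (auto simp: imul_complex_def)
  have "\<forall>\<^sub>F x in nhds x. (plap I u v ^^ k) (\<lambda>x. l x * f x) x =
    l x * (plap I u v ^^ k) f x + of_nat k * (plap I u v ^^ (k - 1)) (dir_deriv (dual_dir I u v l) f) x"
  proof (induction k)
    case (Suc k)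
    then have "\<forall>\<^sub>F z in nhds x. \<forall>\<^sub>F x in nhds z. (plap I u v ^^ k) (\<lambda>x. l x * f x) x =
      l x * (plap I u v ^^ k) f x + of_nat k * (plap I u v ^^ (k - 1)) (dir_deriv (dual_dir I u v l) f) x"
      by (simp add: eventually_eventually)
    then show ?case using holo_eventually[OF f]
    proof eventually_elim
      fix x assume ev: "\<forall>\<^sub>F x in nhds x. (plap I u v ^^ k) (\<lambda>x. l x * f x) x =
        l x * (plap I u v ^^ k) f x + of_nat k * (plap I u v ^^ (k - 1)) (dir_deriv (dual_dir I u v l) f) x"
        and f: "holo f x"
      have "(plap I u v ^^ Suc k) (\<lambda>x. l x * f x) x =
        plap I u v (\<lambda>x. l x * (plap I u v ^^ k) f x + of_nat k * (plap I u v ^^ (k - 1)) (dir_deriv (dual_dir I u v l) f) x) x"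
        by (simp add: plap_cong[OF ev])
      also have "\<dots> = l x * (plap I u v ^^ Suc k) f x + (dir_deriv (dual_dir I u v l) ((plap I u v ^^ k) f) x +
        of_nat k * plap I u v ((plap I u v ^^ (k - 1)) (dir_deriv (dual_dir I u v l) f)) x)"
        using plap_pow_add[where k=1 and I=I and u=u and v=v and x=x, of "\<lambda>x. l x * (plap I u v ^^ k) f x"
          "\<lambda>x. of_nat k * (plap I u v ^^ (k - 1)) (dir_deriv (dual_dir I u v l) f) x"]
        by (simp add: holo_intros hl f holo_plap_pow holo_dir_deriv plap_cmult plap_linear_mult[OF l])
      also have "of_nat k * plap I u v ((plap I u v ^^ (k - 1)) (dir_deriv (dual_dir I u v l) f)) x =
        of_nat k * (plap I u v ^^ k) (dir_deriv (dual_dir I u v l) f) x"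
        by (cases k) auto
      also have "dir_deriv (dual_dir I u v l) ((plap I u v ^^ k) f) x = (plap I u v ^^ k) (dir_deriv (dual_dir I u v l) f) x"
        using f by (rule dir_deriv_plap_pow)
      finally show "(plap I u v ^^ Suc k) (\<lambda>x. l x * f x) x =
        l x * (plap I u v ^^ Suc k) f x + of_nat (Suc k) * (plap I u v ^^ (Suc k - 1)) (dir_deriv (dual_dir I u v l) f) x"
        by (simp add: algebra_simps)
    qed
  qed simp
  then show ?thesis by (rule eventually_nhds_x_imp_x)
qed

text \<open>The coefficient of \<open>t\<^sup>k\<close> in the exponential of \<open>t\<close> times \<open>plap I u v\<close>.\<close>

definition ecoeff :: "'i set \<Rightarrow> ('i \<Rightarrow> 'a) \<Rightarrow> ('i \<Rightarrow> 'a) \<Rightarrow> nat \<Rightarrow> ('a::complex_space \<Rightarrow> complex) \<Rightarrow> 'a \<Rightarrow> complex" where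
  "ecoeff I u v k f x = (plap I u v ^^ k) f x / fact k"

text \<open>Where \<open>l\<close> vanishes only the commutator term survives, and its factor
  \<open>Suc k\<close> turns the factorial of \<open>Suc k\<close> into that of \<open>k\<close>.
  This is the formal counterpart of integration by parts.\<close>

lemma ecoeff_linear_mult:
  assumes "linear l" "\<And>v. l (imul v) = \<i> * l v" and "holo f x" "l x = 0"
  shows "ecoeff I u v (Suc k) (\<lambda>x. l x * f x) x = ecoeff I u v k (dir_deriv (dual_dir I u v l) f) x"
    and "ecoeff I u v 0 (\<lambda>x. l x * f x) x = 0"
proof -
  have "(1 + of_nat k :: complex) \<noteq> 0" by (metis of_nat_Suc of_nat_neq_0)
  then show "ecoeff I u v (Suc k) (\<lambda>x. l x * f x) x = ecoeff I u v k (dir_deriv (dual_dir I u v l) f) x"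
    unfolding ecoeff_def plap_pow_linear_mult[OF assms(1-3)] using assms(4) by simp
qed (use assms in \<open>simp add: ecoeff_def\<close>)

lemma holo_ecoeff: "holo f x \<Longrightarrow> holo (ecoeff I u v k f) x"
  unfolding ecoeff_def by (intro holo_divide holo_plap_pow)

lemma ecoeff_0: "ecoeff I u v 0 f x = f x"
  by (simp add: ecoeff_def)

lemma plap_ecoeff:
  assumes "holo f x"
  shows "plap J u' v' (ecoeff I u v k f) x = plap J u' v' ((plap I u v ^^ k) f) x / fact k"
proof -
  have "ecoeff I u v k f = (\<lambda>x. inverse (fact k) * (plap I u v ^^ k) f x)"
    by (simp add: ecoeff_def fun_eq_iff field_simps)
  then have "plap J u' v' (ecoeff I u v k f) x = inverse (fact k) * plap J u' v' ((plap I u v ^^ k) f) x"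
    by (simp only: plap_cmult[OF holo_plap_pow[OF assms]])
  then show ?thesis by (simp add: field_simps)
qed

text \<open>The differential equation in \<open>t\<close> of the exponential series, read off on
  coefficients.\<close>

lemma ecoeff_Suc:
  assumes "holo f x"
  shows "of_nat (Suc k) * ecoeff I u v (Suc k) f x = plap I u v (ecoeff I u v k f) x"
  unfolding plap_ecoeff[OF assms] by (simp add: ecoeff_def del: of_nat_Suc)

lemma ecoeff_cong: "\<forall>\<^sub>F y in nhds x. f y = g y \<Longrightarrow> ecoeff I u v k f x = ecoeff I u v k g x"
  by (simp add: ecoeff_def plap_pow_cong)

lemma ecoeff_sum:
  "(\<And>j. j \<in> J \<Longrightarrow> holo (f j) x) \<Longrightarrow>
    ecoeff I u v k (\<lambda>x. \<Sum>j\<in>J. f j x) x = (\<Sum>j\<in>J. ecoeff I u v k (f j) x)"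
  by (simp add: ecoeff_def plap_pow_sum sum_divide_distrib)

lemma ecoeff_add:
  "holo f x \<Longrightarrow> holo g x \<Longrightarrow>
    ecoeff I u v k (\<lambda>x. f x + g x) x = ecoeff I u v k f x + ecoeff I u v k g x"
  by (simp add: ecoeff_def plap_pow_add add_divide_distrib)

lemma ecoeff_cmult: "holo f x \<Longrightarrow> ecoeff I u v k (\<lambda>x. c * f x) x = c * ecoeff I u v k f x"
  by (simp add: ecoeff_def plap_pow_cmult)

lemma ecoeff_zero [simp]: "ecoeff I u v k (\<lambda>_. 0) x = 0"
  using ecoeff_cmult[of "\<lambda>_. 0" x I u v k 0] by simp

lemma dir_deriv_ecoeff: "holo f x \<Longrightarrow> dir_deriv w (ecoeff I u v k f) x = ecoeff I u v k (dir_deriv w f) x"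
  unfolding ecoeff_def by (simp add: dir_deriv_divide holo_cdiff holo_plap_pow dir_deriv_plap_pow)

lemma plap_ecoeff_commute:
  assumes "holo f x"
  shows "plap J u' v' (ecoeff I u v k f) x = ecoeff I u v k (plap J u' v' f) x"
  unfolding plap_ecoeff[OF assms] by (simp add: ecoeff_def plap_plap_pow_commute assms)

text \<open>The exponential of a sum of commuting operators is the product of the exponentials. The
  right side is shown to satisfy the recursion \<open>ecoeff_Suc\<close>, as if a product were
  differentiated in \<open>t\<close>.\<close>

lemma ecoeff_Un:
  assumes fin: "finite I" "finite J" and disj: "I \<inter> J = {}" and f: "holo f x"
  shows "ecoeff (I \<union> J) u v N f x = (\<Sum>k\<le>N. ecoeff I u v k (ecoeff J u v (N - k) f) x)"
proof -
  let ?S = "\<lambda>N x. \<Sum>k\<le>N. ecoeff I u v k (ecoeff J u v (N - k) f) x"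
  have "\<forall>\<^sub>F x in nhds x. ecoeff (I \<union> J) u v N f x = ?S N x"
  proof (induction N)
    case (Suc N)
    then have "\<forall>\<^sub>F z in nhds x. \<forall>\<^sub>F x in nhds z. ecoeff (I \<union> J) u v N f x = ?S N x"
      by (simp add: eventually_eventually)
    then show ?case using holo_eventually[OF f]
    proof eventually_elim
      fix x assume ev: "\<forall>\<^sub>F x in nhds x. ecoeff (I \<union> J) u v N f x = ?S N x" and f: "holo f x"
      define b where "b j = ecoeff J u v j f" for j
      have hb: "\<forall>\<^sub>F x in nhds x. holo (b j) x" for j
        using holo_eventually[OF f] unfolding b_def by eventually_elim (rule holo_ecoeff)
      then have hbx: "holo (b j) x" for j by (rule eventually_nhds_x_imp_x)
      have bev: "\<forall>\<^sub>F x in nhds x. plap J u v (b j) x = of_nat (Suc j) * b (Suc j) x" for j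
        using holo_eventually[OF f] unfolding b_def by eventually_elim (rule ecoeff_Suc[symmetric])
      have 1: "plap I u v (ecoeff I u v k (b j)) x = of_nat (Suc k) * ecoeff I u v (Suc k) (b j) x" for k j
        using hbx by (rule ecoeff_Suc[symmetric])
      have 2: "plap J u v (ecoeff I u v k (b j)) x = of_nat (Suc j) * ecoeff I u v k (b (Suc j)) x" for k j
        by (simp add: plap_ecoeff_commute hbx ecoeff_cong[OF bev] ecoeff_cmult del: of_nat_Suc)
      have "of_nat (Suc N) * ecoeff (I \<union> J) u v (Suc N) f x = plap (I \<union> J) u v (ecoeff (I \<union> J) u v N f) x"
        using f by (rule ecoeff_Suc)
      also have "\<dots> = plap (I \<union> J) u v (\<lambda>x. \<Sum>k\<le>N. ecoeff I u v k (b (N - k)) x) x"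
        using ev unfolding b_def by (rule plap_cong)
      also have "\<dots> = (\<Sum>k\<le>N. plap (I \<union> J) u v (ecoeff I u v k (b (N - k))) x)"
        by (intro plap_sum holo_ecoeff hbx)
      also have "\<dots> = (\<Sum>k\<le>N. plap I u v (ecoeff I u v k (b (N - k))) x + plap J u v (ecoeff I u v k (b (N - k))) x)"
        using fin disj by (simp add: plap_def sum.union_disjoint)
      also have "\<dots> = (\<Sum>k\<le>N. of_nat (Suc k) * ecoeff I u v (Suc k) (b (N - k)) x) +
         (\<Sum>k\<le>N. of_nat (Suc N - k) * ecoeff I u v k (b (Suc N - k)) x)"
        unfolding sum.distrib 1 2 by (intro arg_cong2[where f="(+)"] sum.cong refl) (simp_all add: Suc_diff_le)
      also have "(\<Sum>k\<le>N. of_nat (Suc k) * ecoeff I u v (Suc k) (b (N - k)) x) =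
         (\<Sum>k\<le>Suc N. of_nat k * ecoeff I u v k (b (Suc N - k)) x)"
        by (subst sum.atMost_Suc_shift) simp
      also have "(\<Sum>k\<le>N. of_nat (Suc N - k) * ecoeff I u v k (b (Suc N - k)) x) =
         (\<Sum>k\<le>Suc N. of_nat (Suc N - k) * ecoeff I u v k (b (Suc N - k)) x)"
        by simp
      \<comment> \<open>The weights \<open>k\<close> and \<open>Suc N - k\<close> add up to
        \<open>Suc N\<close>, which is cancelled at the end.\<close>
      also have "(\<Sum>k\<le>Suc N. of_nat k * ecoeff I u v k (b (Suc N - k)) x) + \<dots> =
         of_nat (Suc N) * (\<Sum>k\<le>Suc N. ecoeff I u v k (b (Suc N - k)) x)"
        unfolding sum.distrib[symmetric] sum_distrib_left distrib_right[symmetric]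
        by (intro sum.cong refl) (simp flip: of_nat_add)
      finally show "ecoeff (I \<union> J) u v (Suc N) f x = ?S (Suc N) x"
        unfolding b_def by (metis mult_left_cancel of_nat_neq_0)
    qed
  qed (simp add: ecoeff_0)
  then show ?thesis by (rule eventually_nhds_x_imp_x)
qed

lemma plap_pow_fst_slice:
  "(plap I (\<lambda>i. (u i, 0)) (\<lambda>i. (v i, 0)) ^^ k) f (x, y) = (plap I u v ^^ k) (\<lambda>x. f (x, y)) x"
proof -
  have "(\<lambda>x. (plap I (\<lambda>i. (u i, 0)) (\<lambda>i. (v i, 0)) ^^ k) f (x, y)) = (plap I u v ^^ k) (\<lambda>x. f (x, y))"
    by (induction k) (simp_all add: plap_def flip: dir_deriv_fst_slice)
  then show ?thesis by (rule fun_cong)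
qed

lemma plap_pow_snd_slice:
  "(plap I (\<lambda>i. (0, u i)) (\<lambda>i. (0, v i)) ^^ k) f (y, x) = (plap I u v ^^ k) (\<lambda>x. f (y, x)) x"
proof -
  have "(\<lambda>x. (plap I (\<lambda>i. (0, u i)) (\<lambda>i. (0, v i)) ^^ k) f (y, x)) = (plap I u v ^^ k) (\<lambda>x. f (y, x))"
    by (induction k) (simp_all add: plap_def flip: dir_deriv_snd_slice)
  then show ?thesis by (rule fun_cong)
qed

lemma ecoeff_fst_slice:
  "ecoeff I (\<lambda>i. (u i, 0)) (\<lambda>i. (v i, 0)) k f (x, y) = ecoeff I u v k (\<lambda>x. f (x, y)) x"
  by (simp add: ecoeff_def plap_pow_fst_slice)

lemma ecoeff_snd_slice:
  "ecoeff I (\<lambda>i. (0, u i)) (\<lambda>i. (0, v i)) k f (y, x) = ecoeff I u v k (\<lambda>x. f (y, x)) x"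
  by (simp add: ecoeff_def plap_pow_snd_slice)

text \<open>Along \<open>s \<mapsto> b (X + s V(X))\<close> with \<open>V = \<Sum> a\<^sub>c e\<^sub>c\<close> and \<open>\<partial>\<^sub>e a = 0\<close>, the \<open>s\<close>-derivative is
  \<open>\<Sum> a\<^sub>c \<partial>\<^sub>e\<^sub>c\<close> of the function itself, so it is annihilated by the functional for every \<open>s\<close>.\<close>

lemma ecoeff_flow_invariant:
  fixes a :: "'c \<Rightarrow> 'a::complex_space \<Rightarrow> complex" and e :: "'c \<Rightarrow> 'a"
  assumes C: "finite C"
    and a: "\<And>c. c \<in> C \<Longrightarrow> holo (a c) x0" "\<And>c. c \<in> C \<Longrightarrow> a c x0 = 0"
    and ea: "\<forall>\<^sub>F x in nhds x0. \<forall>c\<in>C. \<forall>c'\<in>C. dir_deriv (e c) (a c') x = 0"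
    and ann: "\<And>b. holo b x0 \<Longrightarrow> ecoeff I u v k (\<lambda>x. \<Sum>c\<in>C. a c x * dir_deriv (e c) b x) x0 = 0"
    and b: "holo b x0"
  shows "ecoeff I u v k (\<lambda>x. b (x + (\<Sum>c\<in>C. cscale (a c x) (e c)))) x0 = ecoeff I u v k b x0"
proof -
  define V where "V x = (\<Sum>c\<in>C. cscale (a c x) (e c))" for x
  have V0: "V x0 = 0" using a(2) by (simp add: V_def)
  have "holo V x0" unfolding V_def by (intro holo_intros a)
  \<comment> \<open>The path parameter is adjoined as a coordinate: \<open>H\<close> is one function
    on the product, and its \<open>s\<close>-derivative is a directional derivative that commutes
    with \<open>ecoeff\<close>.\<close>
  define H where "H p = b (fst p + cscale (snd p) (V (fst p)))" for p :: "'a \<times> complex"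
  have hV: "holo (\<lambda>p. V (fst p)) (x0, s)" for s :: complex
    by (rule holo_compose[of V fst]) (use \<open>holo V x0\<close> in simp_all)
  have hX: "holo (\<lambda>p. fst p + cscale (snd p) (V (fst p))) (x0, s)" for s
    by (intro holo_intros hV)
  \<comment> \<open>As \<open>V x0 = 0\<close>, the point \<open>x0\<close> is fixed for every
    complex \<open>s\<close>, so holomorphy of \<open>b\<close> at \<open>x0\<close> serves all
    \<open>s\<close>.\<close>
  have hH: "holo H (x0, s)" for s
    unfolding H_def by (rule holo_compose[of b, OF _ hX]) (use V0 b in simp)
  let ?u = "\<lambda>i. (u i, 0 :: complex)" and ?v = "\<lambda>i. (v i, 0 :: complex)"
  let ?e = "(0 :: 'a, 1 :: complex)"
  have dH: "\<forall>\<^sub>F p in nhds (x0, s). dir_deriv ?e H p = (\<Sum>c\<in>C. a c (fst p) * dir_deriv (e c, 0) H p)" for s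
  proof -
    have "holo fst (x0, s)" by simp
    from holo_eventually_compose[OF this, of "\<lambda>x. holo V x"]
    have 1: "\<forall>\<^sub>F p in nhds (x0, s). holo V (fst p)"
      using \<open>holo V x0\<close> by (simp add: holo_eventually)
    from holo_eventually_compose[OF \<open>holo fst (x0, s)\<close>, of "\<lambda>x. \<forall>c\<in>C. \<forall>c'\<in>C. dir_deriv (e c) (a c') x = 0"]
    have 2: "\<forall>\<^sub>F p in nhds (x0, s). \<forall>c\<in>C. \<forall>c'\<in>C. dir_deriv (e c) (a c') (fst p) = 0"
      using ea by simp
    from holo_eventually_compose[OF \<open>holo fst (x0, s)\<close>, of "\<lambda>x. \<forall>c\<in>C. holo (a c) x"]
    have 3: "\<forall>\<^sub>F p in nhds (x0, s). \<forall>c\<in>C. holo (a c) (fst p)"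
      using C a by (simp add: eventually_ball_finite holo_eventually)
    from holo_eventually_compose[OF hX[of s], of "holo b"]
    have 4: "\<forall>\<^sub>F p in nhds (x0, s). holo b (fst p + cscale (snd p) (V (fst p)))"
      using b V0 by (simp add: holo_eventually)
    from 1 2 3 4 show ?thesis
    proof eventually_elim
      fix p :: "'a \<times> complex"
      assume V: "holo V (fst p)" and ea: "\<forall>c\<in>C. \<forall>c'\<in>C. dir_deriv (e c) (a c') (fst p) = 0"
        and ha: "\<forall>c\<in>C. holo (a c) (fst p)"
        and hb: "holo b (fst p + cscale (snd p) (V (fst p)))"
      obtain x s where p: "p = (x, s)" by (cases p)
      let ?X = "x + cscale s (V x)"
      have b': "cdiff b ?X" using hb p by (simp add: holo_cdiff)
      have "dir_deriv ?e H p = dir_deriv 1 (\<lambda>s. b (x + cscale s (V x))) s"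
        by (simp add: p H_def flip: dir_deriv_snd_slice)
      also have "\<dots> = dir_deriv (cscale 1 (V x)) b ?X"
        by (rule dir_deriv_compose[where f=b and g="\<lambda>s. x + cscale s (V x)" and x=s and G="\<lambda>h. cscale h (V x)", OF b'])
          (auto intro!: derivative_eq_intros bounded_linear_imp_has_derivative cscale_bounded_linear_left
            simp: cscale_cscale imul_complex_def simp flip: cscale_imaginary)
      also have "\<dots> = (\<Sum>c\<in>C. a c x * dir_deriv (e c) b ?X)"
        by (simp add: V_def dir_deriv_sum_dir b'[unfolded V_def] dir_deriv_cscale)
      also have "\<dots> = (\<Sum>c\<in>C. a c x * dir_deriv (e c, 0) H p)"
      proof (intro sum.cong refl arg_cong2[where f="(*)"])
        fix c assume c: "c \<in> C"
        have Vd: "(V has_derivative (\<lambda>w. \<Sum>c'\<in>C. cscale (dir_deriv w (a c') x) (e c'))) (at x)"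
          unfolding V_def
          using ha p by (intro has_derivative_sum bounded_linear.has_derivative[OF cscale_bounded_linear_left] cdiff_has_derivative)
             (simp add: holo_cdiff)
        have "dir_deriv (e c, 0) H p = dir_deriv (e c) (\<lambda>x. b (x + cscale s (V x))) x"
          by (simp add: p H_def flip: dir_deriv_fst_slice)
        also have "\<dots> = dir_deriv (e c + cscale s (\<Sum>c'\<in>C. cscale (dir_deriv (e c) (a c') x) (e c'))) b ?X"
          by (rule dir_deriv_compose[where f=b and g="\<lambda>x. x + cscale s (V x)" and x=x and G="\<lambda>w. w + cscale s (\<Sum>c'\<in>C. cscale (dir_deriv w (a c') x) (e c'))", OF b'])
            (use ha p in \<open>auto intro!: sum.cong derivative_eq_intros bounded_linear.has_derivative[OF cscale_bounded_linear_right] Vd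
            simp: cscale_sum_right cscale_cscale dir_deriv_cscale holo_cdiff mult.commute mult.left_commute cscale_add_right
            simp flip: cscale_imaginary\<close>)
        \<comment> \<open>The coefficients do not vary in the flow directions, so a step along
          \<open>e c\<close> before the flow is the same step after it. This turns derivatives of
          \<open>b\<close> at the image point into derivatives of \<open>H\<close>.\<close>
        also have "(\<Sum>c'\<in>C. cscale (dir_deriv (e c) (a c') x) (e c')) = 0"
          using ea c p by simp
        finally show "dir_deriv (e c) b ?X = dir_deriv (e c, 0) H p" by simp
      qed
      finally show "dir_deriv ?e H p = (\<Sum>c\<in>C. a c (fst p) * dir_deriv (e c, 0) H p)" using p by simp
    qed
  qed
  have "dir_deriv ?e (ecoeff I ?u ?v k H) (x0, s) = 0" for s
  proof -
    have "dir_deriv ?e (ecoeff I ?u ?v k H) (x0, s) = ecoeff I ?u ?v k (dir_deriv ?e H) (x0, s)"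
      by (rule dir_deriv_ecoeff[OF hH])
    also have "\<dots> = ecoeff I ?u ?v k (\<lambda>p. \<Sum>c\<in>C. a c (fst p) * dir_deriv (e c, 0) H p) (x0, s)"
      by (rule ecoeff_cong[OF dH])
    also have "\<dots> = ecoeff I u v k (\<lambda>x. \<Sum>c\<in>C. a c x * dir_deriv (e c) (\<lambda>x. H (x, s)) x) x0"
      by (simp add: ecoeff_fst_slice dir_deriv_fst_slice[where f=H])
    also have "\<dots> = 0"
      by (rule ann, rule holo_compose[of H "\<lambda>x. (x, s)"]) (intro hH holo_intros)+
    finally show ?thesis .
  qed
  moreover have "((\<lambda>s. ecoeff I ?u ?v k H (x0, s)) has_field_derivative dir_deriv ?e (ecoeff I ?u ?v k H) (x0, s)) (at s)" for s
  proof -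
    have c: "cdiff (ecoeff I ?u ?v k H) ((x0, 0) + cscale s ?e)"
      using holo_cdiff[OF holo_ecoeff[OF hH]] by simp
    show ?thesis
      using cdiff_line[OF cdiff_has_derivative[OF c]] c by (simp add: dir_deriv_imul imul_complex_def)
  qed
  ultimately have "((\<lambda>s. ecoeff I ?u ?v k H (x0, s)) has_field_derivative 0) (at s)" for s
    by simp
  then have "ecoeff I ?u ?v k H (x0, 1) = ecoeff I ?u ?v k H (x0, 0)"
    using has_field_derivative_zero_constant[of UNIV "\<lambda>s. ecoeff I ?u ?v k H (x0, s)"]
    by (metis UNIV_I convex_UNIV)
  then show ?thesis
    by (simp add: ecoeff_fst_slice H_def V_def)
qed

section \<open>Changes of variables preserving the phase\<close>

definition xdir :: "'n \<Rightarrow> (complex ^ 'n::finite) \<times> (complex ^ 'n)" where "xdir i = (axis i 1, 0)"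
definition cdir :: "'n \<Rightarrow> (complex ^ 'n::finite) \<times> (complex ^ 'n)" where "cdir i = (0, axis i 1)"

text \<open>The disjoint sum indexes the coordinates of the two cotangent pairs; its two halves give
  the two partial pairings.\<close>

definition xdir2 :: "'n + 'n \<Rightarrow> ('n::finite) cotangent \<times> 'n cotangent" where
  "xdir2 = case_sum (\<lambda>i. (xdir i, 0)) (\<lambda>i. (0, xdir i))"
definition cdir2 :: "'n + 'n \<Rightarrow> ('n::finite) cotangent \<times> 'n cotangent" where
  "cdir2 = case_sum (\<lambda>i. (cdir i, 0)) (\<lambda>i. (0, cdir i))"

abbreviation T1 :: "nat \<Rightarrow> (('n::finite) cotangent \<Rightarrow> complex) \<Rightarrow> 'n cotangent \<Rightarrow> complex" where
  "T1 \<equiv> ecoeff UNIV xdir cdir"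
abbreviation T2 :: "nat \<Rightarrow> (('n::finite) cotangent \<times> 'n cotangent \<Rightarrow> complex) \<Rightarrow> 'n cotangent \<times> 'n cotangent \<Rightarrow> complex" where
  "T2 \<equiv> ecoeff UNIV xdir2 cdir2"

lemma cscale_axis: "cscale s (axis i (1::complex)) = axis i s"
  by (simp add: cscale_vec_complex vec_eq_iff axis_def)

lemma partial_deriv_eq_dir_deriv: "partial_deriv i f z = dir_deriv (axis i 1) f z"
  by (simp add: partial_deriv_def dir_deriv_def cscale_axis)

lemma pairing_deriv_pow: "(pairing_deriv ^^ k) F x y = (plap UNIV xdir cdir ^^ k) (case_prod F) (x, y)"
proof -
  have "pairing_deriv F = curry (plap UNIV xdir cdir (case_prod F))" for F :: "complex ^ 'a \<Rightarrow> complex ^ 'a \<Rightarrow> complex"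
    unfolding pairing_deriv_def plap_def xdir_def cdir_def partial_deriv_eq_dir_deriv
    by (simp add: fun_eq_iff curry_def dir_deriv_def)
  then have "(pairing_deriv ^^ k) F = curry ((plap UNIV xdir cdir ^^ k) (case_prod F))"
    by (induction k) auto
  then show ?thesis by simp
qed

lemma exp_pairing_eq: "exp_pairing F \<nu> x y = (\<Sum>k\<le>\<nu>. T1 k (case_prod (F (\<nu> - k))) (x, y))"
  by (simp add: exp_pairing_def ecoeff_def pairing_deriv_pow)

lemma UNIV_eq_Inl_Un_Inr: "(UNIV :: ('a + 'b) set) = range Inl \<union> range Inr"
  using UNIV_sum by auto

lemma ecoeff_reindex: "inj g \<Longrightarrow> ecoeff (range g) u v k = ecoeff UNIV (\<lambda>i. u (g i)) (\<lambda>i. v (g i)) k"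
proof -
  assume "inj g"
  then have "plap (range g) u v = plap UNIV (\<lambda>i. u (g i)) (\<lambda>i. v (g i))"
    by (simp add: plap_def fun_eq_iff sum.reindex)
  then show ?thesis by (intro ext) (simp add: ecoeff_def)
qed

text \<open>Fubini for the formal integral: each half of the index set differentiates in one pair
  only. Which pair becomes the outer one is a free choice, made the other way round in
  \<open>T2_split2\<close>.\<close>

lemma T2_split1:
  assumes "holo F (X, Y)"
  shows "T2 N F (X, Y) = (\<Sum>k\<le>N. T1 k (\<lambda>X. T1 (N - k) (\<lambda>Y. F (X, Y)) Y) X)"
  unfolding UNIV_eq_Inl_Un_Inr
  by (subst ecoeff_Un) (use assms in \<open>auto simp: ecoeff_reindex xdir2_def cdir2_def ecoeff_fst_slice ecoeff_snd_slice\<close>)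

lemma T2_split2:
  assumes "holo F (X, Y)"
  shows "T2 N F (X, Y) = (\<Sum>k\<le>N. T1 k (\<lambda>Y. T1 (N - k) (\<lambda>X. F (X, Y)) X) Y)"
  unfolding UNIV_eq_Inl_Un_Inr Un_commute[of "range Inl"]
  by (subst ecoeff_Un) (use assms in \<open>auto simp: ecoeff_reindex xdir2_def cdir2_def ecoeff_fst_slice ecoeff_snd_slice\<close>)

lemma holo_slice_fst: "holo g (x, y) \<Longrightarrow> \<forall>\<^sub>F x in nhds x. holo (\<lambda>y. g (x, y)) y"
proof -
  assume g: "holo g (x, y)"
  have "holo (\<lambda>x. (x, y)) x" by (intro holo_intros)
  from holo_eventually_compose[OF this, of "holo g"] g
  have "\<forall>\<^sub>F x in nhds x. holo g (x, y)" by (simp add: holo_eventually)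
  then show ?thesis
    by (rule eventually_mono) (erule holo_compose[of g], intro holo_intros)
qed

lemma holo_slice_snd: "holo g (x, y) \<Longrightarrow> \<forall>\<^sub>F y in nhds y. holo (\<lambda>x. g (x, y)) x"
proof -
  assume g: "holo g (x, y)"
  have "holo (\<lambda>y. (x, y)) y" by (intro holo_intros)
  from holo_eventually_compose[OF this, of "holo g"] g
  have "\<forall>\<^sub>F y in nhds y. holo g (x, y)" by (simp add: holo_eventually)
  then show ?thesis
    by (rule eventually_mono) (erule holo_compose[of g], intro holo_intros)
qed

text \<open>A factor free of the inner variables is a constant for the inner operator. In this form
  an iterated composition is recognized as one exponential in two pairs of variables.\<close>

lemma T2_nested1:
  assumes "holo (\<lambda>P. c (fst P) * g P) (0, 0)" "holo g (0, 0)"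
  shows "T2 N (\<lambda>P. c (fst P) * g P) (0, 0) = (\<Sum>k\<le>N. T1 k (\<lambda>X. c X * T1 (N - k) (\<lambda>Y. g (X, Y)) 0) 0)"
proof -
  have "\<forall>\<^sub>F X in nhds 0. T1 l (\<lambda>Y. c X * g (X, Y)) 0 = c X * T1 l (\<lambda>Y. g (X, Y)) 0" for l
    using holo_slice_fst[OF assms(2)] by eventually_elim (rule ecoeff_cmult)
  then show ?thesis
    by (auto simp: T2_split1[OF assms(1)] intro!: sum.cong ecoeff_cong)
qed

lemma T2_nested2:
  assumes "holo (\<lambda>P. c (snd P) * g P) (0, 0)" "holo g (0, 0)"
  shows "T2 N (\<lambda>P. c (snd P) * g P) (0, 0) = (\<Sum>k\<le>N. T1 k (\<lambda>Y. c Y * T1 (N - k) (\<lambda>X. g (X, Y)) 0) 0)"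
proof -
  have "\<forall>\<^sub>F Y in nhds 0. T1 l (\<lambda>X. c Y * g (X, Y)) 0 = c Y * T1 l (\<lambda>X. g (X, Y)) 0" for l
    using holo_slice_snd[OF assms(2)] by eventually_elim (rule ecoeff_cmult)
  then show ?thesis
    by (auto simp: T2_split2[OF assms(1)] intro!: sum.cong ecoeff_cong)
qed

definition xcoord2 :: "'n + 'n \<Rightarrow> ('n::finite) cotangent \<times> 'n cotangent \<Rightarrow> complex" where
  "xcoord2 = case_sum (\<lambda>j X. fst (fst X) $ j) (\<lambda>j X. fst (snd X) $ j)"
definition ccoord2 :: "'n + 'n \<Rightarrow> ('n::finite) cotangent \<times> 'n cotangent \<Rightarrow> complex" where
  "ccoord2 = case_sum (\<lambda>j X. snd (fst X) $ j) (\<lambda>j X. snd (snd X) $ j)"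

lemma linear_xcoord2: "linear (xcoord2 c)" and linear_ccoord2: "linear (ccoord2 c)"
  by (cases c; auto intro!: linearI simp: xcoord2_def ccoord2_def)+

lemma imul_xcoord2: "xcoord2 c (imul X) = \<i> * xcoord2 c X" and imul_ccoord2: "ccoord2 c (imul X) = \<i> * ccoord2 c X"
  by (cases c; auto simp: xcoord2_def ccoord2_def imul_prod_def imul_vec_def imul_complex_def)+

lemma xcoord2_xdir2: "xcoord2 c (xdir2 d) = (if c = d then 1 else 0)" and xcoord2_cdir2: "xcoord2 c (cdir2 d) = 0"
  and ccoord2_xdir2: "ccoord2 c (xdir2 d) = 0" and ccoord2_cdir2: "ccoord2 c (cdir2 d) = (if c = d then 1 else 0)"
  by (cases c; cases d; auto simp: xcoord2_def ccoord2_def xdir2_def cdir2_def xdir_def cdir_def axis_def)+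

lemma cscale_if: "cscale (if P then 1 else 0) x = (if P then x else 0)"
  by simp

lemma dual_dir_xcoord2: "dual_dir UNIV xdir2 cdir2 (xcoord2 c) = cdir2 c" and dual_dir_ccoord2: "dual_dir UNIV xdir2 cdir2 (ccoord2 c) = xdir2 c"
  by (simp_all add: dual_dir_def xcoord2_xdir2 xcoord2_cdir2 ccoord2_xdir2 ccoord2_cdir2 cscale_if)

lemma T2_xcoord2:
  assumes "holo f 0"
  shows "T2 (Suc k) (\<lambda>x. xcoord2 c x * f x) 0 = T2 k (dir_deriv (cdir2 c) f) 0" "T2 0 (\<lambda>x. xcoord2 c x * f x) 0 = 0"
    "T2 (Suc k) (\<lambda>x. ccoord2 c x * f x) 0 = T2 k (dir_deriv (xdir2 c) f) 0" "T2 0 (\<lambda>x. ccoord2 c x * f x) 0 = 0"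
  using ecoeff_linear_mult[where l="xcoord2 c" and f=f and x=0 and I=UNIV and u=xdir2 and v=cdir2]
    ecoeff_linear_mult[where l="ccoord2 c" and f=f and x=0 and I=UNIV and u=xdir2 and v=cdir2] assms
  by (simp_all add: dual_dir_xcoord2 dual_dir_ccoord2 linear_0 linear_xcoord2 linear_ccoord2 imul_xcoord2 imul_ccoord2)

lemma holo_xcoord2: "holo (xcoord2 c) x" and holo_ccoord2: "holo (ccoord2 c) x"
  using linear_xcoord2 linear_ccoord2 imul_xcoord2 imul_ccoord2 by (auto intro!: holo_linear simp: imul_complex_def)

text \<open>Since \<open>a c\<close> does not depend on covectors, it may be moved under the
  covector derivative, which at 0 is multiplication by \<open>xcoord2 c\<close> one order higher.
  Summing over \<open>c\<close> produces the pairing of position and shift, which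
  \<open>orth\<close> makes 0.\<close>

lemma T2_shift_invariant:
  assumes a: "\<And>c. holo (a c) 0" "\<And>c. a c 0 = 0"
    and ea: "\<And>c c' x. dir_deriv (cdir2 c) (a c') x = 0"
    and orth: "\<forall>\<^sub>F x in nhds 0. (\<Sum>c\<in>UNIV. xcoord2 c x * a c x) = 0"
    and b: "holo b 0"
  shows "T2 k (\<lambda>x. b (x + (\<Sum>c\<in>UNIV. cscale (a c x) (cdir2 c)))) 0 = T2 k b 0"
proof (rule ecoeff_flow_invariant)
  fix b :: "'a cotangent \<times> 'a cotangent \<Rightarrow> complex" assume b: "holo b 0"
  have "T2 k (\<lambda>x. a c x * dir_deriv (cdir2 c) b x) 0 = T2 (Suc k) (\<lambda>x. xcoord2 c x * (a c x * b x)) 0" for c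
  proof -
    have "\<forall>\<^sub>F x in nhds 0. a c x * dir_deriv (cdir2 c) b x = dir_deriv (cdir2 c) (\<lambda>x. a c x * b x) x"
      using holo_eventually[OF a(1)[of c]] holo_eventually[OF b]
      by eventually_elim (simp add: dir_deriv_mult holo_cdiff ea)
    then show ?thesis
      using T2_xcoord2(1)[of "\<lambda>x. a c x * b x" k c] a b
      by (simp add: ecoeff_cong holo_mult)
  qed
  then have "T2 k (\<lambda>x. \<Sum>c\<in>UNIV. a c x * dir_deriv (cdir2 c) b x) 0 =
      (\<Sum>c\<in>UNIV. T2 (Suc k) (\<lambda>x. xcoord2 c x * (a c x * b x)) 0)"
    by (subst ecoeff_sum) (auto intro!: holo_mult a(1) holo_dir_deriv b)
  also have "\<dots> = T2 (Suc k) (\<lambda>x. \<Sum>c\<in>UNIV. xcoord2 c x * (a c x * b x)) 0"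
    by (subst ecoeff_sum) (auto intro!: holo_mult a(1) b holo_xcoord2)
  also have "\<dots> = T2 (Suc k) (\<lambda>x. 0) (0 :: 'a cotangent \<times> 'a cotangent)"
  proof (rule ecoeff_cong)
    show "\<forall>\<^sub>F x in nhds 0. (\<Sum>c\<in>UNIV. xcoord2 c x * (a c x * b x)) = 0"
      using orth by eventually_elim (simp add: sum_distrib_right[symmetric] mult.assoc[symmetric])
  qed
  also have "\<dots> = 0" by simp
  finally show "T2 k (\<lambda>x. \<Sum>c\<in>UNIV. a c x * dir_deriv (cdir2 c) b x) 0 = 0" .
qed (use assms in auto)

lemma sum_Times_bool: "(\<Sum>c\<in>A \<times> (UNIV :: bool set). f c) = (\<Sum>x\<in>A. f (x, True) + f (x, False))"
  using sum.cartesian_product[of "\<lambda>x t. f (x, t)" "UNIV :: bool set" A]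
  by (simp add: UNIV_bool add.commute)

lemma sum_UNIV_pair: "(\<Sum>p\<in>UNIV. f p) = (\<Sum>i\<in>UNIV. \<Sum>j\<in>UNIV. f (i, j))"
  using sum.cartesian_product[of "\<lambda>x t. f (x, t)" UNIV UNIV] by (simp add: UNIV_Times_UNIV)

text \<open>In variables \<open>((y, eta), (x, zeta))\<close> the generator is the sum over
  \<open>i\<close>, \<open>j\<close> of \<open>J y $ i $ j\<close> times (zeta_i d/d eta_j - y_j d/d
  x_i). At 0 the factor zeta_i becomes d/d x_i and y_j becomes d/d eta_j, so both halves give the
  same second derivative one order lower and cancel.\<close>

lemma T2_transvection:
  fixes J :: "complex ^ 'n \<Rightarrow> complex ^ 'n ^ 'n::finite"
  assumes J: "\<And>i j. holo (\<lambda>y. J y $ i $ j) 0" and b: "holo b 0"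
  shows "T2 k (\<lambda>X. b ((fst (fst X), snd (fst X) + transpose (J (fst (fst X))) *v snd (snd X)), snd X)) 0 =
    T2 k (\<lambda>X. b (fst X, (fst (snd X) + J (fst (fst X)) *v fst (fst X), snd (snd X)))) 0"
proof -
  define C where "C = (UNIV :: ('n \<times> 'n) set) \<times> (UNIV :: bool set)"
  \<comment> \<open>The boolean separates the halves of the generator: \<open>True\<close> shifts
    eta by entries of \<open>J\<close> times zeta, \<open>False\<close> shifts x by minus entries of
    \<open>J\<close> times y.\<close>
  define a where "a = (\<lambda>((i, j), t) X. J (fst (fst X)) $ i $ j * (if t then ccoord2 (Inr i) X else - xcoord2 (Inl j) X))"
  define e :: "('n \<times> 'n) \<times> bool \<Rightarrow> 'n cotangent \<times> 'n cotangent"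
    where "e = (\<lambda>((i, j), t). if t then cdir2 (Inl j) else xdir2 (Inr i))"
  \<comment> \<open>Invariance is applied to the right-hand integrand: the flow at time 1 subtracts
    \<open>J y *v y\<close> from x, which undoes the shift built into \<open>b'\<close> and leaves
    the left-hand integrand.\<close>
  define b' where "b' X = b (fst X, (fst (snd X) + J (fst (fst X)) *v fst (fst X), snd (snd X)))" for X
  have hJ: "holo (\<lambda>X :: 'n cotangent \<times> 'n cotangent. J (fst (fst X)) $ i $ j) 0" for i j
    by (rule holo_compose[of "\<lambda>y. J y $ i $ j" "\<lambda>X. fst (fst X)"]) (auto intro!: holo_intros J)
  have hb': "holo b' 0"
    unfolding b'_def
    by (rule holo_compose[of b]) (use b in \<open>auto intro!: holo_intros holo_matrix_vector_mult hJ simp flip: zero_prod_def\<close>)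
  have ha: "holo (a c) 0" for c
  proof -
    obtain i j t where c: "c = ((i, j), t)" by (metis prod.collapse)
    show ?thesis
      by (cases t) (auto simp: a_def c intro!: holo_mult hJ holo_ccoord2 holo_xcoord2 holo_uminus)
  qed
  have "T2 k (\<lambda>x. b' (x + (\<Sum>c\<in>C. cscale (a c x) (e c)))) 0 = T2 k b' 0"
  proof (rule ecoeff_flow_invariant)
    show "finite C" by (simp add: C_def)
    fix c
    show "holo (a c) 0" by (rule ha)
    show "a c 0 = 0"
      by (auto simp: a_def split_beta xcoord2_def ccoord2_def)
  next
    show "\<forall>\<^sub>F x in nhds 0. \<forall>c\<in>C. \<forall>c'\<in>C. dir_deriv (e c) (a c') x = 0"
      by (rule always_eventually) (auto simp: e_def a_def dir_deriv_def xdir2_def cdir2_def xdir_def cdir_def xcoord2_def ccoord2_def cong: if_cong)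
  next
    fix b :: "'n cotangent \<times> 'n cotangent \<Rightarrow> complex" assume b: "holo b 0"
    have *: "T2 k (\<lambda>x. a ((i, j), True) x * dir_deriv (e ((i, j), True)) b x) 0 +
        T2 k (\<lambda>x. a ((i, j), False) x * dir_deriv (e ((i, j), False)) b x) 0 = 0" for i j
    proof -
      let ?J = "\<lambda>X :: 'n cotangent \<times> 'n cotangent. J (fst (fst X)) $ i $ j"
      have h: "holo (\<lambda>x. ?J x * dir_deriv w b x) 0" for w by (intro holo_mult hJ holo_dir_deriv b)
      have J0: "dir_deriv (cdir2 (Inl j)) ?J x = 0" "dir_deriv (xdir2 (Inr i)) ?J x = 0" for x
        by (simp_all add: dir_deriv_def cdir2_def xdir2_def cdir_def xdir_def)
      have 1: "(\<lambda>x. a ((i, j), True) x * dir_deriv (e ((i, j), True)) b x) =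
          (\<lambda>x. ccoord2 (Inr i) x * (?J x * dir_deriv (cdir2 (Inl j)) b x))"
        by (auto simp: a_def e_def fun_eq_iff)
      have 2: "(\<lambda>x. a ((i, j), False) x * dir_deriv (e ((i, j), False)) b x) =
          (\<lambda>x. (- 1) * (xcoord2 (Inl j) x * (?J x * dir_deriv (xdir2 (Inr i)) b x)))"
        by (auto simp: a_def e_def fun_eq_iff)
      have "T2 k (\<lambda>x. ccoord2 (Inr i) x * (?J x * dir_deriv (cdir2 (Inl j)) b x)) 0 =
        T2 k (\<lambda>x. xcoord2 (Inl j) x * (?J x * dir_deriv (xdir2 (Inr i)) b x)) 0"
      \<comment> \<open>At order 0 both sides vanish, a coordinate being evaluated at 0. Otherwise
        one order is traded on either side and the mixed derivatives agree.\<close>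
      proof (cases k)
        case (Suc k')
        have "\<forall>\<^sub>F x in nhds 0. dir_deriv (xdir2 (Inr i)) (\<lambda>x. ?J x * dir_deriv (cdir2 (Inl j)) b x) x =
           dir_deriv (cdir2 (Inl j)) (\<lambda>x. ?J x * dir_deriv (xdir2 (Inr i)) b x) x"
          using holo_eventually[OF hJ[of i j]] holo_eventually[OF b]
          by eventually_elim
            (simp add: dir_deriv_mult holo_cdiff holo_dir_deriv J0 dir_deriv_commute[of b])
        then show ?thesis
          unfolding Suc by (simp only: T2_xcoord2 h ecoeff_cong)
      qed (simp only: T2_xcoord2 h)
      then show ?thesis
        unfolding 1 2 by (subst ecoeff_cmult) (auto intro: holo_mult h holo_xcoord2)
    qed
    have "T2 k (\<lambda>x. \<Sum>c\<in>C. a c x * dir_deriv (e c) b x) 0 = (\<Sum>c\<in>C. T2 k (\<lambda>x. a c x * dir_deriv (e c) b x) 0)"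
      by (intro ecoeff_sum holo_mult ha holo_dir_deriv b)
    also have "\<dots> = 0"
      unfolding C_def sum_Times_bool using * by (intro sum.neutral) auto
    finally show "T2 k (\<lambda>x. \<Sum>c\<in>C. a c x * dir_deriv (e c) b x) 0 = 0" .
  qed (rule hb')
  moreover have "b' (X + (\<Sum>c\<in>C. cscale (a c X) (e c))) =
      b ((fst (fst X), snd (fst X) + transpose (J (fst (fst X))) *v snd (snd X)), snd X)" for X
  proof -
    obtain y \<eta> x \<zeta> where X: "X = ((y, \<eta>), (x, \<zeta>))" by (metis prod.collapse)
    have "(\<Sum>c\<in>C. cscale (a c X) (e c)) = (\<Sum>i\<in>UNIV. \<Sum>j\<in>UNIV.
       ((0, axis j (J y $ i $ j * \<zeta> $ i)), (axis i (- (J y $ i $ j * y $ j)), 0)))"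
      unfolding C_def sum_Times_bool sum_UNIV_pair
      by (simp add: a_def e_def X xdir2_def cdir2_def xdir_def cdir_def xcoord2_def ccoord2_def cscale_axis)
    also have "\<dots> = ((0, transpose (J y) *v \<zeta>), (- (J y *v y), 0))"
    proof -
      have 1: "(\<Sum>i\<in>UNIV. \<Sum>j\<in>UNIV. axis j (J y $ i $ j * \<zeta> $ i)) = transpose (J y) *v \<zeta>"
        by (simp add: vec_eq_iff axis_def matrix_vector_mult_def transpose_def)
      have 2: "(\<Sum>i\<in>UNIV. \<Sum>j\<in>UNIV. axis i (- (J y $ i $ j * y $ j))) = - (J y *v y)"
        unfolding vec_eq_iff sum_component
      proof
        fix k
        show "(\<Sum>i\<in>UNIV. \<Sum>j\<in>UNIV. axis i (- (J y $ i $ j * y $ j)) $ k) = (- (J y *v y)) $ k"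
          by (subst sum.swap) (simp add: axis_def matrix_vector_mult_def sum_negf[symmetric])
      qed
      show ?thesis
        by (simp add: prod_eq_iff fst_sum snd_sum 1 2)
    qed
    finally show ?thesis by (simp add: b'_def X)
  qed
  ultimately have "T2 k (\<lambda>X. b ((fst (fst X), snd (fst X) + transpose (J (fst (fst X))) *v snd (snd X)), snd X)) 0 =
      T2 k b' 0"
    by (simp only:)
  then show ?thesis unfolding b'_def[abs_def] .
qed

section \<open>Associativity and coordinate invariance\<close>

text \<open>The part of order \<open>k\<close> of the product of two functions free of
  \<open>t\<close>: the sum over multi-indices alpha of length \<open>k\<close> of the
  alpha-derivative of \<open>q\<close> in \<zeta> times the alpha-derivative of \<open>p\<close> in
  z, divided by alpha factorial.\<close>

definition star :: "nat \<Rightarrow> (complex ^ 'n \<Rightarrow> complex ^ 'n \<Rightarrow> complex) \<Rightarrow> (complex ^ 'n \<Rightarrow> complex ^ 'n \<Rightarrow> complex) \<Rightarrow>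
    complex ^ 'n \<Rightarrow> complex ^ 'n::finite \<Rightarrow> complex" where
  "star k q p z \<zeta> = T1 k (\<lambda>X. q z (\<zeta> + snd X) * p (z + fst X) \<zeta>) 0"

lemma holo_apply2:
  assumes "holo (case_prod q) (z, \<zeta>)" "holo f x" "holo g x" "f x = z" "g x = \<zeta>"
  shows "holo (\<lambda>x. q (f x) (g x)) x"
  using holo_compose[of "case_prod q" "\<lambda>x. (f x, g x)" x] assms by (simp add: holo_Pair)

text \<open>Adjoining the parameter as inert coordinates turns the family into one function, to
  which \<open>holo_ecoeff\<close> applies.\<close>

lemma holo_ecoeff_param:
  assumes "holo G (x, y)"
  shows "holo (\<lambda>y. ecoeff I u v k (\<lambda>x. G (x, y)) x) y"
proof -
  have "holo (\<lambda>y. ecoeff I (\<lambda>i. (u i, 0)) (\<lambda>i. (v i, 0)) k G (x, y)) y"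
    by (rule holo_compose[of _ "\<lambda>y. (x, y)"]) (intro holo_ecoeff assms holo_intros)+
  then show ?thesis by (simp add: ecoeff_fst_slice)
qed

lemma dir_deriv_ecoeff_param:
  assumes "holo G (x, y)"
  shows "dir_deriv w (\<lambda>y. ecoeff I u v k (\<lambda>x. G (x, y)) x) y = ecoeff I u v k (\<lambda>x. dir_deriv (0, w) G (x, y)) x"
proof -
  let ?T = "ecoeff I (\<lambda>i. (u i, 0)) (\<lambda>i. (v i, 0)) k"
  have "dir_deriv w (\<lambda>y. ecoeff I u v k (\<lambda>x. G (x, y)) x) y = dir_deriv w (\<lambda>y. ?T G (x, y)) y"
    by (simp add: ecoeff_fst_slice)
  also have "\<dots> = dir_deriv (0, w) (?T G) (x, y)" by (rule dir_deriv_snd_slice)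
  also have "\<dots> = ?T (dir_deriv (0, w) G) (x, y)" by (rule dir_deriv_ecoeff[OF assms])
  finally show ?thesis by (simp add: ecoeff_fst_slice)
qed

text \<open>On the left \<open>p\<close> is evaluated at \<open>z\<close> shifted by both position
  increments; on the right \<open>r\<close> is evaluated at \<open>\<zeta>\<close> shifted by both
  covector increments. The transvection with the identity matrix carries one integrand to the
  other.\<close>

lemma star_assoc:
  assumes r: "holo (case_prod r) (z, \<zeta>)" and q: "holo (case_prod q) (z, \<zeta>)" and p: "holo (case_prod p) (z, \<zeta>)"
  shows "(\<Sum>k\<le>N. star k r (star (N - k) q p) z \<zeta>) = (\<Sum>k\<le>N. star k (star (N - k) r q) p z \<zeta>)"
proof -
  note hr = holo_apply2[OF r] and hq = holo_apply2[OF q] and hp = holo_apply2[OF p]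
  let ?g = "\<lambda>P. q (z + fst (fst P)) (\<zeta> + snd (snd P)) * p (z + fst (fst P) + fst (snd P)) \<zeta>"
  let ?c = "\<lambda>X. r z (\<zeta> + snd X)"
  have "(\<Sum>k\<le>N. star k r (star (N - k) q p) z \<zeta>) =
      (\<Sum>k\<le>N. T1 k (\<lambda>X. ?c X * T1 (N - k) (\<lambda>Y. ?g (X, Y)) 0) 0)"
    by (simp add: star_def)
  also have "\<dots> = T2 N (\<lambda>P. ?c (fst P) * ?g P) (0, 0)"
    by (rule T2_nested1[symmetric]) (intro holo_intros hr hq hp; simp)+
  also have "\<dots> = T2 N (\<lambda>X. (\<lambda>P. r z (\<zeta> + snd (fst P)) * (q (z + fst (fst P)) (\<zeta> + snd (snd P)) * p (z + fst (snd P)) \<zeta>))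
      (fst X, (fst (snd X) + mat 1 *v fst (fst X), snd (snd X)))) 0"
    by (simp add: zero_prod_def algebra_simps)
  also have "\<dots> = T2 N (\<lambda>X. (\<lambda>P. r z (\<zeta> + snd (fst P)) * (q (z + fst (fst P)) (\<zeta> + snd (snd P)) * p (z + fst (snd P)) \<zeta>))
     ((fst (fst X), snd (fst X) + transpose (mat 1) *v snd (snd X)), snd X)) 0"
    by (rule T2_transvection[symmetric, of "\<lambda>_. mat 1"]) (intro holo_intros hr hq hp; simp)+
  also have "\<dots> = T2 N (\<lambda>P. p (z + fst (snd P)) \<zeta> * (r z (\<zeta> + snd (snd P) + snd (fst P)) * q (z + fst (fst P)) (\<zeta> + snd (snd P)))) (0, 0)"
    by (simp add: zero_prod_def algebra_simps)
  \<comment> \<open>The pairs exchange roles: the outer composition used the first pair on the left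
    and uses the second one on the right.\<close>
  also have "\<dots> = (\<Sum>k\<le>N. T1 k (\<lambda>Y. p (z + fst Y) \<zeta> *
      T1 (N - k) (\<lambda>X. (\<lambda>P. r z (\<zeta> + snd (snd P) + snd (fst P)) * q (z + fst (fst P)) (\<zeta> + snd (snd P))) (X, Y)) 0) 0)"
    by (rule T2_nested2[where c="\<lambda>Y. p (z + fst Y) \<zeta>"]) (intro holo_intros hr hq hp; simp)+
  also have "\<dots> = (\<Sum>k\<le>N. star k (star (N - k) r q) p z \<zeta>)"
    by (simp add: star_def mult.commute)
  finally show ?thesis .
qed

text \<open>The contribution of order \<open>k\<close> in \<open>t\<close> of a single coefficient.
  At order 0 it is plain substitution of \<open>cotangent_map\<close>.\<close>

definition pull_coeff :: "(complex ^ 'n \<Rightarrow> complex ^ 'n) \<Rightarrow> (complex ^ 'n \<Rightarrow> complex ^ 'n \<Rightarrow> complex ^ 'n ^ 'n) \<Rightarrow> nat \<Rightarrow>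
    (complex ^ 'n \<Rightarrow> complex ^ 'n \<Rightarrow> complex) \<Rightarrow> complex ^ 'n \<Rightarrow> complex ^ 'n::finite \<Rightarrow> complex" where
  "pull_coeff \<Phi> J k p w \<mu> = T1 k (\<lambda>X. p (\<Phi> w) (snd X + transpose (J (\<Phi> w + fst X) (\<Phi> w)) *v \<mu>)) 0"

text \<open>Every term of the pairing contains a covector derivative. This collapses an exponential
  whose integrand has lost its covector variable.\<close>

lemma T1_fst_only:
  fixes f :: "complex ^ 'n::finite \<Rightarrow> complex"
  assumes "k > 0"
  shows "T1 k (\<lambda>Y. f (fst Y)) Y = 0"
proof -
  let ?L = "plap UNIV xdir cdir :: ('n cotangent \<Rightarrow> complex) \<Rightarrow> _"
  have 1: "?L (\<lambda>Y. f (fst Y)) = (\<lambda>_. 0)"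
    by (simp add: plap_def xdir_def cdir_def dir_deriv_def fun_eq_iff)
  have "?L (\<lambda>_. 0) = (\<lambda>_. 0)"
    by (simp add: plap_def fun_eq_iff)
  then have "(?L ^^ j) (\<lambda>_. 0) = (\<lambda>_. 0)" for j
    by (induction j) auto
  with 1 have "(?L ^^ Suc j) (\<lambda>Y. f (fst Y)) = (\<lambda>_. 0)" for j
    unfolding funpow_Suc_right o_def by simp
  moreover obtain j where "k = Suc j" using assms gr0_implies_Suc by blast
  ultimately show ?thesis by (simp only: ecoeff_def div_0)
qed

lemma transpose_pairing:
  fixes A :: "complex ^ 'n ^ 'n"
  shows "(\<Sum>j\<in>UNIV. y $ j * (transpose A *v \<mu>) $ j) = (\<Sum>i\<in>UNIV. (A *v y) $ i * \<mu> $ i)"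
  by (simp add: matrix_vector_mult_def transpose_def sum_distrib_left sum_distrib_right mult_ac)
    (rule sum.swap)

lemma sum_Plus:
  fixes f :: "('a::finite) + ('b::finite) \<Rightarrow> 'c::comm_monoid_add"
  shows "(\<Sum>c\<in>UNIV. f c) = (\<Sum>i\<in>UNIV. f (Inl i)) + (\<Sum>i\<in>UNIV. f (Inr i))"
  unfolding UNIV_eq_Inl_Un_Inr
  by (subst sum.union_disjoint) (auto simp: sum.reindex)

text \<open>The heart of coordinate invariance, for two coefficients free of \<open>t\<close> and
  fixed total order \<open>N\<close>. Both sides become exponentials in two pairs; the integrands
  differ in the arguments of \<open>J\<close>, and the difference identity \<open>Jeq\<close> has to
  absorb this.\<close>

lemma pull_coeff_star:
  fixes \<Phi> \<Psi> :: "complex ^ 'n \<Rightarrow> complex ^ 'n::finite" and \<mu> :: "complex ^ 'n"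
  assumes \<Phi>: "holo \<Phi> w" "\<Phi> w = z" and \<Psi>: "holo \<Psi> z" "\<Psi> z = w"
    and inv: "\<forall>\<^sub>F x in nhds z. \<Phi> (\<Psi> x) = x"
    and J: "\<And>i j. holo (\<lambda>(a, b). J a b $ i $ j) (z, z)"
    and Jeq: "\<forall>\<^sub>F P in nhds (z, z). \<Psi> (fst P) - \<Psi> (snd P) = J (fst P) (snd P) *v (fst P - snd P)"
    and \<zeta>: "\<zeta> = transpose (J z z) *v \<mu>"
    and q: "holo (case_prod q) (z, \<zeta>)" and p: "holo (case_prod p) (z, \<zeta>)"
  shows "(\<Sum>l\<le>N. \<Sum>m\<le>N - l. star m (pull_coeff \<Phi> J (N - l - m) q) (pull_coeff \<Phi> J l p) w \<mu>) =
    (\<Sum>k\<le>N. pull_coeff \<Phi> J k (star (N - k) q p) w \<mu>)"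
proof -
  note hq = holo_apply2[OF q] and hp = holo_apply2[OF p]
  have hJij: "holo (\<lambda>x. J (f x) (g x) $ i $ j) x"
    if "holo f x" "holo g x" "f x = z" "g x = z" for f g i j and x :: "'b::complex_space"
    using holo_compose[of "\<lambda>(a, b). J a b $ i $ j" "\<lambda>x. (f x, g x)" x] J that by (simp add: holo_Pair)
  have hJt: "holo (\<lambda>x. transpose (J (f x) (g x)) *v h x) x"
    if "holo f x" "holo g x" "holo h x" "f x = z" "g x = z" for f g h and x :: "'b::complex_space"
    by (rule holo_matrix_vector_mult) (simp_all add: transpose_def hJij that)
  have hJv: "holo (\<lambda>x. J (f x) (g x) *v h x) x"
    if "holo f x" "holo g x" "holo h x" "f x = z" "g x = z" for f g h and x :: "'b::complex_space"
    by (rule holo_matrix_vector_mult) (simp_all add: hJij that)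
  have h\<Phi>: "holo (\<lambda>x. \<Phi> (f x)) x" if "holo f x" "f x = w" for f and x :: "'b::complex_space"
    using holo_compose[of \<Phi> f x] \<Phi> that by simp
  let ?q = "\<lambda>X. q z (snd X + transpose (J (z + fst X) z) *v \<mu>)"
  let ?p = "\<lambda>P. p (z + fst (fst P)) (snd (snd P) + transpose (J (z + fst (fst P) + fst (snd P)) (z + fst (fst P))) *v \<mu>)"
  have hpb: "holo (\<lambda>x. pull_coeff \<Phi> J l p x \<mu>) w" for l
  proof -
    have "holo (\<lambda>P. p (\<Phi> (snd P)) (snd (fst P) + transpose (J (\<Phi> (snd P) + fst (fst P)) (\<Phi> (snd P))) *v \<mu>)) (0, w)"
      by (intro holo_intros hp hJt h\<Phi>) (simp_all add: \<Phi> \<zeta>)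
    from holo_ecoeff_param[OF this] show ?thesis by (simp add: pull_coeff_def)
  qed
  have hpb': "holo (\<lambda>x. pull_coeff \<Phi> J l p (f x) \<mu>) x" if "holo f x" "f x = w" for f l and x :: "'b::complex_space"
    using holo_compose[of "\<lambda>x. pull_coeff \<Phi> J l p x \<mu>" f x] hpb that by simp
  \<comment> \<open>The transvection with \<open>J (z + y) z\<close> moves the increment of \<mu>
    out of \<open>q\<close>. The other factor is then taken at \<open>w + J (z + y) z *v y\<close>,
    which is \<open>\<Psi> (z + y)\<close>, so both factors are back in
    \<open>z\<close>-coordinates.\<close>
  have step1: "(\<Sum>m\<le>M. star m (pull_coeff \<Phi> J (M - m) q) (pull_coeff \<Phi> J l p) w \<mu>) =
      T1 M (\<lambda>X. ?q X * T1 l (\<lambda>Y. ?p (X, Y)) 0) 0" for l M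
  proof -
    let ?c = "\<lambda>Y. pull_coeff \<Phi> J l p (w + fst Y) \<mu>"
    let ?g = "\<lambda>P. q z (snd (fst P) + transpose (J (z + fst (fst P)) z) *v (\<mu> + snd (snd P)))"
    have "(\<Sum>m\<le>M. star m (pull_coeff \<Phi> J (M - m) q) (pull_coeff \<Phi> J l p) w \<mu>) =
      (\<Sum>m\<le>M. T1 m (\<lambda>Y. ?c Y * T1 (M - m) (\<lambda>X. ?g (X, Y)) 0) 0)"
      by (simp add: star_def pull_coeff_def[of \<Phi> J "M - m" q for m] \<Phi> mult.commute)
    also have "\<dots> = T2 M (\<lambda>P. ?c (snd P) * ?g P) (0, 0)"
      by (rule T2_nested2[symmetric]) (intro holo_intros hq hJt hpb'; simp add: \<zeta>)+
    also have "\<dots> = T2 M (\<lambda>X. (\<lambda>P. ?q (fst P) * ?c (snd P))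
       ((fst (fst X), snd (fst X) + transpose (J (z + fst (fst X)) z) *v snd (snd X)), snd X)) 0"
      by (simp add: zero_prod_def matrix_vector_right_distrib algebra_simps)
    also have "\<dots> = T2 M (\<lambda>X. (\<lambda>P. ?q (fst P) * ?c (snd P))
       (fst X, (fst (snd X) + J (z + fst (fst X)) z *v fst (fst X), snd (snd X)))) 0"
      by (rule T2_transvection[of "\<lambda>y. J (z + y) z"]) (intro holo_intros hq hJt hJij hpb'; simp add: \<zeta>)+
    also have "\<dots> = T2 M (\<lambda>P. ?q (fst P) * pull_coeff \<Phi> J l p (w + (fst (snd P) + J (z + fst (fst P)) z *v fst (fst P))) \<mu>) (0, 0)"
      by (simp add: zero_prod_def)
    also have "\<dots> = (\<Sum>k\<le>M. T1 k (\<lambda>X. T1 (M - k) (\<lambda>Y. ?q X * pull_coeff \<Phi> J l p (w + (fst Y + J (z + fst X) z *v fst X)) \<mu>) 0) 0)"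
      by (subst T2_split1) ((intro holo_intros hq hJt hJv hpb'; simp add: \<zeta>), simp)
    \<comment> \<open>The inner integrand now depends on \<open>Y\<close> through its position part
      only: its positive orders vanish, and the inner exponential becomes evaluation at 0.\<close>
    also have "\<dots> = (\<Sum>k\<le>M. if k = M then T1 M (\<lambda>X. ?q X * pull_coeff \<Phi> J l p (w + (J (z + fst X) z *v fst X)) \<mu>) 0 else 0)"
    proof (intro sum.cong refl)
      fix k assume "k \<in> {..M}"
      have 0: "T1 (M - k) (\<lambda>Y. ?q X * pull_coeff \<Phi> J l p (w + (fst Y + J (z + fst X) z *v fst X)) \<mu>) 0 = 0"
        if "k < M" for X
        using that by (intro T1_fst_only) simp
      show "T1 k (\<lambda>X. T1 (M - k) (\<lambda>Y. ?q X * pull_coeff \<Phi> J l p (w + (fst Y + J (z + fst X) z *v fst X)) \<mu>) 0) 0 =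
          (if k = M then T1 M (\<lambda>X. ?q X * pull_coeff \<Phi> J l p (w + (J (z + fst X) z *v fst X)) \<mu>) 0 else 0)"
        using \<open>k \<in> {..M}\<close> 0 by (cases "k = M") (simp_all add: ecoeff_0)
    qed
    also have "\<dots> = T1 M (\<lambda>X. ?q X * pull_coeff \<Phi> J l p (w + (J (z + fst X) z *v fst X)) \<mu>) 0"
      by simp
    also have "\<dots> = T1 M (\<lambda>X. ?q X * T1 l (\<lambda>Y. ?p (X, Y)) 0) 0"
    proof (rule ecoeff_cong)
      have "holo (\<lambda>X :: 'n cotangent. (z + fst X, z)) 0" by (intro holo_intros)
      from holo_eventually_compose[OF this, of "\<lambda>P. \<Psi> (fst P) - \<Psi> (snd P) = J (fst P) (snd P) *v (fst P - snd P)"]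
      have 1: "\<forall>\<^sub>F X :: 'n cotangent in nhds 0. \<Psi> (z + fst X) - \<Psi> z = J (z + fst X) z *v (fst X)"
        using Jeq by simp
      have "holo (\<lambda>X :: 'n cotangent. z + fst X) 0" by (intro holo_intros)
      from holo_eventually_compose[OF this, of "\<lambda>x. \<Phi> (\<Psi> x) = x"]
      have 2: "\<forall>\<^sub>F X :: 'n cotangent in nhds 0. \<Phi> (\<Psi> (z + fst X)) = z + fst X"
        using inv by simp
      from 1 2 show "\<forall>\<^sub>F X in nhds 0. ?q X * pull_coeff \<Phi> J l p (w + (J (z + fst X) z *v fst X)) \<mu> =
          ?q X * T1 l (\<lambda>Y. ?p (X, Y)) 0"
      proof eventually_elim
        fix X :: "'n cotangent"
        assume 1: "\<Psi> (z + fst X) - \<Psi> z = J (z + fst X) z *v (fst X)" and 2: "\<Phi> (\<Psi> (z + fst X)) = z + fst X"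
        have "w + J (z + fst X) z *v fst X = \<Psi> (z + fst X)"
          unfolding 1[symmetric] \<Psi>(2) by simp
        then show "?q X * pull_coeff \<Phi> J l p (w + (J (z + fst X) z *v fst X)) \<mu> = ?q X * T1 l (\<lambda>Y. ?p (X, Y)) 0"
          by (simp add: pull_coeff_def 2)
      qed
    qed
    finally show ?thesis .
  qed
  have "(\<Sum>l\<le>N. \<Sum>m\<le>N - l. star m (pull_coeff \<Phi> J (N - l - m) q) (pull_coeff \<Phi> J l p) w \<mu>) =
      (\<Sum>l\<le>N. T1 (N - l) (\<lambda>X. ?q X * T1 l (\<lambda>Y. ?p (X, Y)) 0) 0)"
    unfolding step1 ..
  also have "\<dots> = (\<Sum>k\<le>N. T1 k (\<lambda>X. ?q X * T1 (N - k) (\<lambda>Y. ?p (X, Y)) 0) 0)"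
    by (rule sum.reindex_bij_witness[of _ "\<lambda>k. N - k" "\<lambda>k. N - k"]) auto
  also have "\<dots> = T2 N (\<lambda>P. ?q (fst P) * ?p P) (0, 0)"
    by (rule T2_nested1[symmetric]) (intro holo_intros hq hp hJt; simp add: \<zeta>)+
  also have "\<dots> = T2 N (\<lambda>X. (\<lambda>P. ?q (fst P) * p (z + fst (fst P)) (snd (snd P) + transpose (J (z + fst (snd P)) (z + fst (fst P))) *v \<mu>))
      (fst X, (fst (snd X) + mat 1 *v fst (fst X), snd (snd X)))) 0"
    by (simp add: zero_prod_def algebra_simps)
  \<comment> \<open>The identity transvection known from associativity: \<open>J\<close> is taken at
    \<open>z + x\<close> instead of \<open>z + y + x\<close>, and \<open>q\<close> receives both
    covector increments.\<close>
  also have "\<dots> = T2 N (\<lambda>X. (\<lambda>P. ?q (fst P) * p (z + fst (fst P)) (snd (snd P) + transpose (J (z + fst (snd P)) (z + fst (fst P))) *v \<mu>))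
      ((fst (fst X), snd (fst X) + transpose (mat 1) *v snd (snd X)), snd X)) 0"
    by (rule T2_transvection[symmetric, of "\<lambda>_. mat 1"]) (intro holo_intros hq hp hJt; simp add: \<zeta>)+
  also have "\<dots> = T2 N (\<lambda>X. q z (snd (snd X) + snd (fst X) + transpose (J (z + fst (fst X)) z) *v \<mu>) *
      p (z + fst (fst X)) (snd (snd X) + transpose (J (z + fst (snd X)) (z + fst (fst X))) *v \<mu>)) 0"
    by (simp add: add_ac)
  also have "\<dots> = T2 N (\<lambda>X. q z (snd (snd X) + snd (fst X) + transpose (J (z + fst (snd X)) z) *v \<mu>) *
      p (z + fst (fst X)) (snd (snd X) + transpose (J (z + fst (snd X)) z) *v \<mu>)) 0"
  proof -
    \<comment> \<open>\<open>h\<close> and \<open>k\<close> are the covector differences between the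
      current integrand and the one with \<open>J (z + x) z\<close> throughout. They depend on
      positions only and vanish at 0, where every \<open>J\<close> has both arguments
      \<open>z\<close>.\<close>
    define h where "h X = transpose (J (z + fst (fst X)) z) *v \<mu> - transpose (J (z + fst (snd X)) (z + fst (fst X))) *v \<mu>"
      for X :: "'n cotangent \<times> 'n cotangent"
    define k where "k X = transpose (J (z + fst (snd X)) (z + fst (fst X))) *v \<mu> - transpose (J (z + fst (snd X)) z) *v \<mu>"
      for X :: "'n cotangent \<times> 'n cotangent"
    define a where "a = case_sum (\<lambda>j X. h X $ j) (\<lambda>j X. k X $ j)"
    have hh: "holo h 0" and hk: "holo k 0"
      unfolding h_def k_def by (intro holo_intros hJt; simp)+
    let ?b = "\<lambda>X. q z (snd (snd X) + snd (fst X) + transpose (J (z + fst (snd X)) z) *v \<mu>) *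
      p (z + fst (fst X)) (snd (snd X) + transpose (J (z + fst (snd X)) z) *v \<mu>)"
    have "T2 N (\<lambda>X. ?b (X + (\<Sum>c\<in>UNIV. cscale (a c X) (cdir2 c)))) 0 = T2 N ?b 0"
    proof (rule T2_shift_invariant)
      fix c c'
      show "holo (a c) 0" using hh hk by (cases c) (auto simp: a_def intro: holo_vec_nth)
      show "a c 0 = 0" by (cases c) (auto simp: a_def h_def k_def)
      show "dir_deriv (cdir2 c) (a c') x = 0" for x
        by (cases c; cases c') (auto simp: a_def h_def k_def dir_deriv_def cdir2_def cdir_def)
    next
      let ?E = "\<lambda>P. \<Psi> (fst P) - \<Psi> (snd P) = J (fst P) (snd P) *v (fst P - snd P)"
      have "holo (\<lambda>X :: 'n cotangent \<times> 'n cotangent. (z + fst (fst X), z)) 0" by (intro holo_intros)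
      from holo_eventually_compose[OF this, of ?E]
      have 1: "\<forall>\<^sub>F X :: 'n cotangent \<times> 'n cotangent in nhds 0. ?E (z + fst (fst X), z)" using Jeq by simp
      have "holo (\<lambda>X :: 'n cotangent \<times> 'n cotangent. (z + fst (snd X), z)) 0" by (intro holo_intros)
      from holo_eventually_compose[OF this, of ?E]
      have 2: "\<forall>\<^sub>F X :: 'n cotangent \<times> 'n cotangent in nhds 0. ?E (z + fst (snd X), z)" using Jeq by simp
      have "holo (\<lambda>X :: 'n cotangent \<times> 'n cotangent. (z + fst (snd X), z + fst (fst X))) 0" by (intro holo_intros)
      from holo_eventually_compose[OF this, of ?E]
      have 3: "\<forall>\<^sub>F X :: 'n cotangent \<times> 'n cotangent in nhds 0. ?E (z + fst (snd X), z + fst (fst X))" using Jeq by simp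
      from 1 2 3 show "\<forall>\<^sub>F X in nhds 0. (\<Sum>c\<in>UNIV. xcoord2 c X * a c X) = 0"
      proof eventually_elim
        fix X :: "'n cotangent \<times> 'n cotangent"
        let ?y = "fst (fst X)" and ?x = "fst (snd X)"
        assume 1: "?E (z + fst (fst X), z)" and 2: "?E (z + fst (snd X), z)" and 3: "?E (z + fst (snd X), z + fst (fst X))"
        have "(\<Sum>c\<in>UNIV. xcoord2 c X * a c X) = (\<Sum>j\<in>UNIV. ?y $ j * h X $ j) + (\<Sum>j\<in>UNIV. ?x $ j * k X $ j)"
          by (simp add: sum_Plus a_def xcoord2_def)
        also have "\<dots> = (\<Sum>i\<in>UNIV. (J (z + ?y) z *v ?y) $ i * \<mu> $ i) - (\<Sum>i\<in>UNIV. (J (z + ?x) (z + ?y) *v ?y) $ i * \<mu> $ i)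
          + ((\<Sum>i\<in>UNIV. (J (z + ?x) (z + ?y) *v ?x) $ i * \<mu> $ i) - (\<Sum>i\<in>UNIV. (J (z + ?x) z *v ?x) $ i * \<mu> $ i))"
          by (simp only: h_def k_def vector_minus_component right_diff_distrib sum_subtractf transpose_pairing)
        also have "\<dots> = (\<Sum>i\<in>UNIV. (J (z + ?y) z *v ?y - J (z + ?x) z *v ?x + J (z + ?x) (z + ?y) *v (?x - ?y)) $ i * \<mu> $ i)"
          by (simp add: matrix_vector_mult_diff_distrib sum_subtractf[symmetric] sum.distrib[symmetric] algebra_simps)
        \<comment> \<open>Each product is a difference of values of \<open>\<Psi>\<close> at two of
          the points z, z + y, z + x; the three differences run around a triangle and
          cancel.\<close>
        also have "J (z + ?y) z *v ?y - J (z + ?x) z *v ?x + J (z + ?x) (z + ?y) *v (?x - ?y) =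
            (\<Psi> (z + ?y) - \<Psi> z) - (\<Psi> (z + ?x) - \<Psi> z) + (\<Psi> (z + ?x) - \<Psi> (z + ?y))"
          using 1 2 3 by simp
        finally show "(\<Sum>c\<in>UNIV. xcoord2 c X * a c X) = 0" by simp
      qed
    next
      show "holo ?b 0"
        by (intro holo_intros hq hp hJt; simp add: \<zeta>)
    qed
    moreover have "X + (\<Sum>c\<in>UNIV. cscale (a c X) (cdir2 c)) = ((fst (fst X), snd (fst X) + h X), (fst (snd X), snd (snd X) + k X))" for X
    proof -
      have "(\<Sum>c\<in>UNIV. cscale (a c X) (cdir2 c)) = ((0, h X), (0, k X))"
        by (simp add: sum_Plus a_def cdir2_def cdir_def prod_eq_iff fst_sum snd_sum flip: vec_eq_sum_cscale_axis)
      then show ?thesis by (simp add: prod_eq_iff)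
    qed
    ultimately show ?thesis
      by (simp add: h_def k_def algebra_simps)
  qed
  also have "\<dots> = (\<Sum>k\<le>N. T1 k (\<lambda>Y. T1 (N - k) (\<lambda>X. q z (snd Y + snd X + transpose (J (z + fst Y) z) *v \<mu>) *
      p (z + fst X) (snd Y + transpose (J (z + fst Y) z) *v \<mu>)) 0) 0)"
    unfolding zero_prod_def
    by (subst T2_split2) ((intro holo_intros hq hp hJt; simp add: \<zeta>), simp)
  also have "\<dots> = (\<Sum>k\<le>N. pull_coeff \<Phi> J k (star (N - k) q p) w \<mu>)"
    by (simp add: pull_coeff_def star_def \<Phi> add_ac)
  finally show ?thesis .
qed

text \<open>Once the orders \<open>i\<close>, \<open>j\<close>, \<open>l\<close> of the three
  coefficients are fixed, the remaining order is shared by two exponentials, and on this fibre the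
  assumption applies. The rest is reindexing on either side.\<close>

lemma sum_nested_assoc:
  fixes f g :: "nat \<Rightarrow> nat \<Rightarrow> nat \<Rightarrow> nat \<Rightarrow> nat \<Rightarrow> 'a::comm_monoid_add"
  assumes "\<And>i j l N. (\<Sum>k\<le>N. f k (N - k) i j l) = (\<Sum>k\<le>N. g k (N - k) i j l)"
  shows "(\<Sum>a\<le>\<nu>. \<Sum>i\<le>\<nu> - a. \<Sum>b\<le>\<nu> - a - i. \<Sum>j\<le>\<nu> - a - i - b. f a b i j (\<nu> - a - i - b - j)) =
    (\<Sum>b\<le>\<nu>. \<Sum>m\<le>\<nu> - b. \<Sum>a\<le>m. \<Sum>i\<le>m - a. g b a i (m - a - i) (\<nu> - b - m))"
proof -
  have "(\<Sum>a\<le>\<nu>. \<Sum>i\<le>\<nu> - a. \<Sum>b\<le>\<nu> - a - i. \<Sum>j\<le>\<nu> - a - i - b. f a b i j (\<nu> - a - i - b - j)) =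
    (\<Sum>(i, j, l)\<in>{(i, j, l). i + j + l \<le> \<nu>}. \<Sum>k\<le>\<nu> - i - j - l. f k (\<nu> - i - j - l - k) i j l)"
  proof -
    have fin: "finite {(i, j, l). i + j + l \<le> \<nu>}"
      by (rule finite_subset[of _ "{..\<nu>} \<times> {..\<nu>} \<times> {..\<nu>}"]) auto
    show ?thesis
      by (simp add: sum.Sigma fin split_beta)
         (rule sum.reindex_bij_witness[where
          i = "\<lambda>((i, j, l), k). (k, i, \<nu> - i - j - l - k, j)" and
          j = "\<lambda>(a, i, b, j). ((i, j, \<nu> - a - i - b - j), a)"]; auto)
  qed
  also have "\<dots> = (\<Sum>(i, j, l)\<in>{(i, j, l). i + j + l \<le> \<nu>}. \<Sum>k\<le>\<nu> - i - j - l. g k (\<nu> - i - j - l - k) i j l)"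
    by (simp only: assms)
  also have "\<dots> = (\<Sum>b\<le>\<nu>. \<Sum>m\<le>\<nu> - b. \<Sum>a\<le>m. \<Sum>i\<le>m - a. g b a i (m - a - i) (\<nu> - b - m))"
  proof -
    have fin: "finite {(i, j, l). i + j + l \<le> \<nu>}"
      by (rule finite_subset[of _ "{..\<nu>} \<times> {..\<nu>} \<times> {..\<nu>}"]) auto
    show ?thesis
      by (simp add: sum.Sigma fin split_beta)
         (rule sum.reindex_bij_witness[where
          j = "\<lambda>((i, j, l), k). (k, \<nu> - k - l, \<nu> - i - j - l - k, i)" and
          i = "\<lambda>(b, m, a, i). ((i, m - a - i, \<nu> - b - m), b)"]; auto)
  qed
  finally show ?thesis .
qed

text \<open>Grouping by the orders \<open>i\<close> and \<open>p\<close> of the two coefficients: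
  the remaining order is distributed over three exponentials on the left and two on the right, as in
  \<open>pull_coeff_star\<close>.\<close>

lemma sum_nested_pullback:
  fixes f :: "nat \<Rightarrow> nat \<Rightarrow> nat \<Rightarrow> nat \<Rightarrow> nat \<Rightarrow> 'a::comm_monoid_add" and g :: "nat \<Rightarrow> nat \<Rightarrow> nat \<Rightarrow> nat \<Rightarrow> 'a"
  assumes "\<And>i p N. (\<Sum>l\<le>N. \<Sum>m\<le>N - l. f m (N - l - m) l i p) = (\<Sum>k\<le>N. g k (N - k) i p)"
  shows "(\<Sum>m\<le>\<nu>. \<Sum>j\<le>\<nu> - m. \<Sum>k\<le>j. \<Sum>l\<le>\<nu> - m - j. f m k l (j - k) (\<nu> - m - j - l)) =
    (\<Sum>k\<le>\<nu>. \<Sum>l\<le>\<nu> - k. \<Sum>i\<le>\<nu> - k - l. g k l i (\<nu> - k - l - i))"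
proof -
  have fin: "finite {(i, p). i + p \<le> \<nu>}"
    by (rule finite_subset[of _ "{..\<nu>} \<times> {..\<nu>}"]) auto
  have "(\<Sum>m\<le>\<nu>. \<Sum>j\<le>\<nu> - m. \<Sum>k\<le>j. \<Sum>l\<le>\<nu> - m - j. f m k l (j - k) (\<nu> - m - j - l)) =
    (\<Sum>(i, p)\<in>{(i, p). i + p \<le> \<nu>}. \<Sum>l\<le>\<nu> - i - p. \<Sum>m\<le>\<nu> - i - p - l. f m (\<nu> - i - p - l - m) l i p)"
      by (simp add: sum.Sigma fin split_beta)
         (rule sum.reindex_bij_witness[where
          i = "\<lambda>((i, p), l, m). (m, \<nu> - p - l - m, \<nu> - i - p - l - m, l)" and
          j = "\<lambda>(m, j, k, l). ((j - k, \<nu> - m - j - l), l, m)"]; auto)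
  also have "\<dots> = (\<Sum>(i, p)\<in>{(i, p). i + p \<le> \<nu>}. \<Sum>k\<le>\<nu> - i - p. g k (\<nu> - i - p - k) i p)"
    by (simp only: assms)
  also have "\<dots> = (\<Sum>k\<le>\<nu>. \<Sum>l\<le>\<nu> - k. \<Sum>i\<le>\<nu> - k - l. g k l i (\<nu> - k - l - i))"
      by (simp add: sum.Sigma fin split_beta)
         (rule sum.reindex_bij_witness[where
          j = "\<lambda>((i, p), k). (k, \<nu> - i - p - k, i)" and
          i = "\<lambda>(k, l, i). ((i, \<nu> - k - l - i), k)"]; auto)
  finally show ?thesis .
qed

section \<open>From single coefficients to formal symbols: bilinearity and locality of the
  product\<close>

lemma holo_star:
  assumes q: "holo (case_prod q) (z, \<zeta>)" and p: "holo (case_prod p) (z, \<zeta>)"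
  shows "holo (case_prod (star k q p)) (z, \<zeta>)"
proof -
  note hq = holo_apply2[OF q] and hp = holo_apply2[OF p]
  have "holo (\<lambda>P. q (fst (snd P)) (snd (snd P) + snd (fst P)) * p (fst (snd P) + fst (fst P)) (snd (snd P))) (0, (z, \<zeta>))"
    by (intro holo_intros hq hp; simp)
  from holo_ecoeff_param[OF this, of UNIV xdir cdir k] show ?thesis
    by (simp add: star_def case_prod_unfold)
qed

lemma star_integrand:
  fixes q p :: "complex ^ 'n::finite \<Rightarrow> complex ^ 'n \<Rightarrow> complex"
  assumes q: "holo (case_prod q) (z, \<zeta>)" and p: "holo (case_prod p) (z, \<zeta>)"
  shows "holo (\<lambda>X. q z (\<zeta> + snd X) * p (z + fst X) \<zeta>) 0"
  by (intro holo_intros holo_apply2[OF q] holo_apply2[OF p]; simp)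

lemma star_sum_right:
  assumes "holo (case_prod q) (z, \<zeta>)" "\<And>j. j \<in> J \<Longrightarrow> holo (case_prod (p j)) (z, \<zeta>)"
  shows "star k q (\<lambda>z \<zeta>. \<Sum>j\<in>J. p j z \<zeta>) z \<zeta> = (\<Sum>j\<in>J. star k q (p j) z \<zeta>)"
  unfolding star_def sum_distrib_left
  by (rule ecoeff_sum) (intro star_integrand assms)

lemma star_sum_left:
  assumes "\<And>j. j \<in> J \<Longrightarrow> holo (case_prod (q j)) (z, \<zeta>)" "holo (case_prod p) (z, \<zeta>)"
  shows "star k (\<lambda>z \<zeta>. \<Sum>j\<in>J. q j z \<zeta>) p z \<zeta> = (\<Sum>j\<in>J. star k (q j) p z \<zeta>)"
  unfolding star_def sum_distrib_right
  by (rule ecoeff_sum) (intro star_integrand assms)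

lemma star_cong:
  assumes "\<forall>\<^sub>F P in nhds (z, \<zeta>). case_prod q P = case_prod q' P" "\<forall>\<^sub>F P in nhds (z, \<zeta>). case_prod p P = case_prod p' P"
  shows "star k q p z \<zeta> = star k q' p' z \<zeta>"
  unfolding star_def
proof (rule ecoeff_cong)
  have "holo (\<lambda>X :: 'a cotangent. (z, \<zeta> + snd X)) 0" "holo (\<lambda>X :: 'a cotangent. (z + fst X, \<zeta>)) 0"
    by (intro holo_intros)+
  from holo_eventually_compose[OF this(1), of "\<lambda>P. case_prod q P = case_prod q' P"]
    holo_eventually_compose[OF this(2), of "\<lambda>P. case_prod p P = case_prod p' P"] assms
  have "\<forall>\<^sub>F X :: 'a cotangent in nhds 0. q z (\<zeta> + snd X) = q' z (\<zeta> + snd X)"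
    "\<forall>\<^sub>F X :: 'a cotangent in nhds 0. p (z + fst X) \<zeta> = p' (z + fst X) \<zeta>" by simp_all
  then show "\<forall>\<^sub>F X in nhds 0. q z (\<zeta> + snd X) * p (z + fst X) \<zeta> = q' z (\<zeta> + snd X) * p' (z + fst X) \<zeta>"
    by eventually_elim simp
qed

text \<open>Pulling the convolution sum out of the exponential rests on additivity of derivatives,
  available where the coefficients are holomorphic.\<close>

lemma symbol_comp_eq_star:
  assumes Q: "\<And>j. j \<le> \<nu> \<Longrightarrow> holo (\<lambda>(z, \<zeta>). Q j z \<zeta> \<eta>) (z, \<zeta>)"
    and P: "\<And>j. j \<le> \<nu> \<Longrightarrow> holo (\<lambda>(z, \<zeta>). P j z \<zeta> \<eta>) (z, \<zeta>)"
  shows "(Q \<circ>\<^sub>t P) \<nu> z \<zeta> \<eta> =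
    (\<Sum>k\<le>\<nu>. \<Sum>j\<le>\<nu> - k. star k (\<lambda>z \<zeta>. Q j z \<zeta> \<eta>) (\<lambda>z \<zeta>. P (\<nu> - k - j) z \<zeta> \<eta>) z \<zeta>)"
  unfolding symbol_comp_shift exp_pairing_eq star_def zero_prod_def[symmetric] case_prod_unfold
proof (intro sum.cong refl ecoeff_sum)
  fix k j assume "k \<in> {..\<nu>}" "j \<in> {..\<nu> - k}"
  then show "holo (\<lambda>X. Q j z (\<zeta> + snd X) \<eta> * P (\<nu> - k - j) (z + fst X) \<zeta> \<eta>) 0"
    by (intro star_integrand[of "\<lambda>z \<zeta>. Q j z \<zeta> \<eta>" z \<zeta> "\<lambda>z \<zeta>. P (\<nu> - k - j) z \<zeta> \<eta>"] Q P) auto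
qed

text \<open>A composition inside another one is differentiated again, so its expansion is needed
  near the point. Only the coefficients up to order \<nu> enter, hence finitely many neighbourhoods
  are intersected.\<close>

lemma symbol_comp_eq_star_ev:
  assumes Q: "\<And>j. holo (\<lambda>(z, \<zeta>). Q j z \<zeta> \<eta>) x" and P: "\<And>j. holo (\<lambda>(z, \<zeta>). P j z \<zeta> \<eta>) x"
  shows "\<forall>\<^sub>F x in nhds x. case_prod (\<lambda>z \<zeta>. (Q \<circ>\<^sub>t P) \<nu> z \<zeta> \<eta>) x = case_prod (\<lambda>z \<zeta>.
    (\<Sum>k\<le>\<nu>. \<Sum>j\<le>\<nu> - k. star k (\<lambda>z \<zeta>. Q j z \<zeta> \<eta>) (\<lambda>z \<zeta>. P (\<nu> - k - j) z \<zeta> \<eta>) z \<zeta>)) x"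
proof -
  have "\<forall>\<^sub>F x in nhds x. \<forall>j\<in>{..\<nu>}. holo (\<lambda>(z, \<zeta>). Q j z \<zeta> \<eta>) x \<and> holo (\<lambda>(z, \<zeta>). P j z \<zeta> \<eta>) x"
    using Q P by (intro eventually_ball_finite ballI eventually_conj holo_eventually) auto
  then show ?thesis
  proof eventually_elim
    fix x assume h: "\<forall>j\<in>{..\<nu>}. holo (\<lambda>(z, \<zeta>). Q j z \<zeta> \<eta>) x \<and> holo (\<lambda>(z, \<zeta>). P j z \<zeta> \<eta>) x"
    obtain z \<zeta> where x: "x = (z, \<zeta>)" by (cases x)
    have "(Q \<circ>\<^sub>t P) \<nu> z \<zeta> \<eta> =
      (\<Sum>k\<le>\<nu>. \<Sum>j\<le>\<nu> - k. star k (\<lambda>z \<zeta>. Q j z \<zeta> \<eta>) (\<lambda>z \<zeta>. P (\<nu> - k - j) z \<zeta> \<eta>) z \<zeta>)"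
      by (rule symbol_comp_eq_star[where Q=Q and P=P and \<eta>=\<eta>]) (use h x in blast)+
    then show "case_prod (\<lambda>z \<zeta>. (Q \<circ>\<^sub>t P) \<nu> z \<zeta> \<eta>) x = case_prod (\<lambda>z \<zeta>.
      (\<Sum>k\<le>\<nu>. \<Sum>j\<le>\<nu> - k. star k (\<lambda>z \<zeta>. Q j z \<zeta> \<eta>) (\<lambda>z \<zeta>. P (\<nu> - k - j) z \<zeta> \<eta>) z \<zeta>)) x"
      by (simp add: x)
  qed
qed

lemma holo_symbol_comp:
  assumes "\<And>j. holo (\<lambda>(z, \<zeta>). Q j z \<zeta> \<eta>) (z, \<zeta>)" "\<And>j. holo (\<lambda>(z, \<zeta>). P j z \<zeta> \<eta>) (z, \<zeta>)"
  shows "holo (\<lambda>(z, \<zeta>). (Q \<circ>\<^sub>t P) \<nu> z \<zeta> \<eta>) (z, \<zeta>)"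
proof -
  have "holo (\<lambda>x. \<Sum>k\<le>\<nu>. \<Sum>j\<le>\<nu> - k. case_prod (star k (\<lambda>z \<zeta>. Q j z \<zeta> \<eta>) (\<lambda>z \<zeta>. P (\<nu> - k - j) z \<zeta> \<eta>)) x) (z, \<zeta>)"
    by (intro holo_sum holo_star assms)
  then show ?thesis
    by (rule holo_cong_ev[rotated])
       (use symbol_comp_eq_star_ev[where Q=Q and P=P and \<eta>=\<eta> and x="(z, \<zeta>)" and \<nu>=\<nu>] assms in
         \<open>simp add: case_prod_unfold eq_commute\<close>)
qed

lemma symbol_comp_assoc:
  assumes R: "\<And>j. holo (\<lambda>(z, \<zeta>). R j z \<zeta> \<eta>) (z, \<zeta>)" and Q: "\<And>j. holo (\<lambda>(z, \<zeta>). Q j z \<zeta> \<eta>) (z, \<zeta>)"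
    and P: "\<And>j. holo (\<lambda>(z, \<zeta>). P j z \<zeta> \<eta>) (z, \<zeta>)"
  shows "(R \<circ>\<^sub>t (Q \<circ>\<^sub>t P)) \<nu> z \<zeta> \<eta> = ((R \<circ>\<^sub>t Q) \<circ>\<^sub>t P) \<nu> z \<zeta> \<eta>"
proof -
  let ?R = "\<lambda>i z \<zeta>. R i z \<zeta> \<eta>" and ?Q = "\<lambda>i z \<zeta>. Q i z \<zeta> \<eta>" and ?P = "\<lambda>i z \<zeta>. P i z \<zeta> \<eta>"
  have "(R \<circ>\<^sub>t (Q \<circ>\<^sub>t P)) \<nu> z \<zeta> \<eta> = (\<Sum>a\<le>\<nu>. \<Sum>i\<le>\<nu> - a. star a (?R i) (\<lambda>z \<zeta>. (Q \<circ>\<^sub>t P) (\<nu> - a - i) z \<zeta> \<eta>) z \<zeta>)"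
    by (rule symbol_comp_eq_star[where Q=R and P="Q \<circ>\<^sub>t P" and \<eta>=\<eta>]) (intro R holo_symbol_comp Q P)+
  also have "\<dots> = (\<Sum>a\<le>\<nu>. \<Sum>i\<le>\<nu> - a. star a (?R i) (\<lambda>z \<zeta>. \<Sum>b\<le>\<nu> - a - i. \<Sum>j\<le>\<nu> - a - i - b.
      star b (?Q j) (?P (\<nu> - a - i - b - j)) z \<zeta>) z \<zeta>)"
    by (intro sum.cong refl star_cong symbol_comp_eq_star_ev[where Q=Q and P=P and \<eta>=\<eta>] Q P) simp
  also have "\<dots> = (\<Sum>a\<le>\<nu>. \<Sum>i\<le>\<nu> - a. \<Sum>b\<le>\<nu> - a - i. \<Sum>j\<le>\<nu> - a - i - b.
      star a (?R i) (star b (?Q j) (?P (\<nu> - a - i - b - j))) z \<zeta>)"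
  proof (intro sum.cong refl)
    fix a i
    have s: "holo (case_prod (star b (?Q j) (?P l))) (z, \<zeta>)" for b j l by (intro holo_star Q P)
    have s': "holo (case_prod (\<lambda>z \<zeta>. \<Sum>j\<le>\<nu> - a - i - b. star b (?Q j) (?P (\<nu> - a - i - b - j)) z \<zeta>)) (z, \<zeta>)" for b
      unfolding case_prod_unfold by (intro holo_sum s[unfolded case_prod_unfold])
    show "star a (?R i) (\<lambda>z \<zeta>. \<Sum>b\<le>\<nu> - a - i. \<Sum>j\<le>\<nu> - a - i - b.
        star b (?Q j) (?P (\<nu> - a - i - b - j)) z \<zeta>) z \<zeta> =
      (\<Sum>b\<le>\<nu> - a - i. \<Sum>j\<le>\<nu> - a - i - b. star a (?R i) (star b (?Q j) (?P (\<nu> - a - i - b - j))) z \<zeta>)"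
      by (simp only: star_sum_right[OF R s'] star_sum_right[OF R s])
  qed
  also have "\<dots> = (\<Sum>b\<le>\<nu>. \<Sum>m\<le>\<nu> - b. \<Sum>a\<le>m. \<Sum>i\<le>m - a.
      star b (star a (?R i) (?Q (m - a - i))) (?P (\<nu> - b - m)) z \<zeta>)"
    by (rule sum_nested_assoc) (intro star_assoc R Q P)
  also have "\<dots> = (\<Sum>b\<le>\<nu>. \<Sum>m\<le>\<nu> - b. star b (\<lambda>z \<zeta>. \<Sum>a\<le>m. \<Sum>i\<le>m - a.
      star a (?R i) (?Q (m - a - i)) z \<zeta>) (?P (\<nu> - b - m)) z \<zeta>)"
  proof (intro sum.cong refl)
    fix b m
    have s: "holo (case_prod (star b (?R j) (?Q l))) (z, \<zeta>)" for b j l by (intro holo_star R Q)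
    have s': "holo (case_prod (\<lambda>z \<zeta>. \<Sum>i\<le>m - a. star a (?R i) (?Q (m - a - i)) z \<zeta>)) (z, \<zeta>)" for a
      unfolding case_prod_unfold by (intro holo_sum s[unfolded case_prod_unfold])
    show "(\<Sum>a\<le>m. \<Sum>i\<le>m - a. star b (star a (?R i) (?Q (m - a - i))) (?P (\<nu> - b - m)) z \<zeta>) =
      star b (\<lambda>z \<zeta>. \<Sum>a\<le>m. \<Sum>i\<le>m - a. star a (?R i) (?Q (m - a - i)) z \<zeta>) (?P (\<nu> - b - m)) z \<zeta>"
      by (simp only: star_sum_left[OF s' P] star_sum_left[OF s P])
  qed
  also have "\<dots> = (\<Sum>b\<le>\<nu>. \<Sum>m\<le>\<nu> - b. star b (\<lambda>z \<zeta>. (R \<circ>\<^sub>t Q) m z \<zeta> \<eta>) (?P (\<nu> - b - m)) z \<zeta>)"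
    by (intro sum.cong refl star_cong[symmetric] symbol_comp_eq_star_ev[where Q=R and P=Q and \<eta>=\<eta>] R Q) simp
  also have "\<dots> = ((R \<circ>\<^sub>t Q) \<circ>\<^sub>t P) \<nu> z \<zeta> \<eta>"
    by (rule symbol_comp_eq_star[where Q="R \<circ>\<^sub>t Q" and P=P and \<eta>=\<eta>, symmetric]) (intro R holo_symbol_comp Q P)+
  finally show ?thesis .
qed

section \<open>Pullback of formal symbols\<close>

lemma pullback_eq_pull_coeff:
  "pullback \<Phi> J P \<nu> w \<mu> \<eta> = (\<Sum>k\<le>\<nu>. pull_coeff \<Phi> J k (\<lambda>z \<zeta>. P (\<nu> - k) z \<zeta> \<eta>) w \<mu>)"
  by (simp add: pullback_def exp_pairing_eq pull_coeff_def case_prod_unfold zero_prod_def)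

text \<open>Increments and base covector are joint variables here, so that the pullback is seen to
  be holomorphic in \<open>(w, \<mu>)\<close> and can enter a composition.\<close>

lemma pull_coeff_integrand:
  fixes \<Phi> :: "complex ^ 'n \<Rightarrow> complex ^ 'n::finite" and J :: "complex ^ 'n \<Rightarrow> complex ^ 'n \<Rightarrow> complex ^ 'n ^ 'n"
    and p :: "complex ^ 'n \<Rightarrow> complex ^ 'n \<Rightarrow> complex"
  assumes J: "\<And>i j. holo (\<lambda>(a, b). J a b $ i $ j) (\<Phi> w, \<Phi> w)"
    and p: "holo (case_prod p) (\<Phi> w, transpose (J (\<Phi> w) (\<Phi> w)) *v \<mu>)"
    and \<Phi>: "holo \<Phi> w"
  shows "holo (\<lambda>P. p (\<Phi> (fst (snd P))) (snd (fst P) + transpose (J (\<Phi> (fst (snd P)) + fst (fst P)) (\<Phi> (fst (snd P)))) *v snd (snd P)))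
    (0, (w, \<mu>))"
proof -
  let ?x = "(0, (w, \<mu>))"
  have hf: "holo (\<lambda>P. \<Phi> (fst (snd P))) ?x"
    by (rule holo_compose[of \<Phi> "\<lambda>P. fst (snd P)"]) (use \<Phi> in \<open>auto intro!: holo_intros\<close>)
  have hJ: "holo (\<lambda>P. J (\<Phi> (fst (snd P)) + fst (fst P)) (\<Phi> (fst (snd P))) $ i $ j) ?x" for i j
    using holo_compose[of "\<lambda>(a, b). J a b $ i $ j" "\<lambda>P. (\<Phi> (fst (snd P)) + fst (fst P), \<Phi> (fst (snd P)))" ?x] J
    by (simp add: holo_intros hf)
  have "holo (\<lambda>P. transpose (J (\<Phi> (fst (snd P)) + fst (fst P)) (\<Phi> (fst (snd P)))) *v snd (snd P)) ?x"
    by (rule holo_matrix_vector_mult) (simp_all add: transpose_def hJ holo_intros)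
  then show ?thesis
    by (intro holo_apply2[OF p] holo_intros hf) simp_all
qed

lemma holo_pull_coeff:
  fixes \<Phi> :: "complex ^ 'n \<Rightarrow> complex ^ 'n::finite" and J :: "complex ^ 'n \<Rightarrow> complex ^ 'n \<Rightarrow> complex ^ 'n ^ 'n"
    and p :: "complex ^ 'n \<Rightarrow> complex ^ 'n \<Rightarrow> complex"
  assumes "\<And>i j. holo (\<lambda>(a, b). J a b $ i $ j) (\<Phi> w, \<Phi> w)"
    and "holo (case_prod p) (\<Phi> w, transpose (J (\<Phi> w) (\<Phi> w)) *v \<mu>)"
    and "holo \<Phi> w"
  shows "holo (case_prod (pull_coeff \<Phi> J k p)) (w, \<mu>)"
  using holo_ecoeff_param[OF pull_coeff_integrand[of J \<Phi> w p \<mu>, OF assms], of UNIV xdir cdir k]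
  by (simp add: pull_coeff_def case_prod_unfold)

lemma pull_coeff_integrand_at:
  fixes \<Phi> :: "complex ^ 'n \<Rightarrow> complex ^ 'n::finite" and J :: "complex ^ 'n \<Rightarrow> complex ^ 'n \<Rightarrow> complex ^ 'n ^ 'n"
    and p :: "complex ^ 'n \<Rightarrow> complex ^ 'n \<Rightarrow> complex"
  assumes "\<And>i j. holo (\<lambda>(a, b). J a b $ i $ j) (\<Phi> w, \<Phi> w)"
    and "holo (case_prod p) (\<Phi> w, transpose (J (\<Phi> w) (\<Phi> w)) *v \<mu>)"
    and "holo \<Phi> w"
  shows "holo (\<lambda>X. p (\<Phi> w) (snd X + transpose (J (\<Phi> w + fst X) (\<Phi> w)) *v \<mu>)) 0"
proof -
  have "holo (\<lambda>X. (X, (w, \<mu>))) (0 :: 'n cotangent)" by (intro holo_intros)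
  from holo_compose[of _ "\<lambda>X. (X, (w, \<mu>))", OF pull_coeff_integrand[of J \<Phi> w p \<mu>, OF assms] this] show ?thesis by simp
qed

lemma pull_coeff_sum:
  assumes "\<And>i j. holo (\<lambda>(a, b). J a b $ i $ j) (\<Phi> w, \<Phi> w)"
    and "\<And>j. j \<in> I \<Longrightarrow> holo (case_prod (p j)) (\<Phi> w, transpose (J (\<Phi> w) (\<Phi> w)) *v \<mu>)"
    and "holo \<Phi> w"
  shows "pull_coeff \<Phi> J k (\<lambda>z \<zeta>. \<Sum>j\<in>I. p j z \<zeta>) w \<mu> = (\<Sum>j\<in>I. pull_coeff \<Phi> J k (p j) w \<mu>)"
  unfolding pull_coeff_def by (rule ecoeff_sum) (intro pull_coeff_integrand_at assms)

lemma pull_coeff_cong: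
  assumes J: "\<And>i j. holo (\<lambda>(a, b). J a b $ i $ j) (\<Phi> w, \<Phi> w)"
    and p: "\<forall>\<^sub>F P in nhds (\<Phi> w, transpose (J (\<Phi> w) (\<Phi> w)) *v \<mu>). case_prod p P = case_prod p' P"
  shows "pull_coeff \<Phi> J k p w \<mu> = pull_coeff \<Phi> J k p' w \<mu>"
  unfolding pull_coeff_def
proof (rule ecoeff_cong)
  have hJ: "holo (\<lambda>X :: 'a cotangent. J (\<Phi> w + fst X) (\<Phi> w) $ i $ j) 0" for i j
    using holo_compose[of "\<lambda>(a, b). J a b $ i $ j" "\<lambda>X :: 'a cotangent. (\<Phi> w + fst X, \<Phi> w)" 0] J
    by (simp add: holo_intros)
  have "holo (\<lambda>X :: 'a cotangent. transpose (J (\<Phi> w + fst X) (\<Phi> w)) *v \<mu>) 0"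
    by (rule holo_matrix_vector_mult) (simp_all add: transpose_def hJ)
  then have "holo (\<lambda>X :: 'a cotangent. (\<Phi> w, snd X + transpose (J (\<Phi> w + fst X) (\<Phi> w)) *v \<mu>)) 0"
    by (intro holo_intros)
  from holo_eventually_compose[OF this, of "\<lambda>P. case_prod p P = case_prod p' P"] p
  show "\<forall>\<^sub>F X in nhds 0. p (\<Phi> w) (snd X + transpose (J (\<Phi> w + fst X) (\<Phi> w)) *v \<mu>) =
      p' (\<Phi> w) (snd X + transpose (J (\<Phi> w + fst X) (\<Phi> w)) *v \<mu>)" by simp
qed

lemma pullback_symbol_comp:
  fixes \<Phi> \<Psi> :: "complex ^ 'n \<Rightarrow> complex ^ 'n::finite" and \<mu> :: "complex ^ 'n"
  assumes \<Phi>: "holo \<Phi> w" and \<Psi>: "holo \<Psi> (\<Phi> w)" "\<Psi> (\<Phi> w) = w"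
    and inv: "\<forall>\<^sub>F x in nhds (\<Phi> w). \<Phi> (\<Psi> x) = x"
    and J: "\<And>i j. holo (\<lambda>(a, b). J a b $ i $ j) (\<Phi> w, \<Phi> w)"
    and Jeq: "\<forall>\<^sub>F P in nhds (\<Phi> w, \<Phi> w). \<Psi> (fst P) - \<Psi> (snd P) = J (fst P) (snd P) *v (fst P - snd P)"
    and Q: "\<And>j. holo (\<lambda>(z, \<zeta>). Q j z \<zeta> \<eta>) (cotangent_map \<Phi> J (w, \<mu>))"
    and P: "\<And>j. holo (\<lambda>(z, \<zeta>). P j z \<zeta> \<eta>) (cotangent_map \<Phi> J (w, \<mu>))"
  shows "(pullback \<Phi> J Q \<circ>\<^sub>t pullback \<Phi> J P) \<nu> w \<mu> \<eta> = pullback \<Phi> J (Q \<circ>\<^sub>t P) \<nu> w \<mu> \<eta>"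
proof -
  let ?Q = "\<lambda>i z \<zeta>. Q i z \<zeta> \<eta>" and ?P = "\<lambda>i z \<zeta>. P i z \<zeta> \<eta>"
  have Q': "holo (case_prod (?Q j)) (\<Phi> w, transpose (J (\<Phi> w) (\<Phi> w)) *v \<mu>)"
    and P': "holo (case_prod (?P j)) (\<Phi> w, transpose (J (\<Phi> w) (\<Phi> w)) *v \<mu>)" for j
    using Q P by (simp_all add: cotangent_map_def)
  have hQ: "holo (case_prod (pull_coeff \<Phi> J k (?Q j))) (w, \<mu>)" and hP: "holo (case_prod (pull_coeff \<Phi> J k (?P j))) (w, \<mu>)" for k j
    by (intro holo_pull_coeff J Q' P' \<Phi>)+
  have hpQ: "holo (\<lambda>(w, \<mu>). pullback \<Phi> J Q j w \<mu> \<eta>) (w, \<mu>)" and hpP: "holo (\<lambda>(w, \<mu>). pullback \<Phi> J P j w \<mu> \<eta>) (w, \<mu>)" for j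
    unfolding pullback_eq_pull_coeff case_prod_unfold
    by (intro holo_sum hQ[unfolded case_prod_unfold] hP[unfolded case_prod_unfold])+
  have "(pullback \<Phi> J Q \<circ>\<^sub>t pullback \<Phi> J P) \<nu> w \<mu> \<eta> = (\<Sum>m\<le>\<nu>. \<Sum>j\<le>\<nu> - m.
     star m (\<lambda>z \<zeta>. \<Sum>k\<le>j. pull_coeff \<Phi> J k (?Q (j - k)) z \<zeta>) (\<lambda>z \<zeta>. \<Sum>l\<le>\<nu> - m - j. pull_coeff \<Phi> J l (?P (\<nu> - m - j - l)) z \<zeta>) w \<mu>)"
    by (subst symbol_comp_eq_star[where Q="pullback \<Phi> J Q" and P="pullback \<Phi> J P" and \<eta>=\<eta>, OF hpQ hpP]) (simp add: pullback_eq_pull_coeff)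
  also have "\<dots> = (\<Sum>m\<le>\<nu>. \<Sum>j\<le>\<nu> - m. \<Sum>k\<le>j. \<Sum>l\<le>\<nu> - m - j.
     star m (pull_coeff \<Phi> J k (?Q (j - k))) (pull_coeff \<Phi> J l (?P (\<nu> - m - j - l))) w \<mu>)"
  proof (intro sum.cong refl)
    fix m j
    have h: "holo (case_prod (\<lambda>z \<zeta>. \<Sum>l\<le>\<nu> - m - j. pull_coeff \<Phi> J l (?P (\<nu> - m - j - l)) z \<zeta>)) (w, \<mu>)"
      unfolding case_prod_unfold by (intro holo_sum hP[unfolded case_prod_unfold])
    show "star m (\<lambda>z \<zeta>. \<Sum>k\<le>j. pull_coeff \<Phi> J k (?Q (j - k)) z \<zeta>) (\<lambda>z \<zeta>. \<Sum>l\<le>\<nu> - m - j. pull_coeff \<Phi> J l (?P (\<nu> - m - j - l)) z \<zeta>) w \<mu> =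
      (\<Sum>k\<le>j. \<Sum>l\<le>\<nu> - m - j. star m (pull_coeff \<Phi> J k (?Q (j - k))) (pull_coeff \<Phi> J l (?P (\<nu> - m - j - l))) w \<mu>)"
      by (simp only: star_sum_left[OF hQ h] star_sum_right[OF hQ hP])
  qed
  also have "\<dots> = (\<Sum>k\<le>\<nu>. \<Sum>l\<le>\<nu> - k. \<Sum>i\<le>\<nu> - k - l. pull_coeff \<Phi> J k (star l (?Q i) (?P (\<nu> - k - l - i))) w \<mu>)"
    by (rule sum_nested_pullback) (intro pull_coeff_star[OF \<Phi> refl \<Psi> inv J Jeq refl] Q' P')
  also have "\<dots> = (\<Sum>k\<le>\<nu>. pull_coeff \<Phi> J k (\<lambda>z \<zeta>. \<Sum>l\<le>\<nu> - k. \<Sum>i\<le>\<nu> - k - l. star l (?Q i) (?P (\<nu> - k - l - i)) z \<zeta>) w \<mu>)"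
  proof (intro sum.cong refl)
    fix k
    have s: "holo (case_prod (star l (?Q i) (?P j))) (\<Phi> w, transpose (J (\<Phi> w) (\<Phi> w)) *v \<mu>)" for l i j
      by (intro holo_star Q' P')
    have s': "holo (case_prod (\<lambda>z \<zeta>. \<Sum>i\<le>\<nu> - k - l. star l (?Q i) (?P (\<nu> - k - l - i)) z \<zeta>)) (\<Phi> w, transpose (J (\<Phi> w) (\<Phi> w)) *v \<mu>)" for l
      unfolding case_prod_unfold by (intro holo_sum s[unfolded case_prod_unfold])
    show "(\<Sum>l\<le>\<nu> - k. \<Sum>i\<le>\<nu> - k - l. pull_coeff \<Phi> J k (star l (?Q i) (?P (\<nu> - k - l - i))) w \<mu>) =
      pull_coeff \<Phi> J k (\<lambda>z \<zeta>. \<Sum>l\<le>\<nu> - k. \<Sum>i\<le>\<nu> - k - l. star l (?Q i) (?P (\<nu> - k - l - i)) z \<zeta>) w \<mu>"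
      by (simp only: pull_coeff_sum[OF J s' \<Phi>] pull_coeff_sum[OF J s \<Phi>])
  qed
  also have "\<dots> = pullback \<Phi> J (Q \<circ>\<^sub>t P) \<nu> w \<mu> \<eta>"
    unfolding pullback_eq_pull_coeff
    by (intro sum.cong refl pull_coeff_cong[symmetric] J symbol_comp_eq_star_ev[where Q=Q and P=P and \<eta>=\<eta>] Q' P')
  finally show ?thesis .
qed

section \<open>Derivatives and partial sums of compositions\<close>

lemma imul_cotangent:
  "(mult_i :: complex ^ 'n::finite \<Rightarrow> _) = imul"
  "(mult_i2 :: 'n cotangent \<Rightarrow> _) = imul"
  "(mult_i3 :: (complex ^ 'n) \<times> (complex ^ 'n) \<times> complex \<Rightarrow> _) = imul"
  by (auto simp: mult_i_def mult_i2_def mult_i3_def imul_prod_def imul_vec_def imul_complex_def vec_eq_iff fun_eq_iff)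

lemma holo_on_imul: "holo_on imul f U \<longleftrightarrow> (\<forall>x\<in>U. cdiff f x)"
  by (simp add: holo_on_def cdiff_def imul_complex_def)

lemma holo_on_holo: "holo_on imul f U \<Longrightarrow> open U \<Longrightarrow> x \<in> U \<Longrightarrow> holo f x"
  by (auto simp: holo_on_imul intro: holo_open)

abbreviation holo3 :: "(complex ^ 'n \<Rightarrow> complex ^ 'n \<Rightarrow> complex \<Rightarrow> complex) \<Rightarrow> complex ^ 'n \<Rightarrow> complex ^ 'n::finite \<Rightarrow> complex \<Rightarrow> bool" where
  "holo3 p z \<zeta> \<eta> \<equiv> holo (\<lambda>(z, \<zeta>, \<eta>). p z \<zeta> \<eta>) (z, \<zeta>, \<eta>)"

text \<open>The set of all points of holomorphy is open and is the largest admissible neighbourhood,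
  so the existence of \<open>U\<close> becomes a condition at each point.\<close>

lemma coeffs_holo_iff:
  "coeffs_holo \<Omega> S d \<rho> P \<longleftrightarrow>
    (\<forall>\<nu> z \<zeta> \<eta>. (z, \<zeta>) \<in> symbol_domain \<Omega> d \<rho> \<longrightarrow> \<eta> \<in> S \<longrightarrow> holo3 (P \<nu>) z \<zeta> \<eta>)"
proof
  assume "coeffs_holo \<Omega> S d \<rho> P"
  then show "\<forall>\<nu> z \<zeta> \<eta>. (z, \<zeta>) \<in> symbol_domain \<Omega> d \<rho> \<longrightarrow> \<eta> \<in> S \<longrightarrow> holo3 (P \<nu>) z \<zeta> \<eta>"
    unfolding coeffs_holo_def imul_cotangent by (blast intro: holo_on_holo)
next
  assume *: "\<forall>\<nu> z \<zeta> \<eta>. (z, \<zeta>) \<in> symbol_domain \<Omega> d \<rho> \<longrightarrow> \<eta> \<in> S \<longrightarrow> holo3 (P \<nu>) z \<zeta> \<eta>"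
  show "coeffs_holo \<Omega> S d \<rho> P"
    unfolding coeffs_holo_def imul_cotangent holo_on_imul
  proof
    fix \<nu>
    show "\<exists>U. open U \<and> {(z, \<zeta>, \<eta>). (z, \<zeta>) \<in> symbol_domain \<Omega> d \<rho> \<and> \<eta> \<in> S} \<subseteq> U \<and>
         (\<forall>x\<in>U. cdiff (\<lambda>(z, \<zeta>, \<eta>). P \<nu> z \<zeta> \<eta>) x)"
      using * by (intro exI[of _ "{x. holo (\<lambda>(z, \<zeta>, \<eta>). P \<nu> z \<zeta> \<eta>) x}"])
        (auto simp: open_holo intro: holo_cdiff)
  qed
qed

lemma holo3_apply:
  assumes "holo3 p z \<zeta> \<eta>" "holo f x" "holo g x" "holo h x" "f x = z" "g x = \<zeta>" "h x = \<eta>"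
  shows "holo (\<lambda>x. p (f x) (g x) (h x)) x"
  using holo_compose[of "\<lambda>(z, \<zeta>, \<eta>). p z \<zeta> \<eta>" "\<lambda>x. (f x, g x, h x)" x] assms by (simp add: holo_Pair)

lemma holo3_slice:
  assumes "holo3 p z \<zeta> \<eta>"
  shows "holo (\<lambda>(z, \<zeta>). p z \<zeta> \<eta>) (z, \<zeta>)"
  unfolding case_prod_unfold by (rule holo3_apply[OF assms]) (auto intro!: holo_intros)

definition star3 :: "nat \<Rightarrow> (complex ^ 'n \<Rightarrow> complex ^ 'n \<Rightarrow> complex \<Rightarrow> complex) \<Rightarrow> (complex ^ 'n \<Rightarrow> complex ^ 'n \<Rightarrow> complex \<Rightarrow> complex) \<Rightarrow>
    complex ^ 'n \<Rightarrow> complex ^ 'n::finite \<Rightarrow> complex \<Rightarrow> complex" where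
  "star3 k q p z \<zeta> \<eta> = star k (\<lambda>z \<zeta>. q z \<zeta> \<eta>) (\<lambda>z \<zeta>. p z \<zeta> \<eta>) z \<zeta>"

definition eta_deriv :: "(complex ^ 'n \<Rightarrow> complex ^ 'n \<Rightarrow> complex \<Rightarrow> complex) \<Rightarrow> complex ^ 'n \<Rightarrow> complex ^ 'n \<Rightarrow> complex \<Rightarrow> complex" where
  "eta_deriv p z \<zeta> \<eta> = deriv (\<lambda>x. p z \<zeta> x) \<eta>"

lemma d_eta_eta_deriv: "d_eta P \<nu> = eta_deriv (P \<nu>)"
  by (simp add: d_eta_def eta_deriv_def fun_eq_iff)

lemma eta_deriv_eq_dir_deriv: "eta_deriv p z \<zeta> \<eta> = dir_deriv (0, 0, 1) (\<lambda>(z, \<zeta>, \<eta>). p z \<zeta> \<eta>) (z, \<zeta>, \<eta>)"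
  by (simp add: eta_deriv_def dir_deriv_def o_def deriv_shift_0[of _ \<eta>])

lemma holo3_eta_deriv: "holo3 p z \<zeta> \<eta> \<Longrightarrow> holo3 (eta_deriv p) z \<zeta> \<eta>"
  using holo_dir_deriv[of "\<lambda>(z, \<zeta>, \<eta>). p z \<zeta> \<eta>" "(z, \<zeta>, \<eta>)" "(0, 0, 1)"]
  by (simp add: eta_deriv_eq_dir_deriv case_prod_unfold)

context
  fixes q p :: "complex ^ 'n \<Rightarrow> complex ^ 'n::finite \<Rightarrow> complex \<Rightarrow> complex" and z \<zeta> :: "complex ^ 'n" and \<eta> :: complex
  assumes q: "holo3 q z \<zeta> \<eta>" and p: "holo3 p z \<zeta> \<eta>"
begin

abbreviation (input) "q3 \<equiv> (\<lambda>P. q (fst (snd P)) (fst (snd (snd P)) + snd (fst P)) (snd (snd (snd P))))"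
abbreviation (input) "p3 \<equiv> (\<lambda>P. p (fst (snd P) + fst (fst P)) (fst (snd (snd P))) (snd (snd (snd P))))"

lemma holo_q3: "holo q3 ((0, 0), (z, \<zeta>, \<eta>))" and holo_p3: "holo p3 ((0, 0), (z, \<zeta>, \<eta>))"
  by (intro holo3_apply[OF q] holo3_apply[OF p] holo_intros; simp)+

lemma holo3_star3: "holo3 (star3 k q p) z \<zeta> \<eta>"
  using holo_ecoeff_param[OF holo_mult[OF holo_q3 holo_p3], of UNIV xdir cdir k]
  by (simp add: star3_def star_def case_prod_unfold zero_prod_def)

text \<open>\<eta> and the base point are inert coordinates for the pairing: the \<eta>-derivative
  passes through the exponential, and the product rule applies to the integrand.\<close>

lemma eta_deriv_star3: "eta_deriv (star3 k q p) z \<zeta> \<eta> = star3 k (eta_deriv q) p z \<zeta> \<eta> + star3 k q (eta_deriv p) z \<zeta> \<eta>"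
proof -
  let ?e = "(0, 0, 1) :: (complex ^ 'n) \<times> (complex ^ 'n) \<times> complex"
  let ?G = "\<lambda>P. q3 P * p3 P"
  have "eta_deriv (star3 k q p) z \<zeta> \<eta> = dir_deriv ?e (\<lambda>y. T1 k (\<lambda>X. ?G (X, y)) (0, 0)) (z, \<zeta>, \<eta>)"
    by (simp add: eta_deriv_eq_dir_deriv star3_def star_def case_prod_unfold zero_prod_def)
  also have "\<dots> = T1 k (\<lambda>X. dir_deriv (0, ?e) ?G (X, (z, \<zeta>, \<eta>))) (0, 0)"
    by (rule dir_deriv_ecoeff_param[OF holo_mult[OF holo_q3 holo_p3]])
  also have "\<dots> = T1 k (\<lambda>X. eta_deriv q z (\<zeta> + snd X) \<eta> * p (z + fst X) \<zeta> \<eta> + q z (\<zeta> + snd X) \<eta> * eta_deriv p (z + fst X) \<zeta> \<eta>) (0, 0)"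
  proof (rule ecoeff_cong)
    have "holo (\<lambda>X :: 'n cotangent. (X, (z, \<zeta>, \<eta>))) (0, 0)" by (intro holo_intros)
    from holo_eventually_compose[OF this holo_eventually[OF holo_q3]]
      holo_eventually_compose[OF this holo_eventually[OF holo_p3]]
    show "\<forall>\<^sub>F X in nhds (0, 0). dir_deriv (0, ?e) ?G (X, (z, \<zeta>, \<eta>)) =
       eta_deriv q z (\<zeta> + snd X) \<eta> * p (z + fst X) \<zeta> \<eta> + q z (\<zeta> + snd X) \<eta> * eta_deriv p (z + fst X) \<zeta> \<eta>"
    proof eventually_elim
      fix X :: "'n cotangent"
      assume "holo q3 (X, z, \<zeta>, \<eta>)" "holo p3 (X, z, \<zeta>, \<eta>)"
      from this[THEN holo_cdiff] have "dir_deriv (0, ?e) ?G (X, (z, \<zeta>, \<eta>)) =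
          q3 (X, z, \<zeta>, \<eta>) * dir_deriv (0, ?e) p3 (X, (z, \<zeta>, \<eta>)) + dir_deriv (0, ?e) q3 (X, (z, \<zeta>, \<eta>)) * p3 (X, z, \<zeta>, \<eta>)"
        by (rule dir_deriv_mult)
      moreover have "dir_deriv (0, ?e) q3 (X, (z, \<zeta>, \<eta>)) = eta_deriv q z (\<zeta> + snd X) \<eta>"
        "dir_deriv (0, ?e) p3 (X, (z, \<zeta>, \<eta>)) = eta_deriv p (z + fst X) \<zeta> \<eta>"
        by (simp_all add: eta_deriv_eq_dir_deriv dir_deriv_def)
      ultimately show "dir_deriv (0, ?e) ?G (X, (z, \<zeta>, \<eta>)) =
       eta_deriv q z (\<zeta> + snd X) \<eta> * p (z + fst X) \<zeta> \<eta> + q z (\<zeta> + snd X) \<eta> * eta_deriv p (z + fst X) \<zeta> \<eta>"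
        by simp
    qed
  qed
  also have "\<dots> = star3 k (eta_deriv q) p z \<zeta> \<eta> + star3 k q (eta_deriv p) z \<zeta> \<eta>"
    unfolding star3_def star_def zero_prod_def[symmetric]
    by (intro ecoeff_add star_integrand[of "\<lambda>z \<zeta>. q z \<zeta> \<eta>" z \<zeta> "\<lambda>z \<zeta>. eta_deriv p z \<zeta> \<eta>"]
       star_integrand[of "\<lambda>z \<zeta>. eta_deriv q z \<zeta> \<eta>" z \<zeta> "\<lambda>z \<zeta>. p z \<zeta> \<eta>"] holo3_slice holo3_eta_deriv q p)
  finally show ?thesis .
qed

end

text \<open>Agrees with the coefficients of \<open>\<circ>\<^sub>t\<close> at points of holomorphy,
  but is already distributed over single products. Partial sums, \<eta>-derivatives and estimates
  are all carried out in this form.\<close>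

definition star_conv :: "('n::finite) formal_symbol \<Rightarrow> 'n formal_symbol \<Rightarrow> 'n formal_symbol" where
  "star_conv F G m z \<zeta> \<eta> = (\<Sum>k\<le>m. \<Sum>j\<le>m - k. star3 k (F j) (G (m - k - j)) z \<zeta> \<eta>)"

text \<open>Indexed by \<open>m\<close>, the partial sums form a formal symbol again; the null
  condition on \<open>F\<close> is the ordinary growth condition on \<open>psum F\<close>, so one
  estimate of compositions serves both classes.\<close>

definition psum :: "('n::finite) formal_symbol \<Rightarrow> 'n formal_symbol" where
  "psum F m z \<zeta> \<eta> = (\<Sum>\<nu><m. F \<nu> z \<zeta> \<eta>)"

lemma holo3_psum:
  assumes "\<And>\<nu>. holo3 (F \<nu>) z \<zeta> \<eta>"
  shows "holo3 (psum F m) z \<zeta> \<eta>"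
  unfolding psum_def case_prod_unfold using assms by (intro holo_sum) (simp add: case_prod_unfold)

lemma star3_sum_right:
  assumes "holo3 q z \<zeta> \<eta>" "\<And>j. j \<in> J \<Longrightarrow> holo3 (p j) z \<zeta> \<eta>"
  shows "star3 k q (\<lambda>z \<zeta> \<eta>. \<Sum>j\<in>J. p j z \<zeta> \<eta>) z \<zeta> \<eta> = (\<Sum>j\<in>J. star3 k q (p j) z \<zeta> \<eta>)"
  unfolding star3_def by (rule star_sum_right) (use holo3_slice[OF assms(1)] holo3_slice[OF assms(2)] in auto)

lemma star3_sum_left:
  assumes "\<And>j. j \<in> J \<Longrightarrow> holo3 (q j) z \<zeta> \<eta>" "holo3 p z \<zeta> \<eta>"
  shows "star3 k (\<lambda>z \<zeta> \<eta>. \<Sum>j\<in>J. q j z \<zeta> \<eta>) p z \<zeta> \<eta> = (\<Sum>j\<in>J. star3 k (q j) p z \<zeta> \<eta>)"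
  unfolding star3_def by (rule star_sum_left) (use holo3_slice[OF assms(1)] holo3_slice[OF assms(2)] in auto)

text \<open>Total order below \<open>m\<close> means that the third order is below
  \<open>m - k - j\<close>. The boundary index \<open>j = m - k\<close> contributes empty
  sums.\<close>

lemma sum_partial_right:
  fixes f :: "nat \<Rightarrow> nat \<Rightarrow> nat \<Rightarrow> 'a::comm_monoid_add"
  shows "(\<Sum>\<nu><m. \<Sum>k\<le>\<nu>. \<Sum>j\<le>\<nu> - k. f k j (\<nu> - k - j)) = (\<Sum>k\<le>m. \<Sum>j\<le>m - k. \<Sum>i<m - k - j. f k j i)"
  by (simp add: sum.Sigma split_beta)
    (rule sum.reindex_bij_witness[where
          j = "\<lambda>(\<nu>, k, j). (k, j, \<nu> - k - j)" and i = "\<lambda>(k, j, i). (k + j + i, k, j)"]; auto)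

text \<open>The slack \<open>m - \<nu>\<close> is added to the second order: the third one becomes
  \<open>m - k - j\<close>, and the constraint becomes \<open>i < j\<close>.\<close>

lemma sum_partial_left:
  fixes f :: "nat \<Rightarrow> nat \<Rightarrow> nat \<Rightarrow> 'a::comm_monoid_add"
  shows "(\<Sum>\<nu><m. \<Sum>k\<le>\<nu>. \<Sum>j\<le>\<nu> - k. f k j (\<nu> - k - j)) = (\<Sum>k\<le>m. \<Sum>j\<le>m - k. \<Sum>i<j. f k i (m - k - j))"
  by (simp add: sum.Sigma split_beta)
    (rule sum.reindex_bij_witness[where
          j = "\<lambda>(\<nu>, k, j). (k, m - \<nu> + j, j)" and i = "\<lambda>(k, j, i). (m + i - j, k, i)"]; auto)

lemma psum_star_conv:
  assumes F: "\<And>\<nu>. holo3 (F \<nu>) z \<zeta> \<eta>" and G: "\<And>\<nu>. holo3 (G \<nu>) z \<zeta> \<eta>"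
  shows "psum (star_conv F G) m z \<zeta> \<eta> = star_conv F (psum G) m z \<zeta> \<eta>"
    and "psum (star_conv F G) m z \<zeta> \<eta> = star_conv (psum F) G m z \<zeta> \<eta>"
proof -
  have "psum (star_conv F G) m z \<zeta> \<eta> = (\<Sum>k\<le>m. \<Sum>j\<le>m - k. \<Sum>i<m - k - j. star3 k (F j) (G i) z \<zeta> \<eta>)"
    unfolding psum_def star_conv_def by (rule sum_partial_right)
  also have "\<dots> = star_conv F (psum G) m z \<zeta> \<eta>"
    unfolding star_conv_def psum_def[abs_def] by (intro sum.cong refl star3_sum_right[symmetric] F G)
  finally show "psum (star_conv F G) m z \<zeta> \<eta> = star_conv F (psum G) m z \<zeta> \<eta>" .
  have "psum (star_conv F G) m z \<zeta> \<eta> = (\<Sum>k\<le>m. \<Sum>j\<le>m - k. \<Sum>i<j. star3 k (F i) (G (m - k - j)) z \<zeta> \<eta>)"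
    unfolding psum_def star_conv_def by (rule sum_partial_left)
  also have "\<dots> = star_conv (psum F) G m z \<zeta> \<eta>"
    unfolding star_conv_def psum_def[abs_def] by (intro sum.cong refl star3_sum_left[symmetric] F G)
  finally show "psum (star_conv F G) m z \<zeta> \<eta> = star_conv (psum F) G m z \<zeta> \<eta>" .
qed

lemma holo3_star_conv:
  assumes "\<And>\<nu>. holo3 (F \<nu>) z \<zeta> \<eta>" "\<And>\<nu>. holo3 (G \<nu>) z \<zeta> \<eta>"
  shows "holo3 (star_conv F G m) z \<zeta> \<eta>"
  unfolding star_conv_def case_prod_unfold
  using holo3_star3[OF assms] by (intro holo_sum) (simp add: case_prod_unfold)

lemma eta_deriv_star_conv:
  assumes F: "\<And>\<nu>. holo3 (F \<nu>) z \<zeta> \<eta>" and G: "\<And>\<nu>. holo3 (G \<nu>) z \<zeta> \<eta>"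
  shows "eta_deriv (star_conv F G m) z \<zeta> \<eta> = star_conv (\<lambda>\<nu>. eta_deriv (F \<nu>)) G m z \<zeta> \<eta> + star_conv F (\<lambda>\<nu>. eta_deriv (G \<nu>)) m z \<zeta> \<eta>"
proof -
  let ?f = "\<lambda>k j x. case x of (z, \<zeta>, \<eta>) \<Rightarrow> star3 k (F j) (G (m - k - j)) z \<zeta> \<eta>"
  have h: "holo (?f k j) (z, \<zeta>, \<eta>)" for k j by (rule holo3_star3[OF F G])
  have "eta_deriv (star_conv F G m) z \<zeta> \<eta> = dir_deriv (0, 0, 1) (\<lambda>x. \<Sum>k\<le>m. \<Sum>j\<le>m - k. ?f k j x) (z, \<zeta>, \<eta>)"
    by (simp add: eta_deriv_eq_dir_deriv star_conv_def case_prod_unfold)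
  also have "\<dots> = (\<Sum>k\<le>m. dir_deriv (0, 0, 1) (\<lambda>x. \<Sum>j\<le>m - k. ?f k j x) (z, \<zeta>, \<eta>))"
    by (intro dir_deriv_sum holo_cdiff holo_sum h)
  also have "\<dots> = (\<Sum>k\<le>m. \<Sum>j\<le>m - k. dir_deriv (0, 0, 1) (?f k j) (z, \<zeta>, \<eta>))"
    by (intro sum.cong refl dir_deriv_sum holo_cdiff h)
  also have "\<dots> = (\<Sum>k\<le>m. \<Sum>j\<le>m - k. star3 k (eta_deriv (F j)) (G (m - k - j)) z \<zeta> \<eta> + star3 k (F j) (eta_deriv (G (m - k - j))) z \<zeta> \<eta>)"
    by (simp only: eta_deriv_eq_dir_deriv[symmetric] eta_deriv_star3[OF F G])
  finally show ?thesis by (simp add: star_conv_def sum.distrib)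
qed

lemma symbol_comp_eq_star_conv_ev:
  assumes Q: "\<And>\<nu>. holo3 (Q \<nu>) z \<zeta> \<eta>" and P: "\<And>\<nu>. holo3 (P \<nu>) z \<zeta> \<eta>"
  shows "\<forall>\<^sub>F x in nhds (z, \<zeta>, \<eta>). (\<lambda>(z, \<zeta>, \<eta>). (Q \<circ>\<^sub>t P) \<nu> z \<zeta> \<eta>) x = (\<lambda>(z, \<zeta>, \<eta>). star_conv Q P \<nu> z \<zeta> \<eta>) x"
proof -
  have "\<forall>\<^sub>F x in nhds (z, \<zeta>, \<eta>). \<forall>j\<in>{..\<nu>}. holo (\<lambda>(z, \<zeta>, \<eta>). Q j z \<zeta> \<eta>) x \<and> holo (\<lambda>(z, \<zeta>, \<eta>). P j z \<zeta> \<eta>) x"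
    using Q P by (intro eventually_ball_finite ballI eventually_conj holo_eventually) auto
  then show ?thesis
  proof eventually_elim
    fix x assume h: "\<forall>j\<in>{..\<nu>}. holo (\<lambda>(z, \<zeta>, \<eta>). Q j z \<zeta> \<eta>) x \<and> holo (\<lambda>(z, \<zeta>, \<eta>). P j z \<zeta> \<eta>) x"
    obtain z \<zeta> \<eta> where x: "x = (z, \<zeta>, \<eta>)" by (cases x)
    have "(Q \<circ>\<^sub>t P) \<nu> z \<zeta> \<eta> = star_conv Q P \<nu> z \<zeta> \<eta>"
      unfolding star_conv_def star3_def
      by (rule symbol_comp_eq_star[where Q=Q and P=P and \<eta>=\<eta>]; rule holo3_slice) (use h x in blast)+
    then show "(\<lambda>(z, \<zeta>, \<eta>). (Q \<circ>\<^sub>t P) \<nu> z \<zeta> \<eta>) x = (\<lambda>(z, \<zeta>, \<eta>). star_conv Q P \<nu> z \<zeta> \<eta>) x"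
      by (simp add: x)
  qed
qed

section \<open>Cauchy estimates\<close>

lemma maxnorm_ge: "cmod (z $ i) \<le> maxnorm (z :: complex ^ 'n::finite)"
  unfolding maxnorm_def by (rule Max_ge) auto

lemma maxnorm_leI: "(\<And>i. cmod (z $ i) \<le> b) \<Longrightarrow> maxnorm (z :: complex ^ 'n::finite) \<le> b"
  unfolding maxnorm_def by (subst Max_le_iff) auto

lemma maxnorm_add: "maxnorm (x + y :: complex ^ 'n::finite) \<le> maxnorm x + maxnorm y"
  by (rule maxnorm_leI) (simp, rule order_trans[OF norm_triangle_ineq], rule add_mono; rule maxnorm_ge)

lemma maxnorm_uminus [simp]: "maxnorm (- x) = maxnorm x"
  by (simp add: maxnorm_def)

lemma maxnorm_0 [simp]: "maxnorm (0 :: complex ^ 'n::finite) = 0"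
  by (rule antisym) (auto intro: maxnorm_leI maxnorm_nonneg)

lemma maxnorm_smult: "maxnorm (c *s z :: complex ^ 'n::finite) = cmod c * maxnorm z"
proof (rule antisym)
  show "maxnorm (c *s z) \<le> cmod c * maxnorm z"
    by (rule maxnorm_leI) (simp add: norm_mult mult_left_mono maxnorm_ge)
  have "maxnorm z \<in> range (\<lambda>i. cmod (z $ i))"
    unfolding maxnorm_def by (rule Max_in) auto
  then obtain i where "maxnorm z = cmod (z $ i)" by blast
  then show "cmod c * maxnorm z \<le> maxnorm (c *s z)"
    using maxnorm_ge[of "c *s z" i] by (simp add: norm_mult)
qed

lemma maxnorm_axis: "maxnorm (axis i s :: complex ^ 'n::finite) \<le> cmod s"
  by (rule maxnorm_leI) (simp add: axis_def)

lemma maxnorm_le_norm: "maxnorm (z :: complex ^ 'n::finite) \<le> norm z"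
  by (rule maxnorm_leI) (rule Finite_Cartesian_Product.norm_nth_le)

lemma maxnorm_diff_ge: "maxnorm x - maxnorm y \<le> maxnorm (x + y :: complex ^ 'n::finite)"
  using maxnorm_add[of "x + y" "- y"] by simp

lemma dir_deriv_Cauchy_bound:
  assumes r: "r > 0" and d: "\<And>s. norm s \<le> r \<Longrightarrow> cdiff f (x + cscale s v)"
    and M: "\<And>s. norm s = r \<Longrightarrow> cmod (f (x + cscale s v)) \<le> M"
  shows "cmod (dir_deriv v f x) \<le> M / r"
proof -
  let ?g = "\<lambda>s. f (x + cscale s v)"
  have fd: "?g field_differentiable at s" if "norm s \<le> r" for s
    using d[OF that] cdiff_line unfolding cdiff_def field_differentiable_def by blast
  have "cmod ((deriv ^^ 1) ?g 0) \<le> fact 1 * M / r ^ 1"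
  proof (rule Cauchy_inequality)
    show "?g holomorphic_on ball 0 r"
      by (auto simp: holomorphic_on_def intro!: field_differentiable_at_within fd)
    show "continuous_on (cball 0 r) ?g"
      by (auto intro!: continuous_at_imp_continuous_on field_differentiable_imp_continuous_at fd)
  qed (use r M in auto)
  then show ?thesis by (simp add: dir_deriv_def)
qed

text \<open>Each pairing uses circles of radius \<open>\<delta>1\<close> in a position and
  \<open>\<delta>2\<close> in a covector coordinate. It costs the factor
  \<open>real CARD('n) / (\<delta>1 * \<delta>2)\<close> and one layer of the polydisc; after
  \<open>k\<close> of them only the centre is left.\<close>

lemma plap_pow_bound:
  fixes F :: "('n::finite) cotangent \<Rightarrow> complex"
  assumes "\<delta>1 > 0" "\<delta>2 > 0"
    and "\<And>x y. maxnorm (x - x0) \<le> real k * \<delta>1 \<Longrightarrow> maxnorm (y - y0) \<le> real k * \<delta>2 \<Longrightarrow>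
      holo F (x, y) \<and> cmod (F (x, y)) \<le> M"
  shows "cmod ((plap UNIV xdir cdir ^^ k) F (x0, y0)) \<le> (real CARD('n) / (\<delta>1 * \<delta>2)) ^ k * M"
  using assms(3)
proof (induction k arbitrary: F M)
  case (Suc k)
  have h: "holo F (x, y)" "cmod (F (x, y)) \<le> M"
    if "maxnorm (x - x0) \<le> real (Suc k) * \<delta>1" "maxnorm (y - y0) \<le> real (Suc k) * \<delta>2" for x y
    using Suc.prems[OF that] by auto
  \<comment> \<open>The innermost pairing is split off, so the induction hypothesis is used for
    \<open>plap UNIV xdir cdir F\<close> on a polydisc thinner by one layer.\<close>
  have "cmod ((plap UNIV xdir cdir ^^ k) (plap UNIV xdir cdir F) (x0, y0)) \<le>
      (real CARD('n) / (\<delta>1 * \<delta>2)) ^ k * (real CARD('n) * (M / \<delta>1 / \<delta>2))"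
  proof (rule Suc.IH)
    fix x y assume xy: "maxnorm (x - x0) \<le> real k * \<delta>1" "maxnorm (y - y0) \<le> real k * \<delta>2"
    have step: "maxnorm (a + axis i s - b) \<le> real (Suc k) * \<delta>"
      if "maxnorm (a - b) \<le> real k * \<delta>" "cmod s \<le> \<delta>" for a b :: "complex ^ 'n" and s i \<delta>
      using maxnorm_add[of "a - b" "axis i s"] maxnorm_axis[of i s] that by (simp add: algebra_simps)
    have weak: "a \<le> real (Suc k) * \<delta>" if "a \<le> real k * \<delta>" "\<delta> > 0" for a \<delta>
      using that by (simp add: algebra_simps)
    have 1: "cmod (dir_deriv (xdir i) F (x, y')) \<le> M / \<delta>1" if y': "maxnorm (y' - y0) \<le> real (Suc k) * \<delta>2" for i y'
    proof -
      have "holo F ((x, y') + cscale s (xdir i)) \<and> cmod (F ((x, y') + cscale s (xdir i))) \<le> M" if "norm s \<le> \<delta>1" for s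
        using h[OF step[OF xy(1) that] y', of i] by (simp add: xdir_def cscale_axis)
      then show ?thesis using assms(1) by - (rule dir_deriv_Cauchy_bound, auto intro: holo_cdiff)
    qed
    have 2: "cmod (dir_deriv (cdir i) (dir_deriv (xdir i) F) (x, y)) \<le> M / \<delta>1 / \<delta>2" for i
    proof -
      have "holo F ((x, y) + cscale s (cdir i)) \<and> cmod (dir_deriv (xdir i) F ((x, y) + cscale s (cdir i))) \<le> M / \<delta>1" if "norm s \<le> \<delta>2" for s
        using h(1)[OF weak[OF xy(1) assms(1)] step[OF xy(2) that], of i] 1[OF step[OF xy(2) that], of i i]
        by (simp add: cdir_def cscale_axis)
      then show ?thesis using assms(2) by - (rule dir_deriv_Cauchy_bound, auto intro: holo_cdiff holo_dir_deriv)
    qed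
    have "cmod (plap UNIV xdir cdir F (x, y)) \<le> (\<Sum>i\<in>(UNIV :: 'n set). M / \<delta>1 / \<delta>2)"
      unfolding plap_def by (intro sum_norm_le 2)
    moreover have "holo F (x, y)"
      using xy assms by (intro h weak)
    ultimately show "holo (plap UNIV xdir cdir F) (x, y) \<and> cmod (plap UNIV xdir cdir F (x, y)) \<le>
        real CARD('n) * (M / \<delta>1 / \<delta>2)"
      by (simp add: holo_plap)
  qed
  then show ?case
    unfolding funpow_Suc_right o_def by (simp add: field_simps)
qed simp

text \<open>Divided by the factorial, the left side is one term of the exponential series at
  \<open>k\<close>.\<close>

lemma power_le_exp_fact: "real k ^ k \<le> exp (real k) * fact k"
proof -
  have "(\<lambda>n. real k ^ n / fact n) sums exp (real k)"
    using exp_converges[of "real k"] by (simp add: divide_inverse mult.commute)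
  then have "real k ^ k / fact k \<le> exp (real k)"
    using sum_le_suminf[of "\<lambda>n. real k ^ n / fact n" "{k}"] by (simp add: sums_iff)
  then show ?thesis by (simp add: field_simps)
qed

abbreviation sym_bound :: "real \<Rightarrow> real \<Rightarrow> real \<Rightarrow> nat \<Rightarrow> complex ^ 'n::finite \<Rightarrow> complex \<Rightarrow> real" where
  "sym_bound C A h m \<zeta> \<eta> \<equiv> C * fact m * A ^ m * exp (h * maxnorm \<zeta>) / maxnorm (\<eta> *s \<zeta>) ^ m"

text \<open>With radius \<epsilon> in position and \<epsilon> times \<open>maxnorm \<zeta>\<close>
  in covector, each pairing gains 1 over \<open>maxnorm \<zeta>\<close>, hence 1 over
  \<open>maxnorm (\<eta> *s \<zeta>)\<close> as \<open>cmod \<eta> \<le> 1\<close>. \<open>B\<close>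
  dominates \<open>A\<close> for \<open>p\<close>, \<open>2 * A\<close> for \<open>q\<close> at a
  moved covector, and the constant \<open>c\<close> of one pairing.\<close>

lemma star3_bound:
  fixes q p :: "complex ^ 'n \<Rightarrow> complex ^ 'n::finite \<Rightarrow> complex \<Rightarrow> complex"
  assumes \<epsilon>: "0 < \<epsilon>" "\<epsilon> \<le> 1/2" and \<eta>: "\<eta> \<noteq> 0" "cmod \<eta> \<le> 1" and A: "A > 0" and h: "h \<ge> 0"
    and \<zeta>: "maxnorm \<zeta> > 0" and C: "C1 \<ge> 0" "C2 \<ge> 0"
    and q: "\<And>v. maxnorm v \<le> \<epsilon> * maxnorm \<zeta> \<Longrightarrow> holo3 q z (\<zeta> + v) \<eta> \<and> cmod (q z (\<zeta> + v) \<eta>) \<le>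
      sym_bound C1 A h j (\<zeta> + v) \<eta>"
    and p: "\<And>u. maxnorm u \<le> \<epsilon> \<Longrightarrow> holo3 p (z + u) \<zeta> \<eta> \<and> cmod (p (z + u) \<zeta> \<eta>) \<le>
      sym_bound C2 A h i \<zeta> \<eta>"
    and B: "B = 2 * A + real CARD('n) * (exp 1)\<^sup>2 / \<epsilon>\<^sup>2"
  shows "cmod (star3 k q p z \<zeta> \<eta>) \<le>
    C1 * C2 * (fact k * fact j * fact i) * B ^ (k + j + i) * exp (3 * h * maxnorm \<zeta>) / maxnorm (\<eta> *s \<zeta>) ^ (k + j + i)"
proof -
  define m where "m = maxnorm \<zeta>"
  define E where "E = maxnorm (\<eta> *s \<zeta>)"
  have m: "m > 0" using \<zeta> by (simp add: m_def)
  have E: "E = cmod \<eta> * m" by (simp add: E_def m_def maxnorm_smult)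
  then have E0: "E > 0" "E \<le> m" using m \<eta> by (simp_all add: mult_le_cancel_right1)
  define N where "N = real CARD('n)"
  define c where "c = N * (exp 1)\<^sup>2 / \<epsilon>\<^sup>2"
  have c: "c \<ge> 0" by (simp add: c_def N_def)
  define Mq where "Mq = C1 * fact j * (2 * A) ^ j * exp (2 * h * m) / E ^ j"
  define Mp where "Mp = C2 * fact i * A ^ i * exp (h * m) / E ^ i"
  have M0: "Mq \<ge> 0" "Mp \<ge> 0" using C A E0 by (simp_all add: Mq_def Mp_def)
  have q': "cmod (q z (\<zeta> + v) \<eta>) \<le> Mq" if v: "maxnorm v \<le> \<epsilon> * m" for v
  proof -
    let ?m = "maxnorm (\<zeta> + v)"
    have "\<epsilon> * m \<le> m / 2" using \<epsilon> m by simp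
    \<comment> \<open>A covector moved by at most half its size stays between half and twice its
      size. The lower bound costs 2 to the power \<open>j\<close>, the upper one doubles
      \<open>h\<close>; with the share of \<open>p\<close> this gives \<open>3 * h\<close>.\<close>
    then have m': "m / 2 \<le> ?m" "?m \<le> 2 * m"
      using maxnorm_add[of \<zeta> v] maxnorm_diff_ge[of \<zeta> v] v m unfolding m_def by linarith+
    have "cmod (q z (\<zeta> + v) \<eta>) \<le> C1 * fact j * A ^ j * exp (h * ?m) / maxnorm (\<eta> *s (\<zeta> + v)) ^ j"
      using q v by (simp add: m_def)
    also have "\<dots> \<le> C1 * fact j * A ^ j * exp (2 * h * m) / (E / 2) ^ j"
    proof (intro frac_le mult_left_mono power_mono)
      show "exp (h * ?m) \<le> exp (2 * h * m)"
        using mult_left_mono[OF m'(2) h] by simp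
      show "E / 2 \<le> maxnorm (\<eta> *s (\<zeta> + v))"
        using mult_left_mono[OF m'(1), of "cmod \<eta>"] unfolding E maxnorm_smult by simp
    qed (use C A E0 in auto)
    also have "\<dots> = Mq" by (simp add: Mq_def power_divide power_mult_distrib)
    finally show ?thesis .
  qed
  have p': "cmod (p (z + u) \<zeta> \<eta>) \<le> Mp" if "maxnorm u \<le> \<epsilon>" for u
    using p[OF that] by (simp add: Mp_def m_def E_def)
  \<comment> \<open>Radii are divided by \<open>k\<close>; at order 0, where no derivative is taken,
    1 keeps them positive.\<close>
  define K where "K = (if k = 0 then 1 else real k)"
  have K: "K > 0" "real k / K \<le> 1" "K ^ k \<le> exp (real k) * fact k"
    using power_le_exp_fact[of k] by (auto simp: K_def)
  let ?F = "\<lambda>X. q z (\<zeta> + snd X) \<eta> * p (z + fst X) \<zeta> \<eta>"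
  have "cmod ((plap UNIV xdir cdir ^^ k) ?F (0, 0)) \<le> (N / ((\<epsilon> / K) * (\<epsilon> * m / K))) ^ k * (Mq * Mp)"
    unfolding N_def
  proof (rule plap_pow_bound)
    fix x y :: "complex ^ 'n"
    assume "maxnorm (x - 0) \<le> real k * (\<epsilon> / K)" "maxnorm (y - 0) \<le> real k * (\<epsilon> * m / K)"
    then have xy: "maxnorm x \<le> (real k / K) * \<epsilon>" "maxnorm y \<le> (real k / K) * (\<epsilon> * m)" by simp_all
    have "real k / K * \<epsilon> \<le> 1 * \<epsilon>" "real k / K * (\<epsilon> * m) \<le> 1 * (\<epsilon> * m)"
      by (intro mult_right_mono K(2); use \<epsilon> m in simp)+
    with xy have xy': "maxnorm x \<le> \<epsilon>" "maxnorm y \<le> \<epsilon> * m" by linarith+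
    have "holo (\<lambda>X. q z (\<zeta> + snd X) \<eta>) (x, y)"
      by (rule holo3_apply[of q z "\<zeta> + y" \<eta>]) (use q xy' in \<open>auto intro!: holo_intros simp: m_def\<close>)
    moreover have "holo (\<lambda>X. p (z + fst X) \<zeta> \<eta>) (x, y)"
      by (rule holo3_apply[of p "z + x" \<zeta> \<eta>]) (use p xy' in \<open>auto intro!: holo_intros simp: m_def\<close>)
    ultimately show "holo ?F (x, y) \<and> cmod (?F (x, y)) \<le> Mq * Mp"
      using q'[OF xy'(2)] p'[OF xy'(1)] M0 by (simp add: holo_mult norm_mult mult_mono)
  qed (use \<epsilon> m K in auto)
  also have "(N / ((\<epsilon> / K) * (\<epsilon> * m / K))) ^ k = (N / (\<epsilon>\<^sup>2 * m)) ^ k * (K ^ k)\<^sup>2"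
    by (simp add: power_divide power_mult_distrib power2_eq_square field_simps)
  also have "\<dots> \<le> (N / (\<epsilon>\<^sup>2 * m)) ^ k * (exp (real k) * fact k)\<^sup>2"
    using K m by (intro mult_left_mono power_mono) (auto simp: N_def)
  also have "\<dots> = (c / m) ^ k * (fact k)\<^sup>2"
    by (simp add: c_def power_divide power_mult_distrib exp_of_nat_mult[symmetric] power2_eq_square mult_ac)
  also have "\<dots> \<le> (c / E) ^ k * (fact k)\<^sup>2"
    using E0 c m by (intro mult_right_mono power_mono divide_left_mono) auto
  finally have "cmod ((plap UNIV xdir cdir ^^ k) ?F (0, 0)) \<le> (c / E) ^ k * (fact k)\<^sup>2 * (Mq * Mp)"
    using M0 by (simp add: mult_right_mono)
  \<comment> \<open>The square of \<open>fact k\<close> comes from subdividing two radii; the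
    factorial in \<open>ecoeff\<close> cancels one of the two.\<close>
  then have "cmod (star3 k q p z \<zeta> \<eta>) \<le> (c / E) ^ k * (fact k)\<^sup>2 * (Mq * Mp) / fact k"
    by (simp add: star3_def star_def ecoeff_def zero_prod_def norm_divide divide_right_mono)
  also have "\<dots> = C1 * C2 * (fact k * fact j * fact i) * (c ^ k * (2 * A) ^ j * A ^ i) * exp (3 * h * m) / E ^ (k + j + i)"
  proof -
    have "exp (3 * h * m) = exp (2 * h * m) * exp (h * m)" by (simp add: exp_add[symmetric] algebra_simps)
    then show ?thesis
      by (simp add: Mq_def Mp_def power_divide power_add power2_eq_square mult_ac)
  qed
  also have "\<dots> \<le> C1 * C2 * (fact k * fact j * fact i) * (B ^ k * B ^ j * B ^ i) * exp (3 * h * m) / E ^ (k + j + i)"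
    using C A c E0 B by (intro divide_right_mono mult_right_mono mult_left_mono mult_mono power_mono)
      (auto simp: c_def N_def)
  finally show ?thesis by (simp add: power_add m_def E_def)
qed

lemma fact_mult_le: "fact a * fact b \<le> (fact (a + b) :: real)"
proof -
  have "fact a * fact b \<le> (fact (a + b) :: nat)"
    by (intro dvd_imp_le fact_fact_dvd_fact) simp
  then have "real (fact a * fact b) \<le> real (fact (a + b))" by (rule of_nat_mono)
  then show ?thesis by simp
qed

lemma star_conv_bound:
  fixes F G :: "('n::finite) formal_symbol"
  assumes \<epsilon>: "0 < \<epsilon>" "\<epsilon> \<le> 1/2" and \<eta>: "\<eta> \<noteq> 0" "cmod \<eta> \<le> 1" and A: "A > 0" and h: "h \<ge> 0"
    and \<zeta>: "maxnorm \<zeta> > 0" and C: "C1 \<ge> 0" "C2 \<ge> 0"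
    and F: "\<And>j v. maxnorm v \<le> \<epsilon> * maxnorm \<zeta> \<Longrightarrow> holo3 (F j) z (\<zeta> + v) \<eta> \<and> cmod (F j z (\<zeta> + v) \<eta>) \<le>
      sym_bound C1 A h j (\<zeta> + v) \<eta>"
    and G: "\<And>i u. maxnorm u \<le> \<epsilon> \<Longrightarrow> holo3 (G i) (z + u) \<zeta> \<eta> \<and> cmod (G i (z + u) \<zeta> \<eta>) \<le>
      sym_bound C2 A h i \<zeta> \<eta>"
    and B: "B = 2 * A + real CARD('n) * (exp 1)\<^sup>2 / \<epsilon>\<^sup>2"
  shows "cmod (star_conv F G m z \<zeta> \<eta>) \<le>
    sym_bound (C1 * C2) (4 * B) (3 * h) m \<zeta> \<eta>"
proof -
  define R where "R = C1 * C2 * fact m * B ^ m * exp (3 * h * maxnorm \<zeta>) / maxnorm (\<eta> *s \<zeta>) ^ m"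
  have B0: "B \<ge> 0" using A by (simp add: B)
  have R0: "R \<ge> 0" using C B0 by (simp add: R_def maxnorm_nonneg)
  have 1: "cmod (star3 k (F j) (G (m - k - j)) z \<zeta> \<eta>) \<le> R" if kj: "k \<le> m" "j \<le> m - k" for k j
  proof -
    have "cmod (star3 k (F j) (G (m - k - j)) z \<zeta> \<eta>) \<le> C1 * C2 * (fact k * fact j * fact (m - k - j)) *
       B ^ (k + j + (m - k - j)) * exp (3 * h * maxnorm \<zeta>) / maxnorm (\<eta> *s \<zeta>) ^ (k + j + (m - k - j))"
      by (rule star3_bound[OF \<epsilon> \<eta> A h \<zeta> C F G B])
    also have "k + j + (m - k - j) = m" using kj by simp
    also have "C1 * C2 * (fact k * fact j * fact (m - k - j)) * B ^ m * exp (3 * h * maxnorm \<zeta>) / maxnorm (\<eta> *s \<zeta>) ^ m \<le> R"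
    proof -
      have "fact k * fact j * fact (m - k - j) \<le> fact (k + j) * (fact (m - k - j) :: real)"
        by (intro mult_right_mono fact_mult_le) simp
      also have "\<dots> \<le> fact (k + j + (m - k - j))" by (rule fact_mult_le)
      also have "k + j + (m - k - j) = m" using kj by simp
      finally show ?thesis
        unfolding R_def using C B0
        by (intro divide_right_mono mult_right_mono mult_left_mono) (auto simp: maxnorm_nonneg)
    qed
    finally show ?thesis .
  qed
  have "cmod (star_conv F G m z \<zeta> \<eta>) \<le> (\<Sum>k\<le>m. \<Sum>j\<le>m - k. R)"
    unfolding star_conv_def by (intro sum_norm_le 1) auto
  also have "\<dots> \<le> (\<Sum>k\<le>m. \<Sum>j\<le>m. R)"
    by (intro sum_mono sum_mono2) (use R0 in auto)
  also have "\<dots> = (real (Suc m))\<^sup>2 * R" by (simp add: power2_eq_square)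
  \<comment> \<open>The number of terms is at most the square of \<open>Suc m\<close>; since
    \<open>Suc m \<le> 2 ^ m\<close>, it is absorbed by a factor 4 per order.\<close>
  also have "\<dots> \<le> (2 ^ m)\<^sup>2 * R"
  proof (intro mult_right_mono power_mono R0)
    have "Suc m \<le> 2 ^ m" by (rule Suc_leI[OF less_exp])
    then have "real (Suc m) \<le> real (2 ^ m)" by (rule of_nat_mono)
    then show "real (Suc m) \<le> 2 ^ m" by simp
  qed simp
  also have "\<dots> = 4 ^ m * R" by (simp add: power_mult[symmetric] power_mult_distrib[symmetric] mult.commute[of m 2] power_mult)
  also have "\<dots> = sym_bound (C1 * C2) (4 * B) (3 * h) m \<zeta> \<eta>"
    by (simp add: R_def power_mult_distrib)
  finally show ?thesis .
qed

section \<open>Shrinking conic domains\<close>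

lemma thicken_mono: "\<rho>' \<le> \<rho> \<Longrightarrow> thicken \<Omega> \<rho>' \<subseteq> thicken \<Omega> \<rho>"
proof -
  assume "\<rho>' \<le> \<rho>"
  moreover have "\<rho>' * maxnorm \<zeta> \<le> \<rho> * maxnorm \<zeta>" for \<zeta> :: "complex ^ 'a"
    using \<open>\<rho>' \<le> \<rho>\<close> by (intro mult_right_mono maxnorm_nonneg)
  ultimately show ?thesis
    unfolding thicken_def by (intro closure_mono) (blast intro: order_trans)
qed

lemma symbol_domain_mono:
  "\<rho>' \<le> \<rho> \<Longrightarrow> d * (1 - \<rho>) \<le> d' * (1 - \<rho>') \<Longrightarrow> symbol_domain \<Omega> d' \<rho>' \<subseteq> symbol_domain \<Omega> d \<rho>"
  using thicken_mono[of \<rho>' \<rho> \<Omega>] unfolding symbol_domain_def cut_off_def by auto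

lemma symbol_domain_common:
  assumes "d1 > 0" "\<rho>1 \<in> {0<..<1}" "d2 > 0" "\<rho>2 \<in> {0<..<1}"
  obtains d \<rho> where "d > 0" "\<rho> \<in> {0<..<1}" "symbol_domain \<Omega> d \<rho> \<subseteq> symbol_domain \<Omega> d1 \<rho>1"
    "symbol_domain \<Omega> d \<rho> \<subseteq> symbol_domain \<Omega> d2 \<rho>2"
proof -
  define \<rho> where "\<rho> = min \<rho>1 \<rho>2"
  \<comment> \<open>Solved from the requirement that the cut-off \<open>d * (1 - \<rho>)\<close> be
    the larger of the two given ones.\<close>
  define d where "d = max (d1 * (1 - \<rho>1)) (d2 * (1 - \<rho>2)) / (1 - \<rho>)"
  have \<rho>: "0 < \<rho>" "\<rho> < 1" "\<rho> \<le> \<rho>1" "\<rho> \<le> \<rho>2"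
    using assms by (auto simp: \<rho>_def)
  have d: "d * (1 - \<rho>) = max (d1 * (1 - \<rho>1)) (d2 * (1 - \<rho>2))"
    using \<rho> by (simp add: d_def)
  have "max (d1 * (1 - \<rho>1)) (d2 * (1 - \<rho>2)) > 0"
    using assms by (simp add: less_max_iff_disj)
  then have "d > 0" using \<rho> by (simp add: d_def)
  then show thesis
    using \<rho> d by (intro that[of d \<rho>] symbol_domain_mono) auto
qed

text \<open>The perturbation is measured by \<zeta>, but thickening by a base covector
  \<open>b\<close> of \<open>\<Omega>\<close>. They compare by
  \<open>maxnorm \<zeta> \<le> 4 * maxnorm b\<close>, so \<rho>/8 of the first is at most \<rho>/2
  of the second, the half of \<rho> still available. The value of \<open>d\<close> makes the inner
  cut-off \<open>2 * d\<close>, which leaves room for \<open>v\<close>.\<close>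

lemma symbol_domain_interior:
  fixes \<Omega> :: "('n::finite) cotangent set"
  assumes d: "d > 0" and \<rho>: "0 < \<rho>" "\<rho> < 1"
    and z\<zeta>: "(z, \<zeta>) \<in> symbol_domain \<Omega> (2 * d / (1 - \<rho> / 2)) (\<rho> / 2)"
    and u: "maxnorm u \<le> \<rho> / 8" and v: "maxnorm v \<le> \<rho> / 8 * maxnorm \<zeta>"
  shows "(z + u, \<zeta> + v) \<in> symbol_domain \<Omega> d \<rho>" and "maxnorm \<zeta> > 0"
proof -
  have th: "(z, \<zeta>) \<in> thicken \<Omega> (\<rho> / 2)" and m: "2 * d \<le> maxnorm \<zeta>"
    using z\<zeta> \<rho> by (auto simp: symbol_domain_def cut_off_def)
  then show m0: "maxnorm \<zeta> > 0" using d by simp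
  have "\<rho> / 8 * maxnorm \<zeta> \<le> maxnorm \<zeta> / 2" using \<rho> m0 by simp
  then have "d \<le> maxnorm (\<zeta> + v)" using maxnorm_diff_ge[of \<zeta> v] v m by linarith
  moreover have "d * (1 - \<rho>) \<le> d" using d \<rho> by (simp add: mult_le_cancel_left1)
  ultimately have "d * (1 - \<rho>) \<le> maxnorm (\<zeta> + v)" by linarith
  moreover have "(z + u, \<zeta> + v) \<in> thicken \<Omega> \<rho>"
    unfolding thicken_def closure_approachable
  proof (intro allI impI)
    fix e :: real assume e: "e > 0"
    \<comment> \<open>\<open>thicken\<close> is a closure, so the point is only approximated; the
      second bound forces the approximating covector to have at least half the size of
      \<zeta>.\<close>
    define e' where "e' = min e (maxnorm \<zeta> / 2)"
    have "e' > 0" using e m0 by (simp add: e'_def)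
    then obtain y where y: "y \<in> {(z + z', \<zeta> + \<zeta>') |z \<zeta> z' \<zeta>'.
      (z, \<zeta>) \<in> \<Omega> \<and> maxnorm z' \<le> \<rho> / 2 \<and> maxnorm \<zeta>' \<le> \<rho> / 2 * maxnorm \<zeta>}" "dist y (z, \<zeta>) < e'"
      using th unfolding thicken_def closure_approachable by blast
    then obtain a b a' b' where ab: "(a, b) \<in> \<Omega>" "maxnorm a' \<le> \<rho> / 2" "maxnorm b' \<le> \<rho> / 2 * maxnorm b"
      and y': "y = (a + a', b + b')" by blast
    have "maxnorm \<zeta> \<le> maxnorm (b + b') + maxnorm (\<zeta> - (b + b'))"
      using maxnorm_add[of "b + b'" "\<zeta> - (b + b')"] by simp
    also have "maxnorm (\<zeta> - (b + b')) \<le> norm (\<zeta> - (b + b'))" by (rule maxnorm_le_norm)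
    also have "\<dots> = dist (snd y) (snd (z, \<zeta>))" by (simp add: y' dist_norm norm_minus_commute)
    also have "\<dots> \<le> dist y (z, \<zeta>)" by (rule dist_snd_le)
    also have "\<dots> \<le> maxnorm \<zeta> / 2" using y(2) by (simp add: e'_def)
    finally have "maxnorm \<zeta> \<le> 2 * maxnorm (b + b')" by simp
    also have "maxnorm (b + b') \<le> maxnorm b + maxnorm b'" by (rule maxnorm_add)
    also have "maxnorm b' \<le> 1 * maxnorm b"
      by (rule order_trans[OF ab(3)], intro mult_right_mono maxnorm_nonneg) (use \<rho> in simp)
    finally have mb: "maxnorm \<zeta> \<le> 4 * maxnorm b" by simp
    have "maxnorm (b' + v) \<le> maxnorm b' + maxnorm v" by (rule maxnorm_add)
    also have "\<dots> \<le> \<rho> / 2 * maxnorm b + \<rho> / 8 * (4 * maxnorm b)"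
      using v mult_left_mono[OF mb, of "\<rho> / 8"] \<rho> ab(3) by linarith
    finally have 2: "maxnorm (b' + v) \<le> \<rho> * maxnorm b" by simp
    have 1: "maxnorm (a' + u) \<le> \<rho>"
      using maxnorm_add[of a' u] ab(2) u \<rho> by linarith
    have "dist (a + (a' + u), b + (b' + v)) (z + u, \<zeta> + v) = dist y (z, \<zeta>)"
      by (simp add: y' dist_norm algebra_simps)
    then have "dist (a + (a' + u), b + (b' + v)) (z + u, \<zeta> + v) < e"
      using y(2) by (simp add: e'_def)
    then show "\<exists>y\<in>{(z + z', \<zeta> + \<zeta>') |z \<zeta> z' \<zeta>'.
      (z, \<zeta>) \<in> \<Omega> \<and> maxnorm z' \<le> \<rho> \<and> maxnorm \<zeta>' \<le> \<rho> * maxnorm \<zeta>}. dist y (z + u, \<zeta> + v) < e"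
      using ab(1) 1 2 by blast
  qed
  ultimately show "(z + u, \<zeta> + v) \<in> symbol_domain \<Omega> d \<rho>"
    by (simp add: symbol_domain_def cut_off_def)
qed

section \<open>Growth conditions on symbols\<close>

definition holo_sym_on :: "('n::finite) cotangent set \<Rightarrow> complex set \<Rightarrow> 'n formal_symbol \<Rightarrow> bool" where
  "holo_sym_on D S F \<longleftrightarrow> (\<forall>\<nu>. \<forall>(z, \<zeta>)\<in>D. \<forall>\<eta>\<in>S. holo3 (F \<nu>) z \<zeta> \<eta>)"

text \<open>\<open>A\<close> is quantified before \<open>Z\<close> and \<open>h\<close>, so
  constructions may change it only by amounts free of both. Applied to \<open>P\<close> or to
  \<open>psum P\<close>, this is the bound of either symbol class.\<close>

definition growth :: "('n::finite) cotangent set \<Rightarrow> complex set \<Rightarrow> 'n formal_symbol \<Rightarrow> bool" where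
  "growth D S F \<longleftrightarrow> (\<exists>A>0. \<forall>Z h. relatively_compact_in Z S \<and> h > 0 \<longrightarrow>
     (\<exists>C>0. \<forall>m. \<forall>(z, \<zeta>)\<in>D. \<forall>\<eta>\<in>Z.
        cmod (F m z \<zeta> \<eta>) \<le> sym_bound C A h m \<zeta> \<eta>))"

text \<open>Domains only ever become smaller. The conditions used are inherited by subsets, so
  finitely many of them can be met on one domain, which is the purpose of
  \<open>some_dom_conj\<close>.\<close>

definition some_dom :: "('n::finite) cotangent set \<Rightarrow> ('n cotangent set \<Rightarrow> bool) \<Rightarrow> bool" where
  "some_dom \<Omega> X \<longleftrightarrow> (\<exists>d>0. \<exists>\<rho>\<in>{0<..<1}. X (symbol_domain \<Omega> d \<rho>))"

lemma coeffs_holo_eq: "coeffs_holo \<Omega> S d \<rho> P \<longleftrightarrow> holo_sym_on (symbol_domain \<Omega> d \<rho>) S P"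
  unfolding coeffs_holo_iff holo_sym_on_def by blast

lemma N_cl_iff: "P \<in> N_cl \<Omega> S \<longleftrightarrow> some_dom \<Omega> (\<lambda>D. holo_sym_on D S P \<and> growth D S (psum P))"
  unfolding N_cl_def some_dom_def growth_def psum_def coeffs_holo_eq by simp

lemma S_cl_iff:
  "P \<in> S_cl \<Omega> S \<longleftrightarrow> some_dom \<Omega> (\<lambda>D. holo_sym_on D S P \<and> growth D S P) \<and> d_eta P \<in> N_cl \<Omega> S"
  unfolding S_cl_def some_dom_def growth_def coeffs_holo_eq by simp

lemma holo_sym_on_subset: "holo_sym_on D S F \<Longrightarrow> D' \<subseteq> D \<Longrightarrow> holo_sym_on D' S F"
  unfolding holo_sym_on_def by blast

lemma growth_subset: "growth D S F \<Longrightarrow> D' \<subseteq> D \<Longrightarrow> growth D' S F"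
  unfolding growth_def by (meson subset_iff)

lemma some_dom_mono: "some_dom \<Omega> X \<Longrightarrow> (\<And>D. X D \<Longrightarrow> Y D) \<Longrightarrow> some_dom \<Omega> Y"
  unfolding some_dom_def by blast

lemma some_dom_conj:
  assumes "some_dom \<Omega> X" "some_dom \<Omega> Y"
    and X: "\<And>D D'. X D \<Longrightarrow> D' \<subseteq> D \<Longrightarrow> X D'" and Y: "\<And>D D'. Y D \<Longrightarrow> D' \<subseteq> D \<Longrightarrow> Y D'"
  shows "some_dom \<Omega> (\<lambda>D. X D \<and> Y D)"
proof -
  obtain d1 \<rho>1 d2 \<rho>2 where 1: "d1 > 0" "\<rho>1 \<in> {0<..<1}" "X (symbol_domain \<Omega> d1 \<rho>1)"
    and 2: "d2 > 0" "\<rho>2 \<in> {0<..<1}" "Y (symbol_domain \<Omega> d2 \<rho>2)"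
    using assms(1,2) unfolding some_dom_def by blast
  obtain d \<rho> where "d > 0" "\<rho> \<in> {0<..<1}" "symbol_domain \<Omega> d \<rho> \<subseteq> symbol_domain \<Omega> d1 \<rho>1"
    "symbol_domain \<Omega> d \<rho> \<subseteq> symbol_domain \<Omega> d2 \<rho>2"
    using symbol_domain_common[OF 1(1,2) 2(1,2)] by blast
  then show ?thesis
    unfolding some_dom_def using X[OF 1(3)] Y[OF 2(3)] by blast
qed

lemma relatively_compact_subset: "relatively_compact_in Z S \<Longrightarrow> Z \<subseteq> S"
  unfolding relatively_compact_in_def using closure_subset by blast

lemma growth_cong:
  assumes "growth D S F" "\<And>m z \<zeta> \<eta>. (z, \<zeta>) \<in> D \<Longrightarrow> \<eta> \<in> S \<Longrightarrow> G m z \<zeta> \<eta> = F m z \<zeta> \<eta>"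
  shows "growth D S G"
proof -
  obtain A where A: "A > 0" "\<And>Z h. relatively_compact_in Z S \<Longrightarrow> h > 0 \<Longrightarrow>
     (\<exists>C>0. \<forall>m. \<forall>(z, \<zeta>)\<in>D. \<forall>\<eta>\<in>Z.
        cmod (F m z \<zeta> \<eta>) \<le> sym_bound C A h m \<zeta> \<eta>)"
    using assms(1) unfolding growth_def by blast
  show ?thesis
    unfolding growth_def
  proof (rule exI[of _ A], intro conjI allI impI A(1))
    fix Z h assume "relatively_compact_in Z S \<and> (h :: real) > 0"
    then have "Z \<subseteq> S" and "\<exists>C>0. \<forall>m. \<forall>(z, \<zeta>)\<in>D. \<forall>\<eta>\<in>Z.
        cmod (F m z \<zeta> \<eta>) \<le> sym_bound C A h m \<zeta> \<eta>"
      using relatively_compact_subset A(2) by blast+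
    then obtain C where C: "C > 0" "\<And>m z \<zeta> \<eta>. (z, \<zeta>) \<in> D \<Longrightarrow> \<eta> \<in> Z \<Longrightarrow>
        cmod (F m z \<zeta> \<eta>) \<le> sym_bound C A h m \<zeta> \<eta>"
      by fast
    show "\<exists>C>0. \<forall>m. \<forall>(z, \<zeta>)\<in>D. \<forall>\<eta>\<in>Z.
        cmod (G m z \<zeta> \<eta>) \<le> sym_bound C A h m \<zeta> \<eta>"
      using C \<open>Z \<subseteq> S\<close> by (intro exI[of _ C] conjI allI ballI) (auto simp: assms(2) subset_iff)
  qed
qed

text \<open>The bound increases with \<open>A\<close>, so the larger of the two constants serves
  both series and can still be fixed before \<open>Z\<close> and \<open>h\<close>.\<close>

lemma growth_two:
  fixes F G :: "('n::finite) formal_symbol"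
  assumes "growth D1 S F" "growth D2 S G"
  obtains A where "A > 0" "\<And>Z h. relatively_compact_in Z S \<Longrightarrow> h > 0 \<Longrightarrow>
    \<exists>C1>0. \<exists>C2>0. (\<forall>m z \<zeta> \<eta>. (z, \<zeta>) \<in> D1 \<longrightarrow> \<eta> \<in> Z \<longrightarrow>
        cmod (F m z \<zeta> \<eta>) \<le> sym_bound C1 A h m \<zeta> \<eta>) \<and>
     (\<forall>m z \<zeta> \<eta>. (z, \<zeta>) \<in> D2 \<longrightarrow> \<eta> \<in> Z \<longrightarrow>
        cmod (G m z \<zeta> \<eta>) \<le> sym_bound C2 A h m \<zeta> \<eta>)"
proof -
  have weaken: "\<exists>C>0. \<forall>m z \<zeta> \<eta>. (z, \<zeta>) \<in> D \<longrightarrow> \<eta> \<in> Z \<longrightarrow>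
        cmod (F m z \<zeta> \<eta>) \<le> sym_bound C A' h m \<zeta> \<eta>"
    if bd: "\<exists>C>0. \<forall>m. \<forall>(z, \<zeta>)\<in>D. \<forall>\<eta>\<in>Z.
        cmod (F m z \<zeta> \<eta>) \<le> sym_bound C A h m \<zeta> \<eta>" and A: "0 < A" "A \<le> A'"
    for D Z A A' h and F :: "'n formal_symbol"
  proof -
    obtain C where C: "C > 0" "\<And>m z \<zeta> \<eta>. (z, \<zeta>) \<in> D \<Longrightarrow> \<eta> \<in> Z \<Longrightarrow>
        cmod (F m z \<zeta> \<eta>) \<le> sym_bound C A h m \<zeta> \<eta>"
      using bd by fast
    have le: "sym_bound C A h m \<zeta> \<eta> \<le>
      sym_bound C A' h m \<zeta> \<eta>" for m \<zeta> \<eta>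
      using C(1) A by (intro divide_right_mono mult_right_mono mult_left_mono power_mono) (auto simp: maxnorm_nonneg)
    show ?thesis using C(1) order_trans[OF C(2) le] by blast
  qed
  obtain A1 where A1: "A1 > 0" "\<And>Z h. relatively_compact_in Z S \<Longrightarrow> h > 0 \<Longrightarrow>
     (\<exists>C>0. \<forall>m. \<forall>(z, \<zeta>)\<in>D1. \<forall>\<eta>\<in>Z.
        cmod (F m z \<zeta> \<eta>) \<le> sym_bound C A1 h m \<zeta> \<eta>)"
    using assms(1) unfolding growth_def by blast
  obtain A2 where A2: "A2 > 0" "\<And>Z h. relatively_compact_in Z S \<Longrightarrow> h > 0 \<Longrightarrow>
     (\<exists>C>0. \<forall>m. \<forall>(z, \<zeta>)\<in>D2. \<forall>\<eta>\<in>Z.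
        cmod (G m z \<zeta> \<eta>) \<le> sym_bound C A2 h m \<zeta> \<eta>)"
    using assms(2) unfolding growth_def by blast
  show thesis
  proof (rule that[of "max A1 A2"])
    show "max A1 A2 > 0" using A1 by simp
    fix Z h assume Zh: "relatively_compact_in Z S" "(h :: real) > 0"
    show "\<exists>C1>0. \<exists>C2>0. (\<forall>m z \<zeta> \<eta>. (z, \<zeta>) \<in> D1 \<longrightarrow> \<eta> \<in> Z \<longrightarrow>
        cmod (F m z \<zeta> \<eta>) \<le> sym_bound C1 (max A1 A2) h m \<zeta> \<eta>) \<and>
     (\<forall>m z \<zeta> \<eta>. (z, \<zeta>) \<in> D2 \<longrightarrow> \<eta> \<in> Z \<longrightarrow>
        cmod (G m z \<zeta> \<eta>) \<le> sym_bound C2 (max A1 A2) h m \<zeta> \<eta>)"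
      using weaken[where D=D1 and Z=Z and F=F and A=A1 and A'="max A1 A2" and h=h, OF A1(2)[OF Zh] A1(1)]
        weaken[where D=D2 and Z=Z and F=G and A=A2 and A'="max A1 A2" and h=h, OF A2(2)[OF Zh] A2(1)]
      by auto
  qed
qed

lemma growth_add:
  assumes "growth D S F" "growth D S G"
  shows "growth D S (\<lambda>m z \<zeta> \<eta>. F m z \<zeta> \<eta> + G m z \<zeta> \<eta>)"
proof -
  obtain A where A: "A > 0" "\<And>Z h. relatively_compact_in Z S \<Longrightarrow> h > 0 \<Longrightarrow>
    \<exists>C1>0. \<exists>C2>0. (\<forall>m z \<zeta> \<eta>. (z, \<zeta>) \<in> D \<longrightarrow> \<eta> \<in> Z \<longrightarrow>
        cmod (F m z \<zeta> \<eta>) \<le> sym_bound C1 A h m \<zeta> \<eta>) \<and>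
     (\<forall>m z \<zeta> \<eta>. (z, \<zeta>) \<in> D \<longrightarrow> \<eta> \<in> Z \<longrightarrow>
        cmod (G m z \<zeta> \<eta>) \<le> sym_bound C2 A h m \<zeta> \<eta>)"
    using growth_two[OF assms] by blast
  show ?thesis
    unfolding growth_def
  proof (rule exI[of _ A], intro conjI allI impI A(1), elim conjE)
    fix Z h assume Zh: "relatively_compact_in Z S" "(h :: real) > 0"
    obtain C1 C2 where C: "C1 > 0" "C2 > 0"
      and F: "\<And>m z \<zeta> \<eta>. (z, \<zeta>) \<in> D \<Longrightarrow> \<eta> \<in> Z \<Longrightarrow>
        cmod (F m z \<zeta> \<eta>) \<le> sym_bound C1 A h m \<zeta> \<eta>"
      and G: "\<And>m z \<zeta> \<eta>. (z, \<zeta>) \<in> D \<Longrightarrow> \<eta> \<in> Z \<Longrightarrow>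
        cmod (G m z \<zeta> \<eta>) \<le> sym_bound C2 A h m \<zeta> \<eta>"
      using A(2)[OF Zh] by blast
    have "cmod (F m z \<zeta> \<eta> + G m z \<zeta> \<eta>) \<le> sym_bound (C1 + C2) A h m \<zeta> \<eta>"
      if "(z, \<zeta>) \<in> D" "\<eta> \<in> Z" for m z \<zeta> \<eta>
      using norm_triangle_le[OF add_mono[OF F[OF that, of m] G[OF that, of m]]]
      by (simp add: distrib_right add_divide_distrib)
    then show "\<exists>C>0. \<forall>m. \<forall>(z, \<zeta>)\<in>D. \<forall>\<eta>\<in>Z. cmod (F m z \<zeta> \<eta> + G m z \<zeta> \<eta>)
        \<le> sym_bound C A h m \<zeta> \<eta>"
      using C by (intro exI[of _ "C1 + C2"]) auto
  qed
qed

lemma growth_star_conv: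
  fixes F G :: "('n::finite) formal_symbol"
  assumes S: "\<And>\<eta>. \<eta> \<in> S \<Longrightarrow> \<eta> \<noteq> 0 \<and> cmod \<eta> \<le> 1"
    and F: "some_dom \<Omega> (\<lambda>D. holo_sym_on D S F \<and> growth D S F)" and G: "some_dom \<Omega> (\<lambda>D. holo_sym_on D S G \<and> growth D S G)"
  shows "some_dom \<Omega> (\<lambda>D. growth D S (star_conv F G))"
proof -
  have "some_dom \<Omega> (\<lambda>D. (holo_sym_on D S F \<and> growth D S F) \<and> (holo_sym_on D S G \<and> growth D S G))"
    by (rule some_dom_conj[OF F G]) (auto intro: holo_sym_on_subset growth_subset)
  then obtain d \<rho> where d: "d > 0" and \<rho>: "0 < \<rho>" "\<rho> < 1"
    and F: "holo_sym_on (symbol_domain \<Omega> d \<rho>) S F" "growth (symbol_domain \<Omega> d \<rho>) S F"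
    and G: "holo_sym_on (symbol_domain \<Omega> d \<rho>) S G" "growth (symbol_domain \<Omega> d \<rho>) S G"
    unfolding some_dom_def by auto
  let ?D = "symbol_domain \<Omega> d \<rho>"
  \<comment> \<open>The inner domain of \<open>symbol_domain_interior\<close>: moving by the radii
    of the estimate stays inside \<open>?D\<close>.\<close>
  let ?d = "2 * d / (1 - \<rho> / 2)" and ?\<rho> = "\<rho> / 2"
  obtain A where A: "A > 0" "\<And>Z h. relatively_compact_in Z S \<Longrightarrow> h > 0 \<Longrightarrow>
    \<exists>C1>0. \<exists>C2>0. (\<forall>m z \<zeta> \<eta>. (z, \<zeta>) \<in> ?D \<longrightarrow> \<eta> \<in> Z \<longrightarrow>
        cmod (F m z \<zeta> \<eta>) \<le> sym_bound C1 A h m \<zeta> \<eta>) \<and>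
     (\<forall>m z \<zeta> \<eta>. (z, \<zeta>) \<in> ?D \<longrightarrow> \<eta> \<in> Z \<longrightarrow>
        cmod (G m z \<zeta> \<eta>) \<le> sym_bound C2 A h m \<zeta> \<eta>)"
    using growth_two[OF F(2) G(2)] by blast
  \<comment> \<open>Built from \<open>A\<close>, the dimension and \<rho> alone, hence available
    before \<open>Z\<close> and \<open>h\<close>.\<close>
  define B where "B = 2 * A + real CARD('n) * (exp 1)\<^sup>2 / (\<rho> / 8)\<^sup>2"
  have "B > 0" unfolding B_def using A(1) by (simp add: add_pos_nonneg)
  have "growth (symbol_domain \<Omega> ?d ?\<rho>) S (star_conv F G)"
    unfolding growth_def
  proof (rule exI[of _ "4 * B"], intro conjI allI impI, goal_cases)
    case 1
    show ?case using \<open>B > 0\<close> by simp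
  next
    case (2 Z h)
    \<comment> \<open>\<open>star_conv_bound\<close> triples the exponential rate, so the factors
      are estimated with a third of \<open>h\<close>.\<close>
    then have Zh: "relatively_compact_in Z S" "h / 3 > 0" by auto
    then have ZS: "Z \<subseteq> S" by (intro relatively_compact_subset)
    obtain C1 C2 where C: "C1 > 0" "C2 > 0"
      and bF: "\<And>m z \<zeta> \<eta>. (z, \<zeta>) \<in> ?D \<Longrightarrow> \<eta> \<in> Z \<Longrightarrow>
        cmod (F m z \<zeta> \<eta>) \<le> sym_bound C1 A (h / 3) m \<zeta> \<eta>"
      and bG: "\<And>m z \<zeta> \<eta>. (z, \<zeta>) \<in> ?D \<Longrightarrow> \<eta> \<in> Z \<Longrightarrow>
        cmod (G m z \<zeta> \<eta>) \<le> sym_bound C2 A (h / 3) m \<zeta> \<eta>"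
      using A(2)[OF Zh] by blast
    have "cmod (star_conv F G m z \<zeta> \<eta>) \<le> sym_bound (C1 * C2) (4 * B) h m \<zeta> \<eta>"
      if z\<zeta>: "(z, \<zeta>) \<in> symbol_domain \<Omega> ?d ?\<rho>" and \<eta>: "\<eta> \<in> Z" for m z \<zeta> \<eta>
    proof -
      note int = symbol_domain_interior[OF d \<rho> z\<zeta>]
      have \<zeta>0: "maxnorm \<zeta> > 0" using int(2)[of 0 0] \<rho> by (simp add: maxnorm_nonneg)
      have "cmod (star_conv F G m z \<zeta> \<eta>) \<le>
        sym_bound (C1 * C2) (4 * B) (3 * (h / 3)) m \<zeta> \<eta>"
      proof (rule star_conv_bound[where \<epsilon>="\<rho> / 8" and A=A])
        fix j v assume v: "maxnorm (v :: complex ^ 'n) \<le> \<rho> / 8 * maxnorm \<zeta>"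
        have "(z, \<zeta> + v) \<in> ?D" using int(1)[of 0 v] v \<rho> by simp
        then show "holo3 (F j) z (\<zeta> + v) \<eta> \<and> cmod (F j z (\<zeta> + v) \<eta>) \<le>
          sym_bound C1 A (h / 3) j (\<zeta> + v) \<eta>"
          using bF F(1) \<eta> ZS unfolding holo_sym_on_def by blast
      next
        fix i u assume u: "maxnorm (u :: complex ^ 'n) \<le> \<rho> / 8"
        have "(z + u, \<zeta>) \<in> ?D" using int(1)[of u 0] u \<rho> \<zeta>0 by simp
        then show "holo3 (G i) (z + u) \<zeta> \<eta> \<and> cmod (G i (z + u) \<zeta> \<eta>) \<le>
          sym_bound C2 A (h / 3) i \<zeta> \<eta>"
          using bG G(1) \<eta> ZS unfolding holo_sym_on_def by blast
      qed (use \<rho> S ZS \<eta> A(1) Zh(2) C \<zeta>0 in \<open>auto simp: B_def\<close>)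
      then show ?thesis by simp
    qed
    then show ?case using C by (intro exI[of _ "C1 * C2"]) auto
  qed
  moreover have "?d > 0" "?\<rho> \<in> {0<..<1}" using d \<rho> by auto
  ultimately show ?thesis unfolding some_dom_def by blast
qed

lemma holo_sym_on_at: "holo_sym_on D S F \<Longrightarrow> (z, \<zeta>) \<in> D \<Longrightarrow> \<eta> \<in> S \<Longrightarrow> holo3 (F \<nu>) z \<zeta> \<eta>"
  unfolding holo_sym_on_def by blast

lemma holo_sym_on_psum: "holo_sym_on D S F \<Longrightarrow> holo_sym_on D S (psum F)"
  unfolding holo_sym_on_def[of D S "psum F"] by (auto intro!: holo3_psum dest: holo_sym_on_at)

lemma holo_sym_on_d_eta: "holo_sym_on D S F \<Longrightarrow> holo_sym_on D S (d_eta F)"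
  unfolding holo_sym_on_def[of D S "d_eta F"] d_eta_eta_deriv by (auto intro!: holo3_eta_deriv dest: holo_sym_on_at)

lemma symbol_comp_eq_star_conv:
  assumes "holo_sym_on D S Q" "holo_sym_on D S P" "(z, \<zeta>) \<in> D" "\<eta> \<in> S"
  shows "holo3 ((Q \<circ>\<^sub>t P) \<nu>) z \<zeta> \<eta>" and "(Q \<circ>\<^sub>t P) \<nu> z \<zeta> \<eta> = star_conv Q P \<nu> z \<zeta> \<eta>"
    and "d_eta (Q \<circ>\<^sub>t P) \<nu> z \<zeta> \<eta> = star_conv (d_eta Q) P \<nu> z \<zeta> \<eta> + star_conv Q (d_eta P) \<nu> z \<zeta> \<eta>"
proof -
  have Q: "holo3 (Q \<nu>) z \<zeta> \<eta>" and P: "holo3 (P \<nu>) z \<zeta> \<eta>" for \<nu>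
    using assms unfolding holo_sym_on_def by blast+
  note ev = symbol_comp_eq_star_conv_ev[where Q=Q and P=P and \<nu>=\<nu>, OF Q P]
  have "\<forall>\<^sub>F x in nhds (z, \<zeta>, \<eta>). (\<lambda>(z, \<zeta>, \<eta>). star_conv Q P \<nu> z \<zeta> \<eta>) x = (\<lambda>(z, \<zeta>, \<eta>). (Q \<circ>\<^sub>t P) \<nu> z \<zeta> \<eta>) x"
    using ev by (rule eventually_mono) simp
  then show "holo3 ((Q \<circ>\<^sub>t P) \<nu>) z \<zeta> \<eta>"
    by (rule holo_cong_ev) (rule holo3_star_conv[where F=Q and G=P, OF Q P])
  show "(Q \<circ>\<^sub>t P) \<nu> z \<zeta> \<eta> = star_conv Q P \<nu> z \<zeta> \<eta>"
    using eventually_nhds_x_imp_x[OF ev] by simp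
  have "d_eta (Q \<circ>\<^sub>t P) \<nu> z \<zeta> \<eta> = eta_deriv (star_conv Q P \<nu>) z \<zeta> \<eta>"
    unfolding d_eta_eta_deriv eta_deriv_eq_dir_deriv by (rule dir_deriv_cong[OF ev])
  also have "\<dots> = star_conv (\<lambda>\<nu>. eta_deriv (Q \<nu>)) P \<nu> z \<zeta> \<eta> + star_conv Q (\<lambda>\<nu>. eta_deriv (P \<nu>)) \<nu> z \<zeta> \<eta>"
    by (rule eta_deriv_star_conv[where F=Q and G=P, OF Q P])
  finally show "d_eta (Q \<circ>\<^sub>t P) \<nu> z \<zeta> \<eta> = star_conv (d_eta Q) P \<nu> z \<zeta> \<eta> + star_conv Q (d_eta P) \<nu> z \<zeta> \<eta>"
    by (simp flip: d_eta_eta_deriv)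
qed

lemma holo_sym_on_symbol_comp: "holo_sym_on D S Q \<Longrightarrow> holo_sym_on D S P \<Longrightarrow> holo_sym_on D S (Q \<circ>\<^sub>t P)"
  using symbol_comp_eq_star_conv(1) unfolding holo_sym_on_def[of D S "Q \<circ>\<^sub>t P"] by fast

context
  fixes \<Omega> :: "('n::finite) cotangent set" and S :: "complex set"
  assumes S: "\<And>\<eta>. \<eta> \<in> S \<Longrightarrow> \<eta> \<noteq> 0 \<and> cmod \<eta> \<le> 1"
begin

text \<open>The partial sums of the null factor enter \<open>growth_star_conv\<close> as an ordinary
  symbol. Holomorphy of both factors is kept in the conclusion, since compositions are identified
  with \<open>star_conv\<close> under it.\<close>

lemma growth_psum_star_conv_right:
  assumes F: "some_dom \<Omega> (\<lambda>D. holo_sym_on D S F \<and> growth D S F)"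
    and G: "some_dom \<Omega> (\<lambda>D. holo_sym_on D S G \<and> growth D S (psum G))"
  shows "some_dom \<Omega> (\<lambda>D. holo_sym_on D S F \<and> holo_sym_on D S G \<and> growth D S (psum (star_conv F G)))"
proof -
  have "some_dom \<Omega> (\<lambda>D. growth D S (star_conv F (psum G)))"
    by (rule growth_star_conv[OF S F some_dom_mono[OF G]]) (auto intro: holo_sym_on_psum)
  moreover have "some_dom \<Omega> (\<lambda>D. (holo_sym_on D S F \<and> growth D S F) \<and> holo_sym_on D S G \<and> growth D S (psum G))"
    by (rule some_dom_conj[OF F G]) (auto intro: holo_sym_on_subset growth_subset)
  ultimately have "some_dom \<Omega> (\<lambda>D. growth D S (star_conv F (psum G)) \<and> (holo_sym_on D S F \<and> growth D S F) \<and> holo_sym_on D S G \<and> growth D S (psum G))"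
    by (rule some_dom_conj) (auto intro: holo_sym_on_subset growth_subset)
  then show ?thesis
  proof (rule some_dom_mono, elim conjE, intro conjI)
    fix D assume h: "holo_sym_on D S F" "holo_sym_on D S G" and g: "growth D S (star_conv F (psum G))"
    show "growth D S (psum (star_conv F G))"
      by (rule growth_cong[OF g]) (rule psum_star_conv(1)[OF holo_sym_on_at[OF h(1)] holo_sym_on_at[OF h(2)]])
  qed
qed

lemma growth_psum_star_conv_left:
  assumes F: "some_dom \<Omega> (\<lambda>D. holo_sym_on D S F \<and> growth D S (psum F))"
    and G: "some_dom \<Omega> (\<lambda>D. holo_sym_on D S G \<and> growth D S G)"
  shows "some_dom \<Omega> (\<lambda>D. holo_sym_on D S F \<and> holo_sym_on D S G \<and> growth D S (psum (star_conv F G)))"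
proof -
  have "some_dom \<Omega> (\<lambda>D. growth D S (star_conv (psum F) G))"
    by (rule growth_star_conv[OF S some_dom_mono[OF F] G]) (auto intro: holo_sym_on_psum)
  moreover have "some_dom \<Omega> (\<lambda>D. (holo_sym_on D S F \<and> growth D S (psum F)) \<and> holo_sym_on D S G \<and> growth D S G)"
    by (rule some_dom_conj[OF F G]) (auto intro: holo_sym_on_subset growth_subset)
  ultimately have "some_dom \<Omega> (\<lambda>D. growth D S (star_conv (psum F) G) \<and> (holo_sym_on D S F \<and> growth D S (psum F)) \<and> holo_sym_on D S G \<and> growth D S G)"
    by (rule some_dom_conj) (auto intro: holo_sym_on_subset growth_subset)
  then show ?thesis
  proof (rule some_dom_mono, elim conjE, intro conjI)
    fix D assume h: "holo_sym_on D S F" "holo_sym_on D S G" and g: "growth D S (star_conv (psum F) G)"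
    show "growth D S (psum (star_conv F G))"
      by (rule growth_cong[OF g]) (rule psum_star_conv(2)[OF holo_sym_on_at[OF h(1)] holo_sym_on_at[OF h(2)]])
  qed
qed

lemma symbol_comp_in_N_cl:
  assumes c: "some_dom \<Omega> (\<lambda>D. holo_sym_on D S Q \<and> holo_sym_on D S P \<and> growth D S (psum (star_conv Q P)))"
  shows "Q \<circ>\<^sub>t P \<in> N_cl \<Omega> S"
  unfolding N_cl_iff using c
proof (rule some_dom_mono, elim conjE, intro conjI)
  fix D assume Q: "holo_sym_on D S Q" and P: "holo_sym_on D S P" and g: "growth D S (psum (star_conv Q P))"
  show "holo_sym_on D S (Q \<circ>\<^sub>t P)" using Q P by (rule holo_sym_on_symbol_comp)
  show "growth D S (psum (Q \<circ>\<^sub>t P))"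
    by (rule growth_cong[OF g]) (simp add: psum_def symbol_comp_eq_star_conv(2)[OF Q P])
qed

text \<open>By the product rule the \<eta>-derivative is a sum of two compositions, each of a null
  series with an ordinary one, so the two one-sided results make it null.\<close>

lemma symbol_comp_in_S_cl:
  assumes P: "P \<in> S_cl \<Omega> S" and Q: "Q \<in> S_cl \<Omega> S"
  shows "Q \<circ>\<^sub>t P \<in> S_cl \<Omega> S"
proof -
  have P': "some_dom \<Omega> (\<lambda>D. holo_sym_on D S P \<and> growth D S P)"
    and dP: "some_dom \<Omega> (\<lambda>D. holo_sym_on D S (d_eta P) \<and> growth D S (psum (d_eta P)))"
    and Q': "some_dom \<Omega> (\<lambda>D. holo_sym_on D S Q \<and> growth D S Q)"
    and dQ: "some_dom \<Omega> (\<lambda>D. holo_sym_on D S (d_eta Q) \<and> growth D S (psum (d_eta Q)))"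
    using P Q unfolding S_cl_iff N_cl_iff by auto
  have QP: "some_dom \<Omega> (\<lambda>D. (holo_sym_on D S Q \<and> growth D S Q) \<and> holo_sym_on D S P \<and> growth D S P)"
    by (rule some_dom_conj[OF Q' P']) (auto intro: holo_sym_on_subset growth_subset)
  have "some_dom \<Omega> (\<lambda>D. growth D S (star_conv Q P) \<and> (holo_sym_on D S Q \<and> growth D S Q) \<and> holo_sym_on D S P \<and> growth D S P)"
    by (rule some_dom_conj[OF growth_star_conv[OF S Q' P'] QP]) (auto intro: holo_sym_on_subset growth_subset)
  then have 1: "some_dom \<Omega> (\<lambda>D. holo_sym_on D S (Q \<circ>\<^sub>t P) \<and> growth D S (Q \<circ>\<^sub>t P))"
  proof (rule some_dom_mono, elim conjE, intro conjI)
    fix D assume h: "holo_sym_on D S Q" "holo_sym_on D S P" and g: "growth D S (star_conv Q P)"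
    show "holo_sym_on D S (Q \<circ>\<^sub>t P)" using h by (rule holo_sym_on_symbol_comp)
    show "growth D S (Q \<circ>\<^sub>t P)"
      by (rule growth_cong[OF g]) (rule symbol_comp_eq_star_conv(2)[OF h])
  qed
  have "some_dom \<Omega> (\<lambda>D. (holo_sym_on D S (d_eta Q) \<and> holo_sym_on D S P \<and> growth D S (psum (star_conv (d_eta Q) P))) \<and>
      (holo_sym_on D S Q \<and> holo_sym_on D S (d_eta P) \<and> growth D S (psum (star_conv Q (d_eta P)))))"
    by (rule some_dom_conj[OF growth_psum_star_conv_left[OF dQ P'] growth_psum_star_conv_right[OF Q' dP]])
      (auto intro: holo_sym_on_subset growth_subset)
  then have "d_eta (Q \<circ>\<^sub>t P) \<in> N_cl \<Omega> S"
    unfolding N_cl_iff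
  proof (rule some_dom_mono, elim conjE, intro conjI)
    fix D assume h: "holo_sym_on D S Q" "holo_sym_on D S P"
      and g: "growth D S (psum (star_conv (d_eta Q) P))" "growth D S (psum (star_conv Q (d_eta P)))"
    show "holo_sym_on D S (d_eta (Q \<circ>\<^sub>t P))" using h by (intro holo_sym_on_d_eta holo_sym_on_symbol_comp)
    show "growth D S (psum (d_eta (Q \<circ>\<^sub>t P)))"
      by (rule growth_cong[OF growth_add[OF g]])
        (simp add: psum_def symbol_comp_eq_star_conv(3)[OF h] sum.distrib)
  qed
  with 1 show ?thesis unfolding S_cl_iff by simp
qed

end

theorem theorem6p16:
  fixes \<Omega> :: "('n::finite) cotangent set" and r \<theta> :: real
  assumes "open \<Omega>" and "fiber_conic \<Omega>" and "conically_compact_in \<Omega> UNIV"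
    and "r \<in> {0<..<1/2}" and "\<theta> \<in> {0<..<1/2}"
  defines "S \<equiv> sector r \<theta>"
  shows
    "(\<forall>P \<in> S_cl \<Omega> S. \<forall>Q \<in> S_cl \<Omega> S.
        Q \<circ>\<^sub>t P \<in> S_cl \<Omega> S \<and>
        (P \<in> N_cl \<Omega> S \<or> Q \<in> N_cl \<Omega> S \<longrightarrow> Q \<circ>\<^sub>t P \<in> N_cl \<Omega> S))
   \<and> (\<forall>P \<in> S_cl \<Omega> S. \<forall>Q \<in> S_cl \<Omega> S. \<forall>R \<in> S_cl \<Omega> S.
        \<forall>d>0. \<forall>\<rho>\<in>{0<..<1}.
          coeffs_holo \<Omega> S d \<rho> P \<and> coeffs_holo \<Omega> S d \<rho> Q \<and> coeffs_holo \<Omega> S d \<rho> R \<longrightarrow>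
          (\<forall>\<nu>. \<forall>(z, \<zeta>) \<in> symbol_domain \<Omega> d \<rho>. \<forall>\<eta>\<in>S.
             (R \<circ>\<^sub>t (Q \<circ>\<^sub>t P)) \<nu> z \<zeta> \<eta> = ((R \<circ>\<^sub>t Q) \<circ>\<^sub>t P) \<nu> z \<zeta> \<eta>))
   \<and> (\<forall>\<Phi> W Z J. coord_transformation \<Phi> W Z \<and> fst ` closure \<Omega> \<subseteq> Z \<and> is_J_star J \<Phi> W Z \<longrightarrow>
        (\<forall>P \<in> S_cl \<Omega> S. \<forall>Q \<in> S_cl \<Omega> S.
         \<forall>d>0. \<forall>\<rho>\<in>{0<..<1}.
          coeffs_holo \<Omega> S d \<rho> P \<and> coeffs_holo \<Omega> S d \<rho> Q \<longrightarrow>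
          (\<forall>\<nu> w \<mu>. \<forall>\<eta>\<in>S. w \<in> W \<and> cotangent_map \<Phi> J (w, \<mu>) \<in> symbol_domain \<Omega> d \<rho> \<longrightarrow>
             (pullback \<Phi> J Q \<circ>\<^sub>t pullback \<Phi> J P) \<nu> w \<mu> \<eta> = pullback \<Phi> J (Q \<circ>\<^sub>t P) \<nu> w \<mu> \<eta>)))"
proof (intro conjI)
  \<comment> \<open>All that the estimates use of the sector: the first part keeps denominators
    positive, the second lets \<open>maxnorm \<zeta>\<close> be replaced by
    \<open>maxnorm (\<eta> *s \<zeta>)\<close>.\<close>
  have S: "\<eta> \<noteq> 0 \<and> cmod \<eta> \<le> 1" if "\<eta> \<in> S" for \<eta>
    using that assms(4) by (auto simp: S_def sector_def)
  show "\<forall>P \<in> S_cl \<Omega> S. \<forall>Q \<in> S_cl \<Omega> S.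
        Q \<circ>\<^sub>t P \<in> S_cl \<Omega> S \<and>
        (P \<in> N_cl \<Omega> S \<or> Q \<in> N_cl \<Omega> S \<longrightarrow> Q \<circ>\<^sub>t P \<in> N_cl \<Omega> S)"
  proof (intro ballI conjI impI)
    fix P Q assume P: "P \<in> S_cl \<Omega> S" and Q: "Q \<in> S_cl \<Omega> S"
    show "Q \<circ>\<^sub>t P \<in> S_cl \<Omega> S" by (rule symbol_comp_in_S_cl[OF S P Q])
    assume "P \<in> N_cl \<Omega> S \<or> Q \<in> N_cl \<Omega> S"
    then show "Q \<circ>\<^sub>t P \<in> N_cl \<Omega> S"
    proof
      assume "P \<in> N_cl \<Omega> S"
      with Q show ?thesis
        unfolding N_cl_iff[of P] S_cl_iff by (intro symbol_comp_in_N_cl growth_psum_star_conv_right S) auto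
    next
      assume "Q \<in> N_cl \<Omega> S"
      with P show ?thesis
        unfolding N_cl_iff[of Q] S_cl_iff by (intro symbol_comp_in_N_cl growth_psum_star_conv_left S) auto
    qed
  qed
  show "\<forall>P \<in> S_cl \<Omega> S. \<forall>Q \<in> S_cl \<Omega> S. \<forall>R \<in> S_cl \<Omega> S.
        \<forall>d>0. \<forall>\<rho>\<in>{0<..<1}.
          coeffs_holo \<Omega> S d \<rho> P \<and> coeffs_holo \<Omega> S d \<rho> Q \<and> coeffs_holo \<Omega> S d \<rho> R \<longrightarrow>
          (\<forall>\<nu>. \<forall>(z, \<zeta>) \<in> symbol_domain \<Omega> d \<rho>. \<forall>\<eta>\<in>S.
             (R \<circ>\<^sub>t (Q \<circ>\<^sub>t P)) \<nu> z \<zeta> \<eta> = ((R \<circ>\<^sub>t Q) \<circ>\<^sub>t P) \<nu> z \<zeta> \<eta>)"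
    \<comment> \<open>Both sides involve only germs of the coefficients at the given point, so the
      identity holds on the whole domain.\<close>
    unfolding coeffs_holo_iff
    by (auto intro!: symbol_comp_assoc holo3_slice)
  show "\<forall>\<Phi> W Z J. coord_transformation \<Phi> W Z \<and> fst ` closure \<Omega> \<subseteq> Z \<and> is_J_star J \<Phi> W Z \<longrightarrow>
        (\<forall>P \<in> S_cl \<Omega> S. \<forall>Q \<in> S_cl \<Omega> S.
         \<forall>d>0. \<forall>\<rho>\<in>{0<..<1}.
          coeffs_holo \<Omega> S d \<rho> P \<and> coeffs_holo \<Omega> S d \<rho> Q \<longrightarrow>
          (\<forall>\<nu> w \<mu>. \<forall>\<eta>\<in>S. w \<in> W \<and> cotangent_map \<Phi> J (w, \<mu>) \<in> symbol_domain \<Omega> d \<rho> \<longrightarrow>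
             (pullback \<Phi> J Q \<circ>\<^sub>t pullback \<Phi> J P) \<nu> w \<mu> \<eta> = pullback \<Phi> J (Q \<circ>\<^sub>t P) \<nu> w \<mu> \<eta>))"
  proof (intro allI ballI impI, elim conjE)
    fix \<Phi> :: "complex ^ 'n \<Rightarrow> complex ^ 'n" and W Z J P Q d \<rho> \<nu> w \<mu> \<eta>
    assume ct: "coord_transformation \<Phi> W Z" and J: "is_J_star J \<Phi> W Z"
      and PQ: "coeffs_holo \<Omega> S d \<rho> P" "coeffs_holo \<Omega> S d \<rho> Q"
      and \<eta>: "\<eta> \<in> S" and w: "w \<in> W" and cm: "cotangent_map \<Phi> J (w, \<mu>) \<in> symbol_domain \<Omega> d \<rho>"
    let ?\<Psi> = "inv_into W \<Phi>"
    have W: "open W" "open Z" "bij_betw \<Phi> W Z" using ct by (auto simp: coord_transformation_def)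
    have z: "\<Phi> w \<in> Z" using W(3) w by (auto simp: bij_betw_def)
    obtain N where N: "open N" "(\<Phi> w, \<Phi> w) \<in> N"
      and hN: "\<And>i j. holo_on mult_i2 (\<lambda>(z', z). J z' z $ i $ j) N"
      and eqN: "\<And>z' z. (z', z) \<in> N \<Longrightarrow> ?\<Psi> z' - ?\<Psi> z = J z' z *v (z' - z)"
      using J z unfolding is_J_star_def by blast
    \<comment> \<open>The pullback at \<open>(w, \<mu>)\<close> sees the coefficients near the
      transported covector only, and that covector lies in the symbol domain by assumption.\<close>
    have PQ': "holo (\<lambda>(z, \<zeta>). F j z \<zeta> \<eta>) (cotangent_map \<Phi> J (w, \<mu>))" if "coeffs_holo \<Omega> S d \<rho> F" for F j
      using that cm \<eta> unfolding coeffs_holo_iff by (cases "cotangent_map \<Phi> J (w, \<mu>)") (auto intro: holo3_slice)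
    show "(pullback \<Phi> J Q \<circ>\<^sub>t pullback \<Phi> J P) \<nu> w \<mu> \<eta> = pullback \<Phi> J (Q \<circ>\<^sub>t P) \<nu> w \<mu> \<eta>"
    proof (rule pullback_symbol_comp[where \<Psi>="?\<Psi>"])
      show "holo \<Phi> w"
        using ct W w by (intro holo_vecI) (auto simp: coord_transformation_def imul_cotangent intro: holo_on_holo)
      show "holo ?\<Psi> (\<Phi> w)"
        using ct W z by (intro holo_vecI) (auto simp: coord_transformation_def imul_cotangent intro: holo_on_holo)
      show "?\<Psi> (\<Phi> w) = w" using W(3) w by (simp add: bij_betw_def)
      show "\<forall>\<^sub>F x in nhds (\<Phi> w). \<Phi> (?\<Psi> x) = x"
        unfolding eventually_nhds using W z by (intro exI[of _ Z]) (auto simp: bij_betw_inv_into_right)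
      show "holo (\<lambda>(a, b). J a b $ i $ j) (\<Phi> w, \<Phi> w)" for i j
        using hN N by (auto simp: imul_cotangent intro: holo_on_holo)
      show "\<forall>\<^sub>F P in nhds (\<Phi> w, \<Phi> w). ?\<Psi> (fst P) - ?\<Psi> (snd P) = J (fst P) (snd P) *v (fst P - snd P)"
        unfolding eventually_nhds using N eqN by (intro exI[of _ N]) auto
    qed (intro PQ' PQ)+
  qed
qed

end
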